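(* Let the domain $\Omega$, the surface $\Gamma$, the operator $A_0$, the function $\xi$, the numbers $d$, $m$, $Z$, the sets $\Omega_d$, the integer $N\ge2$ and the vector function $P(x,\nabla V)$ be as described in the context; in particular $A_0$ admits the pointwise Carleman estimate in $\Omega_d$ with the weight $\varphi_\lambda=e^{\lambda\xi}$. Suppose that there exist two $N$-dimensional vector functions $V^{(1)},V^{(2)}\in C^2(\overline\Omega)$, each satisfying $$A_0(x,V^{(i)})-P(x,\nabla V^{(i)})=0,\quad x\in\Omega,\ i=1,2,$$ with boundary data $V^{(i)}|_\Gamma=p_0^{(i)}(x)$ and $\partial_nV^{(i)}|_\Gamma=p_1^{(i)}(x)$, $i=1,2$. Let $K>0$ be such that $\|V^{(i)}\|_{C^1(\overline\Omega)}\le K$ for $i=1,2$. Let $\sigma\in(0,1)$ be the level of the error in the data, i.e. $$\|p_0^{(1)}-p_0^{(2)}\|_{H^1(\Gamma)}\le\sigma,\qquad \|p_1^{(1)}-p_1^{(2)}\|_{L_2(\Gamma)}\le\sigma .$$ Choose a number $c>0$ such that $\Omega_{d+c}\ne\varnothing$. Then there exist a sufficiently small constant $\sigma_0=\sigma_0(\Omega,K,Z,\xi,m,c)\in(0,1)$ and a constant $C_2=C_2(\Omega,K,Z,\xi,m,c)>0$, both depending only on the listed parameters ($A_0,\Gamma,d,N$ being fixed), such that for all $\sigma\in(0,\sigma_0)$ the following H\"older stability estimate is valid: $$\|V^{(1)}-V^{(2)}\|_{H^1(\Omega_{d+c})}\le C_2\left(1+\|V^{(1)}-V^{(2)}\|_{H^2(\Omega)}\right)\sigma^{\rho},\qquad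 \rho=\frac{c}{m+c}.$$ In particular, if $p_0^{(1)}=p_0^{(2)}$ and $p_1^{(1)}=p_1^{(2)}$ (i.e. if $\sigma=0$), then $V^{(1)}(x)=V^{(2)}(x)$ in $\Omega_d$.
   Context: All functions are real valued. A vector function belongs to a function space if each component does, and its norm is the square root of the sum of the squares of the norms of its components. **Operator.** $x\in\mathbb R^n$; $\Omega\subset\mathbb R^n$ is a bounded domain with piecewise smooth boundary. For multiindices $\alpha$, let $A(x,u)=\sum_{|\alpha|\le2}a_\alpha(x)D_x^\alpha u$ with principal part $A_0(x,u)=\sum_{|\alpha|=2}a_\alpha(x)D^\alpha_xu$. The coefficients satisfy $a_\alpha\in C^1(\mathbb R^n)$ for $|\alpha|\le2$, $a_\alpha$ is constant outside $\Omega$, and $\|a_\alpha\|_{C^1(\overline\Omega)}\le Z$ for $|\alpha|\le1$, where $Z>0$ is a given number. For a vector function $V=(v_0,\dots,v_{N-1})^T$ put $A_0(x,V)=(A_0(x,v_0),\dots,A_0(x,v_{N-1}))^T$. **Geometry.** $\Gamma\in C^2$, $\Gamma\subseteq\partial\Omega$ is a part of the boundary, and no part of $\Gamma$ is a characteristic surface of $A_0$. $\partial_n$ is the normal derivative. The function $\xi\in C^\infty(\overline\Omega)$ satisfies $|\nabla\xi|\neq0$ in $\overline\Omega$. For a number $d>0$ let $\xi_d=\{x\in\Omega:\xi(x)=d\}$, $\Omega_d=\{x\in\Omega:\xi(x)>d\}$ (similarly $\Omega_{d+c}$), $\Gamma_d=\{x\in\Gamma:\xi(x)>d\}$. It is assumed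 that $\Omega_d\neq\varnothing$, that the part of $\overline{\Omega}_d\cap\partial\Omega$ where $\xi>d$ is $\Gamma_d\subseteq\Gamma$, that $\partial\Omega_d$ is the union of the closures of $\xi_d$ and $\Gamma_d$, and that $\partial\Omega_d$ is piecewise smooth. Let $m=\max_{\overline{\Omega}_d}\xi$ and $\varphi_\lambda(x)=\exp(\lambda\xi(x))$, $\lambda>1$. **Carleman estimate.** $A_0$ admits the pointwise Carleman estimate in $\Omega_d$ with weight $\varphi_\lambda$ if there exist constants $\lambda_0=\lambda_0(A_0,\Omega_d)>1$ and $C_1=C_1(A_0,\Omega_d)>0$ such that for all $\lambda\ge\lambda_0$, all $x\in\overline{\Omega}_d$ and all $u\in C^2(\overline{\Omega}_d)$ $$(A_0u)^2\varphi_\lambda^2\ge C_1\lambda|\nabla u|^2\varphi_\lambda^2+C_1\lambda^3u^2\varphi_\lambda^2+\operatorname{div}U,\qquad |U(x)|\le C_1\lambda^3\left[|\nabla u|^2+u^2\right]\varphi_\lambda^2(x),$$ with a $C^1(\overline\Omega_d)$ vector field $U$ depending on $u$ and $\lambda$. This is assumed to hold. **The vector function $P$.** Let $[\cdot,\cdot]$ be the scalar product of $L_2(0,1)$ (functions of $x_0\in(0,1)$), and let $\{\psi_k\}_{k\ge0}$ be the orthonormal basis of $L_2(0,1)$ obtained by Gram--Schmidt from $e^{x_0},x_0e^{x_0},x_0^2e^{x_0},\dots$. Fix an integer $N\ge2$ and let $M_N$ be the $N\times N$ matrix with entries $a_{mk}=[\psi_k',\psi_m]$, $0\le m,k\le N-1$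 ($m$ the row index); it is invertible. For $q,r\in\mathbb R^n$ put $F_1(x,q)=\sum_{1\le|\alpha|\le2}a_\alpha(x)q^\alpha$ and $F_2(x,q,r)=\sum_{i=1}^n\partial_{q_i}F_1(x,q)\,r_i$. (These arise from substituting $u=e^v$ into the equation $A(x,u)=0$ in $\Omega$, which gives $A_0(x,v)+F_1(x,\nabla v)=-a_0(x)$, and then differentiating in the parameter $x_0$.) For $V=(v_0,\dots,v_{N-1})^T$ let $F(x,\nabla V)$ be the vector with components, $m'=0,\dots,N-1$, $$-\left[F_2\left(x,\sum_{k=0}^{N-1}\nabla v_k(x)\psi_k(x_0),\sum_{k=0}^{N-1}\nabla v_k(x)\psi_k'(x_0)\right),\psi_{m'}(x_0)\right],$$ and $P(x,\nabla V)=M_N^{-1}F(x,\nabla V)$. Each component of $P$ is a quadratic function of the first derivatives $\partial_{x_k}v_i$, with coefficients that are $C^1$ in $x$. *)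

theory Defs
  imports "HOL-Analysis.Analysis"
begin

text \<open>
  The space \<open>C\<^sup>k\<close> of the closure of an open set \<open>S\<close> consists of the functions that are \<open>k\<close> times
  continuously differentiable in \<open>S\<close> and whose derivatives up to order \<open>k\<close> extend continuously to
  the closure. Only values on \<open>closure S\<close> matter. On the boundary, a derivative always means the
  limit from inside \<open>S\<close>. For \<open>S = UNIV\<close> this is the usual space \<open>C\<^sup>k\<close> of the whole space.
\<close>

definition part_deriv :: "(real^'n) set \<Rightarrow> 'n \<Rightarrow> (real^'n \<Rightarrow> real) \<Rightarrow> real^'n \<Rightarrow> real" where
  "part_deriv S i f x =
     (if x \<in> S then frechet_derivative f (at x) (axis i 1)
      else Lim (at x within S) (\<lambda>y. frechet_derivative f (at y) (axis i 1)))"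

definition grad :: "(real^'n) set \<Rightarrow> (real^'n \<Rightarrow> real) \<Rightarrow> real^'n \<Rightarrow> real^'n" where
  "grad S f x = (\<chi> i. part_deriv S i f x)"

definition divergence :: "(real^'n) set \<Rightarrow> (real^'n \<Rightarrow> real^'n) \<Rightarrow> real^'n \<Rightarrow> real" where
  "divergence S U x = (\<Sum>i\<in>UNIV. part_deriv S i (\<lambda>y. U y $ i) x)"

fun Ck_closure :: "nat \<Rightarrow> (real^'n) set \<Rightarrow> (real^'n \<Rightarrow> real) \<Rightarrow> bool" where
  "Ck_closure 0 S f \<longleftrightarrow> continuous_on (closure S) f"
| "Ck_closure (Suc k) S f \<longleftrightarrow> continuous_on (closure S) f \<and> (\<forall>x\<in>S. f differentiable (at x)) \<and>
     (\<forall>i. Ck_closure k S (part_deriv S i f))"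

type_synonym 'n multiindex = "'n \<Rightarrow> nat"

definition mi_order :: "('n::finite) multiindex \<Rightarrow> nat" where
  "mi_order \<alpha> = (\<Sum>i\<in>UNIV. \<alpha> i)"

definition mono_power :: "real^'n \<Rightarrow> 'n multiindex \<Rightarrow> real" where
  "mono_power q \<alpha> = (\<Prod>i\<in>UNIV. (q $ i) ^ \<alpha> i)"

fun part_derivs :: "(real^'n) set \<Rightarrow> 'n list \<Rightarrow> (real^'n \<Rightarrow> real) \<Rightarrow> real^'n \<Rightarrow> real" where
  "part_derivs S [] f = f"
| "part_derivs S (i # is) f = part_deriv S i (part_derivs S is f)"

text \<open>
  The index type carries no order, so the partial derivatives in \<open>D\<^sup>\<alpha>\<close> are taken in an arbitrary
  order; for functions of class \<open>C\<^sup>k\<close> with \<open>k \<ge> |\<alpha>|\<close> the order is irrelevant.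
\<close>

definition multi_deriv ::
    "(real^'n) set \<Rightarrow> 'n multiindex \<Rightarrow> (real^'n \<Rightarrow> real) \<Rightarrow> real^'n \<Rightarrow> real" where
  "multi_deriv S \<alpha> f = part_derivs S (SOME is. \<forall>i. count_list is i = \<alpha> i) f"

definition Ck_norm :: "nat \<Rightarrow> (real^'n) set \<Rightarrow> (real^'n \<Rightarrow> real) \<Rightarrow> real" where
  "Ck_norm k S f = (\<Sum>\<alpha> | mi_order \<alpha> \<le> k. SUP x\<in>closure S. \<bar>multi_deriv S \<alpha> f x\<bar>)"

text \<open>A vector function with \<open>N\<close> components is a family \<open>V k\<close>, of which only \<open>k < N\<close> is relevant.\<close>

definition Ck_norm_vec :: "nat \<Rightarrow> nat \<Rightarrow> (real^'n) set \<Rightarrow> (nat \<Rightarrow> real^'n \<Rightarrow> real) \<Rightarrow> real" where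
  "Ck_norm_vec N k S V = sqrt (\<Sum>j<N. (Ck_norm k S (V j))\<^sup>2)"

text \<open>
  Hausdorff measure, normalised so that in integer dimension it agrees with the surface measure.
  The convention \<open>0 ^ 0 = 1\<close> makes the \<open>0\<close>-dimensional measure the counting measure.
\<close>

definition hausdorff_pre :: "nat \<Rightarrow> real \<Rightarrow> 'a::metric_space set \<Rightarrow> ennreal" where
  "hausdorff_pre k \<delta> A =
     (INF C\<in>{C :: nat \<Rightarrow> 'a set. A \<subseteq> (\<Union>i. C i) \<and> (\<forall>i. bounded (C i) \<and> diameter (C i) \<le> \<delta>)}.
        \<Sum>i. if C i = {} then 0
             else ennreal (unit_ball_vol (real k) * (diameter (C i) / 2) ^ k))"

definition hausdorff_outer :: "nat \<Rightarrow> 'a::metric_space set \<Rightarrow> ennreal" where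
  "hausdorff_outer k A = (SUP \<delta>\<in>{0<..}. hausdorff_pre k \<delta> A)"

definition surface_measure :: "(real^'n) measure" where
  "surface_measure = measure_of UNIV (sets borel) (hausdorff_outer (CARD('n) - 1))"

definition local_defining_fun ::
    "nat \<Rightarrow> (real^'n) set \<Rightarrow> (real^'n) set \<Rightarrow> (real^'n \<Rightarrow> real) \<Rightarrow> bool" where
  "local_defining_fun k \<Omega> U g \<longleftrightarrow>
     open U \<and> Ck_closure k U g \<and> (\<forall>x\<in>U. grad U g x \<noteq> 0) \<and>
     \<Omega> \<inter> U = {x \<in> U. g x < 0} \<and> frontier \<Omega> \<inter> U = {x \<in> U. g x = 0}"

text \<open>
  Boundary portion of class \<open>C\<^sup>k\<close> in the sense of Gilbarg and Trudinger: relatively open in the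
  boundary, with the domain locally on one side of a \<open>C\<^sup>k\<close> hypersurface.
\<close>

definition boundary_portion :: "nat \<Rightarrow> (real^'n) set \<Rightarrow> (real^'n) set \<Rightarrow> bool" where
  "boundary_portion k \<Omega> T \<longleftrightarrow>
     openin (top_of_set (frontier \<Omega>)) T \<and> (\<forall>x\<in>T. \<exists>U g. x \<in> U \<and> local_defining_fun k \<Omega> U g)"

definition outward_normal :: "(real^'n) set \<Rightarrow> real^'n \<Rightarrow> real^'n" where
  "outward_normal \<Omega> x = (THE \<nu>. \<exists>U g. x \<in> U \<and> local_defining_fun 1 \<Omega> U g \<and> \<nu> = sgn (grad U g x))"

text \<open>
  Piecewise smooth: finitely many connected open faces of class \<open>C\<^sup>1\<close>, which leave out only a set
  (edges, corners) of surface measure zero contained in the closures of the faces.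
\<close>

definition piecewise_smooth_boundary :: "(real^'n) set \<Rightarrow> bool" where
  "piecewise_smooth_boundary \<Omega> \<longleftrightarrow>
     (\<exists>\<T>. finite \<T> \<and> (\<forall>T\<in>\<T>. connected T \<and> boundary_portion 1 \<Omega> T) \<and>
        frontier \<Omega> = (\<Union>T\<in>\<T>. closure T) \<and>
        emeasure surface_measure (frontier \<Omega> - \<Union>\<T>) = 0 \<and>
        emeasure surface_measure (frontier \<Omega>) < \<infinity>)"

definition bounded_domain :: "(real^'n) set \<Rightarrow> bool" where
  "bounded_domain \<Omega> \<longleftrightarrow> open \<Omega> \<and> connected \<Omega> \<and> bounded \<Omega> \<and> \<Omega> \<noteq> {}"

definition normal_deriv :: "(real^'n) set \<Rightarrow> (real^'n \<Rightarrow> real) \<Rightarrow> real^'n \<Rightarrow> real" where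
  "normal_deriv \<Omega> f x = outward_normal \<Omega> x \<bullet> grad \<Omega> f x"

text \<open>The tangential gradient of a function that is given on the boundary portion \<open>\<Gamma>\<close> only.\<close>

definition surface_grad ::
    "(real^'n) set \<Rightarrow> (real^'n) set \<Rightarrow> (real^'n \<Rightarrow> real) \<Rightarrow> real^'n \<Rightarrow> real^'n" where
  "surface_grad \<Omega> \<Gamma> p x =
     (THE g. g \<bullet> outward_normal \<Omega> x = 0 \<and> (p has_derivative (\<lambda>h. g \<bullet> h)) (at x within \<Gamma>))"

text \<open>
  The norms take values in \<open>ennreal\<close>, so that an infinite norm is not confused with \<open>0\<close>. They are
  applied to classically differentiable functions only.
\<close>

definition esqrt :: "ennreal \<Rightarrow> ennreal" where
  "esqrt t = (if t = \<infinity> then \<infinity> else ennreal (sqrt (enn2real t)))"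

definition Hk_norm_vec ::
    "nat \<Rightarrow> nat \<Rightarrow> (real^'n) set \<Rightarrow> (nat \<Rightarrow> real^'n \<Rightarrow> real) \<Rightarrow> ennreal" where
  "Hk_norm_vec N k S V =
     esqrt (\<Sum>j<N. \<Sum>\<alpha> | mi_order \<alpha> \<le> k.
       \<integral>\<^sup>+x\<in>S. ennreal ((multi_deriv S \<alpha> (V j) x)\<^sup>2) \<partial>lborel)"

definition L2_surface_norm_vec ::
    "nat \<Rightarrow> (real^'n) set \<Rightarrow> (nat \<Rightarrow> real^'n \<Rightarrow> real) \<Rightarrow> ennreal" where
  "L2_surface_norm_vec N \<Gamma> p = esqrt (\<Sum>j<N. \<integral>\<^sup>+x\<in>\<Gamma>. ennreal ((p j x)\<^sup>2) \<partial>surface_measure)"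

definition H1_surface_norm_vec ::
    "nat \<Rightarrow> (real^'n) set \<Rightarrow> (real^'n) set \<Rightarrow> (nat \<Rightarrow> real^'n \<Rightarrow> real) \<Rightarrow> ennreal" where
  "H1_surface_norm_vec N \<Omega> \<Gamma> p =
     esqrt (\<Sum>j<N. \<integral>\<^sup>+x\<in>\<Gamma>. ennreal ((p j x)\<^sup>2 + (norm (surface_grad \<Omega> \<Gamma> (p j) x))\<^sup>2)
       \<partial>surface_measure)"

text \<open>
  The coefficient family \<open>a\<close> is indexed by all multi-indices; only orders up to \<open>2\<close> are relevant,
  and only order \<open>2\<close> enters the principal part.
\<close>

definition principal_part ::
    "('n multiindex \<Rightarrow> real^'n \<Rightarrow> real) \<Rightarrow> (real^'n) set \<Rightarrow> (real^'n \<Rightarrow> real) \<Rightarrow> real^'n \<Rightarrow> real" where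
  "principal_part a S u x = (\<Sum>\<alpha> | mi_order \<alpha> = 2. a \<alpha> x * multi_deriv S \<alpha> u x)"

definition admissible_coeff :: "(real^'n) set \<Rightarrow> (real^'n \<Rightarrow> real) \<Rightarrow> bool" where
  "admissible_coeff \<Omega> f \<longleftrightarrow> Ck_closure 1 UNIV f \<and> (\<exists>C. \<forall>x. x \<notin> \<Omega> \<longrightarrow> f x = C)"

definition characteristic_on ::
    "('n multiindex \<Rightarrow> real^'n \<Rightarrow> real) \<Rightarrow> (real^'n) set \<Rightarrow> (real^'n) set \<Rightarrow> bool" where
  "characteristic_on a \<Omega> T \<longleftrightarrow>
     (\<forall>x\<in>T. (\<Sum>\<alpha> | mi_order \<alpha> = 2. a \<alpha> x * mono_power (outward_normal \<Omega> x) \<alpha>) = 0)"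

definition superlevel :: "(real^'n) set \<Rightarrow> (real^'n \<Rightarrow> real) \<Rightarrow> real \<Rightarrow> (real^'n) set" where
  "superlevel A \<xi> d = {x \<in> A. \<xi> x > d}"

definition level_set :: "(real^'n) set \<Rightarrow> (real^'n \<Rightarrow> real) \<Rightarrow> real \<Rightarrow> (real^'n) set" where
  "level_set A \<xi> d = {x \<in> A. \<xi> x = d}"

definition carleman_weight :: "(real^'n \<Rightarrow> real) \<Rightarrow> real \<Rightarrow> real^'n \<Rightarrow> real" where
  "carleman_weight \<xi> l x = exp (l * \<xi> x)"

definition carleman_estimate ::
    "('n multiindex \<Rightarrow> real^'n \<Rightarrow> real) \<Rightarrow> (real^'n) set \<Rightarrow> (real^'n \<Rightarrow> real) \<Rightarrow> bool" where
  "carleman_estimate a D \<xi> \<longleftrightarrow>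
     (\<exists>l\<^sub>0 > 1. \<exists>C\<^sub>1 > 0. \<forall>l \<ge> l\<^sub>0. \<forall>u. Ck_closure 2 D u \<longrightarrow>
        (\<exists>U. (\<forall>i. Ck_closure 1 D (\<lambda>y. U y $ i)) \<and>
           (\<forall>x\<in>closure D.
              (principal_part a D u x)\<^sup>2 * (carleman_weight \<xi> l x)\<^sup>2
                \<ge> C\<^sub>1 * l * (norm (grad D u x))\<^sup>2 * (carleman_weight \<xi> l x)\<^sup>2
                  + C\<^sub>1 * l ^ 3 * (u x)\<^sup>2 * (carleman_weight \<xi> l x)\<^sup>2
                  + divergence D U x \<and>
              norm (U x)
                \<le> C\<^sub>1 * l ^ 3 * ((norm (grad D u x))\<^sup>2 + (u x)\<^sup>2) * (carleman_weight \<xi> l x)\<^sup>2)))"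

definition L2_inner :: "(real \<Rightarrow> real) \<Rightarrow> (real \<Rightarrow> real) \<Rightarrow> real" where
  "L2_inner f g = (LINT t:{0<..<1}|lborel. f t * g t)"

definition L2_normalize :: "(real \<Rightarrow> real) \<Rightarrow> real \<Rightarrow> real" where
  "L2_normalize f t = f t / sqrt (L2_inner f f)"

text \<open>Gram-Schmidt orthonormalisation of \<open>t\<^sup>k e\<^sup>t\<close> in \<open>L\<^sub>2(0,1)\<close>.\<close>

fun psi :: "nat \<Rightarrow> real \<Rightarrow> real" where
  "psi k = L2_normalize (\<lambda>t. t ^ k * exp t
     - (\<Sum>j<k. L2_inner (\<lambda>s. s ^ k * exp s) (psi j) * psi j t))"

declare psi.simps [simp del]

definition psi_matrix :: "nat \<Rightarrow> nat \<Rightarrow> real" where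
  "psi_matrix m k = L2_inner (deriv (psi k)) (psi m)"

definition inverse_matrix :: "nat \<Rightarrow> (nat \<Rightarrow> nat \<Rightarrow> real) \<Rightarrow> nat \<Rightarrow> nat \<Rightarrow> real" where
  "inverse_matrix N M = (SOME B. \<forall>i<N. \<forall>j<N.
     (\<Sum>k<N. M i k * B k j) = of_bool (i = j) \<and> (\<Sum>k<N. B i k * M k j) = of_bool (i = j))"

text \<open>
  The substitution \<open>u = exp v\<close> turns \<open>A(x, u) = 0\<close> into \<open>A\<^sub>0(x, v) + F1(x, \<nabla>v) = - a\<^sub>0(x)\<close>. The product
  \<open>q\<^sup>\<alpha>\<close> with \<open>|\<alpha>| = 2\<close> comes from the second derivatives of \<open>exp v\<close>. Differentiation in the parameter
  \<open>x\<^sub>0\<close> gives \<open>F2\<close>, and projection onto the first \<open>N\<close> basis functions gives \<open>P\<close>.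
\<close>

definition F1 :: "('n multiindex \<Rightarrow> real^'n \<Rightarrow> real) \<Rightarrow> real^'n \<Rightarrow> real^'n \<Rightarrow> real" where
  "F1 a x q = (\<Sum>\<alpha> | 1 \<le> mi_order \<alpha> \<and> mi_order \<alpha> \<le> 2. a \<alpha> x * mono_power q \<alpha>)"

definition F2 :: "('n multiindex \<Rightarrow> real^'n \<Rightarrow> real) \<Rightarrow> real^'n \<Rightarrow> real^'n \<Rightarrow> real^'n \<Rightarrow> real" where
  "F2 a x q r = (\<Sum>i\<in>UNIV. part_deriv UNIV i (F1 a x) q * r $ i)"

text \<open>In the following two definitions, \<open>G k\<close> is the value of the gradient of \<open>v\<^sub>k\<close> at \<open>x\<close>.\<close>

definition F_vec ::
    "('n multiindex \<Rightarrow> real^'n \<Rightarrow> real) \<Rightarrow> nat \<Rightarrow> real^'n \<Rightarrow> (nat \<Rightarrow> real^'n) \<Rightarrow> nat \<Rightarrow> real" where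
  "F_vec a N x G m =
     - L2_inner (\<lambda>t. F2 a x (\<Sum>k<N. psi k t *\<^sub>R G k) (\<Sum>k<N. deriv (psi k) t *\<^sub>R G k)) (psi m)"

definition P_vec ::
    "('n multiindex \<Rightarrow> real^'n \<Rightarrow> real) \<Rightarrow> nat \<Rightarrow> real^'n \<Rightarrow> (nat \<Rightarrow> real^'n) \<Rightarrow> nat \<Rightarrow> real" where
  "P_vec a N x G m = (\<Sum>j<N. inverse_matrix N psi_matrix m j * F_vec a N x G j)"

definition solves_cauchy_problem ::
    "('n multiindex \<Rightarrow> real^'n \<Rightarrow> real) \<Rightarrow> nat \<Rightarrow> (real^'n) set \<Rightarrow> (real^'n) set \<Rightarrow>
     (nat \<Rightarrow> real^'n \<Rightarrow> real) \<Rightarrow> (nat \<Rightarrow> real^'n \<Rightarrow> real) \<Rightarrow> (nat \<Rightarrow> real^'n \<Rightarrow> real) \<Rightarrow> bool" where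
  "solves_cauchy_problem a N \<Omega> \<Gamma> V p0 p1 \<longleftrightarrow>
     (\<forall>j<N. Ck_closure 2 \<Omega> (V j)) \<and>
     (\<forall>j<N. \<forall>x\<in>\<Omega>. principal_part a \<Omega> (V j) x - P_vec a N x (\<lambda>k. grad \<Omega> (V k) x) j = 0) \<and>
     (\<forall>j<N. \<forall>x\<in>\<Gamma>. V j x = p0 j x \<and> normal_deriv \<Omega> (V j) x = p1 j x)"

definition vec_diff ::
    "(nat \<Rightarrow> real^'n \<Rightarrow> real) \<Rightarrow> (nat \<Rightarrow> real^'n \<Rightarrow> real) \<Rightarrow> nat \<Rightarrow> real^'n \<Rightarrow> real" where
  "vec_diff V W j x = V j x - W j x"

end

theory Submission
  imports Defs
begin

text \<open>
  The difference \<open>u\<close> of the two solutions has small Cauchy data on \<open>\<Gamma>\<close>. Both gradients are bounded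
  by a multiple of \<open>K\<close>, and \<open>P\<close> is quadratic in the gradients, hence Lipschitz on the relevant set
  (\<open>P_vec_lipschitz\<close>). So \<open>u\<close> satisfies the differential inequality
  \<open>|A\<^sub>0 u\<^sub>j|\<^sup>2 \<le> M \<Sum>\<^sub>k |\<nabla>u\<^sub>k|\<^sup>2\<close> (\<open>difference_inequality\<close>). The pointwise Carleman estimate with weight
  \<open>exp (l \<xi>)\<close> is integrated over \<open>D = {\<xi> > d}\<close>. For large \<open>l\<close> its left-hand side, which carries the
  factor \<open>l\<close>, absorbs the right-hand side of the differential inequality, and only the integral of
  \<open>div U\<close> remains.

  That integral is estimated by the integral of \<open>|U|\<close> over \<open>\<partial>D\<close>
  (\<open>integral_part_deriv_le_boundary\<close>). A bound with some dimensional constant suffices, and such a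
  bound holds on every bounded open set whose boundary has finite Hausdorff measure. One covers \<open>\<partial>D\<close> by small balls of radii \<open>r\<^sub>i\<close>, multiplies by
  Lipschitz cutoffs \<open>\<kappa>\<close> that vanish on these balls, and moves the derivative onto \<open>\<kappa>\<close>. The ball of
  radius \<open>r\<^sub>i\<close> then contributes at most a constant times \<open>r\<^sub>i\<^bsup>n-1\<^esup>\<close> times the size of \<open>U\<close> there,
  which is a term of the sum that defines the Hausdorff measure. To turn the sums into integrals,
  Hausdorff outer measure must be additive on Borel sets, which follows from Caratheodory's criterion
  (\<open>measure_space_hausdorff_outer\<close>).

  On \<open>\<partial>D\<close> one has either \<open>\<xi> \<le> d\<close>, where \<open>u\<close> and \<open>\<nabla>u\<close> are bounded in terms of \<open>K\<close> and the weight
  is at most \<open>exp (l d)\<close>, or a point of \<open>\<Gamma>\<close>, where the weight is at most \<open>exp (l m)\<close>, but \<open>\<nabla>u\<close> splits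
  into the tangential gradient of the Dirichlet datum and the Neumann datum (\<open>norm_grad_boundary\<close>).
  This yields
  \<open>\<integral>\<^sub>D (|\<nabla>u|\<^sup>2 + u\<^sup>2) exp (2 l \<xi>) \<le> C l\<^sup>2 (exp (2 l m) \<sigma>\<^sup>2 + exp (2 l d))\<close>
  (\<open>weighted_stability_estimate\<close>). On \<open>{\<xi> > d + c}\<close> the weight is at least \<open>exp (l (d + c))\<close>. With
  \<open>l = ln (1/\<sigma>) / (m - d)\<close> both terms on the right balance, and the integral of \<open>|\<nabla>u|\<^sup>2 + u\<^sup>2\<close> over this
  set is at most \<open>2 C l\<^sup>2 \<sigma>\<^bsup>2c/(m-d)\<^esup>\<close>. Since \<open>c/(m-d) > c/(m+c)\<close>, the factor \<open>l\<^sup>2\<close> is absorbed as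
  well. For vanishing data one takes \<open>\<sigma> = 0\<close> and lets \<open>l\<close> tend to infinity on \<open>{\<xi> > e}\<close> for every
  \<open>e > d\<close>.
\<close>


section \<open>Hausdorff measure on Borel sets\<close>

lemma hausdorff_pre_empty: "\<delta> \<ge> 0 \<Longrightarrow> hausdorff_pre k \<delta> {} = 0"
  unfolding hausdorff_pre_def
  by (intro antisym INF_lower2[where i="\<lambda>_. {}"]) auto

lemma hausdorff_pre_mono: "A \<subseteq> B \<Longrightarrow> hausdorff_pre k \<delta> A \<le> hausdorff_pre k \<delta> B"
  unfolding hausdorff_pre_def by (intro INF_superset_mono) auto

lemma hausdorff_pre_antimono: "\<delta> \<le> \<delta>' \<Longrightarrow> hausdorff_pre k \<delta>' A \<le> hausdorff_pre k \<delta> A"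
  unfolding hausdorff_pre_def by (intro INF_superset_mono) (auto intro: order_trans)

lemma hausdorff_pre_approx:
  fixes A :: "'a::metric_space set"
  assumes "hausdorff_pre k \<delta> A < b"
  shows "\<exists>C :: nat \<Rightarrow> 'a set. A \<subseteq> (\<Union>i. C i) \<and> (\<forall>i. bounded (C i) \<and> diameter (C i) \<le> \<delta>) \<and>
    (\<Sum>i. if C i = {} then 0 else ennreal (unit_ball_vol (real k) * (diameter (C i) / 2) ^ k)) < b"
  using assms unfolding hausdorff_pre_def INF_less_iff by auto

text \<open>The usual \<open>e / 2\<^bsup>n+1\<^esup>\<close> argument; the double sequence of covering sets is enumerated by pairing.\<close>

lemma hausdorff_pre_countable_subadditive:
  fixes A :: "nat \<Rightarrow> 'a::metric_space set"
  shows "hausdorff_pre k \<delta> (\<Union>n. A n) \<le> (\<Sum>n. hausdorff_pre k \<delta> (A n))"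
proof (rule ennreal_le_epsilon)
  fix e :: real
  assume fin: "(\<Sum>n. hausdorff_pre k \<delta> (A n)) < top" and e: "0 < e"
  define w where "w S = (if S = {} then 0
      else ennreal (unit_ball_vol (real k) * (diameter S / 2) ^ k))" for S :: "'a set"
  have lt: "hausdorff_pre k \<delta> (A n) < hausdorff_pre k \<delta> (A n) + ennreal (e * (1/2) ^ Suc n)" for n
  proof -
    have "hausdorff_pre k \<delta> (A n) < top"
      using fin by (rule ennreal_suminf_lessD)
    then show ?thesis using e
      by (cases "hausdorff_pre k \<delta> (A n)")
         (auto simp: ennreal_less_iff simp flip: ennreal_plus)
  qed
  have "\<exists>C :: nat \<Rightarrow> 'a set. A n \<subseteq> (\<Union>i. C i) \<and> (\<forall>i. bounded (C i) \<and> diameter (C i) \<le> \<delta>) \<and>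
      (\<Sum>i. w (C i)) < hausdorff_pre k \<delta> (A n) + ennreal (e * (1/2) ^ Suc n)" for n
    unfolding w_def by (rule hausdorff_pre_approx[OF lt[of n]])
  then obtain C :: "nat \<Rightarrow> nat \<Rightarrow> 'a set" where C: "\<And>n. A n \<subseteq> (\<Union>i. C n i)"
    "\<And>n i. bounded (C n i)" "\<And>n i. diameter (C n i) \<le> \<delta>"
    "\<And>n. (\<Sum>i. w (C n i)) < hausdorff_pre k \<delta> (A n) + ennreal (e * (1/2) ^ Suc n)"
    by metis
  define D where "D = (\<lambda>m. case_prod C (prod_decode m))"
  have "(\<Union>n. A n) \<subseteq> (\<Union>m. D m)"
  proof
    fix x assume "x \<in> (\<Union>n. A n)"
    then obtain n i where "x \<in> C n i" using C(1) by blast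
    then have "x \<in> D (prod_encode (n, i))" by (simp add: D_def)
    then show "x \<in> (\<Union>m. D m)" by blast
  qed
  moreover have "bounded (D m) \<and> diameter (D m) \<le> \<delta>" for m
    using C(2,3) by (auto simp: D_def split: prod.split)
  ultimately have "hausdorff_pre k \<delta> (\<Union>n. A n) \<le> (\<Sum>m. w (D m))"
    unfolding hausdorff_pre_def w_def by (intro INF_lower) auto
  also have "\<dots> = (\<Sum>n. \<Sum>i. w (C n i))"
    using suminf_ennreal_2dimen[where f="\<lambda>(n,i). w (C n i)" and g="\<lambda>n. \<Sum>i. w (C n i)"]
    by (simp add: D_def case_prod_beta)
  also have "\<dots> \<le> (\<Sum>n. hausdorff_pre k \<delta> (A n) + ennreal (e * (1/2) ^ Suc n))"
    using C(4) by (intro suminf_le summableI) (auto simp: less_imp_le)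
  also have "\<dots> = (\<Sum>n. hausdorff_pre k \<delta> (A n)) + (\<Sum>n. ennreal (e * (1/2) ^ Suc n))"
    by (rule suminf_add[symmetric]; rule summableI)
  also have "(\<Sum>n. ennreal (e * (1/2) ^ Suc n)) = ennreal e"
    using e sums_mult[OF power_half_series, of e] by (intro suminf_ennreal_eq) auto
  finally show "hausdorff_pre k \<delta> (\<Union>n. A n) \<le> (\<Sum>n. hausdorff_pre k \<delta> (A n)) + ennreal e" .
qed

lemma hausdorff_pre_le_outer: "\<delta> > 0 \<Longrightarrow> hausdorff_pre k \<delta> A \<le> hausdorff_outer k A"
  unfolding hausdorff_outer_def by (intro SUP_upper) auto

lemma hausdorff_outer_mono: "A \<subseteq> B \<Longrightarrow> hausdorff_outer k A \<le> hausdorff_outer k B"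
  unfolding hausdorff_outer_def by (intro SUP_mono') (rule hausdorff_pre_mono)

lemma hausdorff_outer_space: "outer_measure_space UNIV (hausdorff_outer k :: 'a::metric_space set \<Rightarrow> _)"
  unfolding outer_measure_space_def
proof (intro conjI)
  show "positive UNIV (hausdorff_outer k :: 'a set \<Rightarrow> _)"
    by (auto simp: positive_def hausdorff_outer_def hausdorff_pre_empty)
  show "increasing UNIV (hausdorff_outer k :: 'a set \<Rightarrow> _)"
    by (auto simp: increasing_def intro: hausdorff_outer_mono)
  show "countably_subadditive UNIV (hausdorff_outer k :: 'a set \<Rightarrow> _)"
    unfolding countably_subadditive_def
  proof (intro allI impI)
    fix A :: "nat \<Rightarrow> 'a set"
    show "hausdorff_outer k (\<Union>n. A n) \<le> (\<Sum>n. hausdorff_outer k (A n))"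
      unfolding hausdorff_outer_def[of k "\<Union>n. A n"]
    proof (rule SUP_least)
      fix \<delta> :: real assume "\<delta> \<in> {0<..}"
      then have "(\<Sum>n. hausdorff_pre k \<delta> (A n)) \<le> (\<Sum>n. hausdorff_outer k (A n))"
        by (intro suminf_le summableI hausdorff_pre_le_outer) auto
      then show "hausdorff_pre k \<delta> (\<Union>n. A n) \<le> (\<Sum>n. hausdorff_outer k (A n))"
        using hausdorff_pre_countable_subadditive order_trans by blast
    qed
  qed
qed

text \<open>
  A covering set of diameter less than \<open>e\<close> meets at most one of the two sets, so every covering of
  the union splits into a covering of \<open>A\<close> and one of \<open>B\<close>.
\<close>

lemma hausdorff_pre_separated:
  fixes A B :: "'a::metric_space set"
  assumes sep: "\<And>x y. x \<in> A \<Longrightarrow> y \<in> B \<Longrightarrow> e \<le> dist x y" and \<delta>: "0 \<le> \<delta>" "\<delta> < e"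
  shows "hausdorff_pre k \<delta> A + hausdorff_pre k \<delta> B \<le> hausdorff_pre k \<delta> (A \<union> B)"
  unfolding hausdorff_pre_def[of k \<delta> "A \<union> B"]
proof (rule INF_greatest, clarify)
  fix C :: "nat \<Rightarrow> 'a set"
  assume cov: "A \<union> B \<subseteq> (\<Union>i. C i)" and C: "\<forall>i. bounded (C i) \<and> diameter (C i) \<le> \<delta>"
  define w where "w S = (if S = {} then 0
      else ennreal (unit_ball_vol (real k) * (diameter S / 2) ^ k))" for S :: "'a set"
  define CA where "CA i = (if C i \<inter> A = {} then {} else C i)" for i
  define CB where "CB i = (if C i \<inter> B = {} then {} else C i)" for i
  have disj: "C i \<inter> A = {} \<or> C i \<inter> B = {}" for i
  proof (rule ccontr)
    assume "\<not> ?thesis"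
    then obtain x y where "x \<in> C i" "x \<in> A" "y \<in> C i" "y \<in> B" by blast
    moreover from this have "dist x y \<le> diameter (C i)"
      using C by (intro diameter_bounded_bound) auto
    ultimately show False using sep[of x y] C \<delta> by (smt (verit))
  qed
  have "A \<subseteq> (\<Union>i. CA i)" "B \<subseteq> (\<Union>i. CB i)"
    using cov by (fastforce simp: CA_def CB_def)+
  moreover have "bounded (CA i) \<and> diameter (CA i) \<le> \<delta>" "bounded (CB i) \<and> diameter (CB i) \<le> \<delta>" for i
    using C \<delta> by (auto simp: CA_def CB_def)
  ultimately have "hausdorff_pre k \<delta> A \<le> (\<Sum>i. w (CA i))" "hausdorff_pre k \<delta> B \<le> (\<Sum>i. w (CB i))"
    unfolding hausdorff_pre_def w_def by (intro INF_lower; simp)+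
  then have "hausdorff_pre k \<delta> A + hausdorff_pre k \<delta> B \<le> (\<Sum>i. w (CA i)) + (\<Sum>i. w (CB i))"
    by (rule add_mono)
  also have "(\<Sum>i. w (CA i)) + (\<Sum>i. w (CB i)) = (\<Sum>i. w (CA i) + w (CB i))"
    by (rule suminf_add; rule summableI)
  also have "(\<Sum>i. w (CA i) + w (CB i)) \<le> (\<Sum>i. w (C i))"
    using disj by (intro suminf_le summableI) (auto simp: CA_def CB_def w_def)
  finally show "hausdorff_pre k \<delta> A + hausdorff_pre k \<delta> B \<le> (\<Sum>i. if C i = {} then 0
      else ennreal (unit_ball_vol (real k) * (diameter (C i) / 2) ^ k))"
    unfolding w_def .
qed

lemma hausdorff_outer_separated:
  fixes A B :: "'a::metric_space set"
  assumes sep: "\<And>x y. x \<in> A \<Longrightarrow> y \<in> B \<Longrightarrow> e \<le> dist x y" and e: "e > 0"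
  shows "hausdorff_outer k A + hausdorff_outer k B \<le> hausdorff_outer k (A \<union> B)"
proof -
  have "hausdorff_outer k A + hausdorff_outer k B
      = (SUP \<delta>\<in>{0<..}. hausdorff_pre k \<delta> A + hausdorff_pre k \<delta> B)"
    unfolding hausdorff_outer_def
    by (rule SUP_add_directed_ennreal[symmetric])
       (metis greaterThan_iff hausdorff_pre_antimono min.cobounded1 min.cobounded2 min_less_iff_conj
         add_mono)
  also have "\<dots> \<le> hausdorff_outer k (A \<union> B)"
  proof (rule SUP_least)
    fix \<delta> :: real assume \<delta>: "\<delta> \<in> {0<..}"
    \<comment> \<open>smaller than the distance of the two sets, and still an admissible mesh size for the supremum\<close>
    define \<delta>' where "\<delta>' = min \<delta> (e/2)"
    have "hausdorff_pre k \<delta> A + hausdorff_pre k \<delta> B \<le> hausdorff_pre k \<delta>' A + hausdorff_pre k \<delta>' B"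
      by (intro add_mono hausdorff_pre_antimono) (auto simp: \<delta>'_def)
    also have "\<dots> \<le> hausdorff_pre k \<delta>' (A \<union> B)"
      using \<delta> e by (intro hausdorff_pre_separated[where e=e] sep) (auto simp: \<delta>'_def)
    also have "\<dots> \<le> hausdorff_outer k (A \<union> B)"
      using \<delta> e by (intro hausdorff_pre_le_outer) (auto simp: \<delta>'_def)
    finally show "hausdorff_pre k \<delta> A + hausdorff_pre k \<delta> B \<le> hausdorff_outer k (A \<union> B)" .
  qed
  finally show ?thesis .
qed

text \<open>
  For closed \<open>F\<close>, the part of \<open>A\<close> at distance at least \<open>1/(n+1)\<close> from \<open>F\<close> is separated from
  \<open>A \<inter> F\<close>. The rest of \<open>A - F\<close> is a union of shells \<open>R j\<close>. Shells that are not neighbours are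
  separated, so the measures of the even shells sum up to at most \<open>h A\<close>, and so do those of the
  odd ones. Hence the tail that is left out is small.
\<close>

lemma caratheodory_criterion_closed:
  fixes h :: "'a::metric_space set \<Rightarrow> ennreal"
  assumes oms: "outer_measure_space UNIV h"
    and sep: "\<And>A B e. e > 0 \<Longrightarrow> (\<And>x y. x \<in> A \<Longrightarrow> y \<in> B \<Longrightarrow> e \<le> dist x y) \<Longrightarrow> h A + h B \<le> h (A \<union> B)"
    and F: "closed F"
  shows "h (A \<inter> F) + h (A - F) \<le> h A"
proof (cases "F = {} \<or> h A = top")
  case True
  have "h {} = 0" using oms by (auto simp: outer_measure_space_def positive_def)
  with True show ?thesis by auto
next
  case False
  then have F0: "F \<noteq> {}" and hA: "h A < top" by (auto simp: top.not_eq_extremum)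
  have mono: "h X \<le> h Y" if "X \<subseteq> Y" for X Y
    using oms that by (auto simp: outer_measure_space_def increasing_def)
  have csa: "subadditive UNIV h" "countably_subadditive UNIV h" and pos: "positive UNIV h"
    using oms ring_of_sets.countably_subadditive_subadditive[of UNIV UNIV h]
    by (auto simp: outer_measure_space_def Pow_UNIV[symmetric] ring_of_sets_Pow simp del: Pow_UNIV)
  have h0: "h {} = 0" using pos by (auto simp: positive_def)
  define q where "q j = 1 / (real j + 1)" for j :: nat
  define R where "R j = {x \<in> A. q (Suc j) \<le> infdist x F \<and> infdist x F < q j}" for j
  define S where "S n = {x \<in> A. q n \<le> infdist x F}" for n
  have q_anti: "q j \<le> q i" if "i \<le> j" for i j using that by (auto simp: q_def divide_simps)
  have q_strict: "q j < q i" if "i < j" for i j using that by (auto simp: q_def divide_simps)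
  have q_pos: "q i > 0" for i by (simp add: q_def)
  have R_sep: "q j - q (Suc j) \<le> dist x y" if "x \<in> R i" "y \<in> R (Suc j)" "i < j" for i j x y
  proof -
    have "q j \<le> infdist x F" using that q_anti[of "Suc i" j] by (auto simp: R_def)
    moreover have "infdist y F < q (Suc j)" using that by (auto simp: R_def)
    moreover have "infdist x F \<le> infdist y F + dist x y" by (rule infdist_triangle)
    ultimately show ?thesis by simp
  qed
  have part: "(\<Sum>j<n. h (R (2*j+p))) \<le> h (\<Union>j<n. R (2*j+p))" for n p
  proof (induction n)
    case 0
    then show ?case by simp
  next
    case (Suc n)
    have "h (\<Union>j<n. R (2*j+p)) + h (R (2*n+p)) \<le> h ((\<Union>j<n. R (2*j+p)) \<union> R (2*n+p))"
    proof (cases n)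
      case 0
      then show ?thesis by (simp add: h0)
    next
      case (Suc m)
      show ?thesis
      proof (rule sep[where e="q (2*m+1+p) - q (Suc (2*m+1+p))"])
        show "q (2*m+1+p) - q (Suc (2*m+1+p)) > 0" using q_strict by simp
        fix x y assume "x \<in> (\<Union>j<n. R (2*j+p))" "y \<in> R (2*n+p)"
        then obtain j where "j < n" "x \<in> R (2*j+p)" "y \<in> R (Suc (2*m+1+p))"
          using Suc by auto
        then show "q (2*m+1+p) - q (Suc (2*m+1+p)) \<le> dist x y"
          using Suc by (intro R_sep[of _ "2*j+p"]) auto
      qed
    qed
    also have "(\<Union>j<n. R (2*j+p)) \<union> R (2*n+p) = (\<Union>j<Suc n. R (2*j+p))"
      by (auto simp: less_Suc_eq)
    finally have "h (\<Union>j<n. R (2*j+p)) + h (R (2*n+p)) \<le> h (\<Union>j<Suc n. R (2*j+p))" .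
    then show ?case using order_trans[OF add_right_mono[OF Suc.IH]] by simp
  qed
  have partA: "(\<Sum>j<n. h (R (2*j+p))) \<le> h A" for n p
    by (rule order_trans[OF part mono]) (auto simp: R_def)
  have "(\<Sum>j. h (R j)) \<le> 2 * h A"
  proof (rule suminf_le_const[OF summableI])
    fix n
    have split: "(\<Sum>j<2*n. h (R j)) = (\<Sum>j<n. h (R (2*j+0))) + (\<Sum>j<n. h (R (2*j+1)))"
      by (induction n) (auto simp: algebra_simps)
    have "(\<Sum>j<n. h (R j)) \<le> (\<Sum>j<2*n. h (R j))"
      by (intro sum_mono2) auto
    also have "\<dots> \<le> h A + h A"
      unfolding split by (intro add_mono partA)
    finally show "(\<Sum>j<n. h (R j)) \<le> 2 * h A" by (simp add: mult_2)
  qed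
  also have "\<dots> < top" using hA by (simp add: ennreal_mult_less_top)
  finally have Rfin: "(\<Sum>j. h (R j)) < top" .
  define r where "r j = enn2real (h (R j))" for j
  have hR: "h (R j) = ennreal (r j)" for j
    using ennreal_suminf_lessD[OF Rfin, of j] by (simp add: r_def)
  have r0: "r j \<ge> 0" for j by (simp add: r_def)
  have "summable r"
    using Rfin unfolding hR by (intro summable_suminf_not_top) (auto simp: r0)
  show ?thesis
  proof (rule ennreal_le_epsilon)
    fix e :: real assume "0 < e"
    \<comment> \<open>the shells from \<open>n\<close> on have total measure below \<open>e\<close>\<close>
    obtain n where n: "norm (\<Sum>i. r (i + n)) < e"
      using suminf_exist_split[OF \<open>0 < e\<close> \<open>summable r\<close>] by auto
    have tail: "(\<Sum>i. h (R (i + n))) \<le> ennreal e"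
    proof -
      have "(\<Sum>i. h (R (i + n))) = ennreal (\<Sum>i. r (i + n))"
        unfolding hR using \<open>summable r\<close> r0
        by (intro suminf_ennreal2) (auto simp: summable_iff_shift)
      also have "\<dots> \<le> ennreal e" using n by (intro ennreal_leI) auto
      finally show ?thesis .
    qed
    have "A - F \<subseteq> S n \<union> (\<Union>i. R (i + n))"
    proof
      fix x assume x: "x \<in> A - F"
      then have pos: "infdist x F > 0"
        using F F0 in_closed_iff_infdist_zero[of F x] infdist_nonneg[of x F] by auto
      show "x \<in> S n \<union> (\<Union>i. R (i + n))"
      proof (cases "q n \<le> infdist x F")
        case True then show ?thesis using x by (auto simp: S_def)
      next
        case nle: False
        have ex: "\<exists>m. q m \<le> infdist x F"
        proof -
          obtain m where "1 / real (Suc m) < infdist x F" using nat_approx_posE[OF pos] by blast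
          then show ?thesis by (intro exI[of _ m]) (auto simp: q_def add.commute)
        qed
        define M where "M = (LEAST m. q m \<le> infdist x F)"
        have M: "q M \<le> infdist x F" unfolding M_def using ex by (rule LeastI_ex)
        have M': "infdist x F < q j" if "j < M" for j
          using not_less_Least[of j "\<lambda>m. q m \<le> infdist x F"] that unfolding M_def by (auto simp: not_le)
        have "M > n" using nle M q_anti[of M n] by (meson not_le order_trans)
        then obtain m where m: "M = Suc (m + n)"
          by (metis add.commute less_iff_Suc_add)
        then have "x \<in> R (m + n)" using M M'[of "m+n"] x by (auto simp: R_def)
        then show ?thesis by blast
      qed
    qed
    then have "h (A - F) \<le> h (S n \<union> (\<Union>i. R (i + n)))" by (rule mono)
    also have "\<dots> \<le> h (S n) + h (\<Union>i. R (i + n))"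
    proof -
      have "h (S n \<union> (\<Union>i. R (i + n))) = h (S n \<union> ((\<Union>i. R (i + n)) - S n))" by (simp only: Un_Diff_cancel)
      also have "\<dots> \<le> h (S n) + h ((\<Union>i. R (i + n)) - S n)"
        using csa(1)[unfolded subadditive_def, rule_format, of "S n" "(\<Union>i. R (i + n)) - S n"] by simp
      also have "\<dots> \<le> h (S n) + h (\<Union>i. R (i + n))" by (intro add_left_mono mono) auto
      finally show ?thesis .
    qed
    also have "h (\<Union>i. R (i + n)) \<le> (\<Sum>i. h (R (i + n)))"
    proof -
      have "disjoint_family (\<lambda>i. R (i + n))"
        unfolding disjoint_family_on_def
      proof (intro ballI impI)
        have *: "R i \<inter> R j = {}" if "i < j" for i j
          using q_anti[of "Suc i" j] that by (auto simp: R_def)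
        fix i j :: nat assume "i \<noteq> j"
        then show "R (i + n) \<inter> R (j + n) = {}"
          using *[of "i+n" "j+n"] *[of "j+n" "i+n"] by (cases "i < j") auto
      qed
      then show ?thesis using csa(2) by (auto simp: countably_subadditive_def)
    qed
    finally have 1: "h (A - F) \<le> h (S n) + ennreal e" using tail
      by (meson add_left_mono order_trans)
    have "h (A \<inter> F) + h (S n) \<le> h ((A \<inter> F) \<union> S n)"
    proof (rule sep[OF q_pos[of n]])
      fix x y assume "x \<in> A \<inter> F" "y \<in> S n"
      then have "q n \<le> infdist y F" "infdist y F \<le> dist y x"
        by (auto simp: S_def intro: infdist_le)
      then show "q n \<le> dist x y" by (simp add: dist_commute)
    qed
    also have "\<dots> \<le> h A" by (rule mono) (auto simp: S_def)
    finally have "h (A \<inter> F) + h (S n) \<le> h A" .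
    then have "h (A \<inter> F) + h (S n) + ennreal e \<le> h A + ennreal e"
      by (rule add_right_mono)
    moreover have "h (A \<inter> F) + h (A - F) \<le> h (A \<inter> F) + (h (S n) + ennreal e)"
      using 1 by (rule add_left_mono)
    ultimately show "h (A \<inter> F) + h (A - F) \<le> h A + ennreal e"
      unfolding add.assoc by (rule order_trans[rotated])
  qed
qed

text \<open>
  This makes \<open>measure_of\<close> in the definition of the surface measure return the Hausdorff measure; for
  a set function that is not countably additive it would return the zero measure.
\<close>

lemma measure_space_hausdorff_outer:
  "measure_space UNIV (sets borel) (hausdorff_outer k :: 'a::metric_space set \<Rightarrow> _)"
proof -
  let ?h = "hausdorff_outer k :: 'a set \<Rightarrow> ennreal"
  interpret sigma_algebra "UNIV :: 'a set" UNIV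
    using sigma_algebra_Pow[of "UNIV :: 'a set"] by simp
  have ms: "measure_space UNIV (lambda_system UNIV UNIV ?h) ?h"
    by (rule caratheodory_lemma[OF hausdorff_outer_space])
  then interpret L: sigma_algebra UNIV "lambda_system UNIV UNIV ?h"
    by (auto simp: measure_space_def)
  have "F \<in> lambda_system UNIV UNIV ?h" if "closed F" for F
  proof -
    have sa: "subadditive UNIV ?h"
      using hausdorff_outer_space countably_subadditive_subadditive
      by (auto simp: outer_measure_space_def)
    have "?h (A \<inter> F) + ?h (A - F) = ?h A" for A
    proof (rule antisym)
      show "?h (A \<inter> F) + ?h (A - F) \<le> ?h A"
        by (rule caratheodory_criterion_closed[OF hausdorff_outer_space hausdorff_outer_separated that])
      show "?h A \<le> ?h (A \<inter> F) + ?h (A - F)"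
        using sa[unfolded subadditive_def, rule_format, of "A \<inter> F" "A - F"]
        by (simp add: Int_Diff_Un Int_Diff_disjoint)
    qed
    then show ?thesis by (simp add: lambda_system_eq)
  qed
  then have "sigma_sets UNIV (Collect closed) \<subseteq> lambda_system UNIV UNIV ?h"
    by (intro L.sigma_sets_subset) auto
  then have "sets borel \<subseteq> lambda_system UNIV UNIV ?h"
    unfolding borel_eq_closed by (simp add: sets_measure_of)
  then show ?thesis
    by (intro measure_down[OF ms]) (auto intro: sets.sigma_algebra_axioms[of borel, unfolded space_borel])
qed

lemma sets_surface_measure [simp, measurable_cong]: "sets surface_measure = sets borel"
  unfolding surface_measure_def using sets.sigma_sets_eq[of borel]
  by (simp add: sets_measure_of_conv)


lemma emeasure_surface_measure:
  fixes A :: "(real^'n) set"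
  assumes "A \<in> sets borel"
  shows "emeasure surface_measure A = hausdorff_outer (CARD('n) - 1) A"
  unfolding surface_measure_def
  using measure_space_hausdorff_outer assms
  by (intro emeasure_measure_of_sigma) (auto simp: measure_space_def)

text \<open>
  Balls around points of \<open>E\<close> come from an almost optimal covering: pick a point of \<open>E\<close> in each
  covering set and a radius slightly above its diameter; the increments are paid for by the slack
  \<open>s\<close>. So in the sum the radius \<open>r i\<close> plays the role of a diameter.
\<close>

lemma hausdorff_ball_cover:
  fixes E :: "'a::metric_space set"
  assumes E: "hausdorff_outer k E < ennreal b" and \<delta>: "\<delta> > 0"
  obtains x :: "nat \<Rightarrow> 'a" and r :: "nat \<Rightarrow> real" and J where
    "\<And>i. i \<in> J \<Longrightarrow> x i \<in> E" "\<And>i. 0 < r i" "\<And>i. r i < \<delta>"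
    "E \<subseteq> (\<Union>i\<in>J. ball (x i) (r i))"
    "\<And>I. finite I \<Longrightarrow> I \<subseteq> J \<Longrightarrow> (\<Sum>i\<in>I. unit_ball_vol (real k) * (r i / 2) ^ k) \<le> b"
proof -
  let ?v = "unit_ball_vol (real k)"
  have v: "?v > 0" by simp
  have "hausdorff_pre k (\<delta>/2) E < ennreal b"
    using hausdorff_pre_le_outer[of "\<delta>/2" k E] E \<delta> by (auto intro: le_less_trans)
  from hausdorff_pre_approx[OF this] obtain C :: "nat \<Rightarrow> 'a set"
    where "E \<subseteq> (\<Union>i. C i) \<and> (\<forall>i. bounded (C i) \<and> diameter (C i) \<le> \<delta>/2) \<and>
      (\<Sum>i. if C i = {} then 0 else ennreal (?v * (diameter (C i) / 2) ^ k)) < ennreal b" ..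
  then have C: "E \<subseteq> (\<Union>i. C i)" "\<And>i. bounded (C i)" "\<And>i. diameter (C i) \<le> \<delta>/2"
    and Csum: "(\<Sum>i. if C i = {} then 0 else ennreal (?v * (diameter (C i) / 2) ^ k)) < ennreal b"
    by auto
  define w where "w i = (if C i = {} then 0 else ?v * (diameter (C i) / 2) ^ k)" for i
  have w0: "w i \<ge> 0" for i using diameter_ge_0[OF C(2), of i] by (auto simp: w_def)
  have w_eq: "(if C i = {} then 0 else ennreal (?v * (diameter (C i) / 2) ^ k)) = ennreal (w i)" for i
    by (simp add: w_def)
  have "summable w"
    using Csum unfolding w_eq
    by (intro summable_suminf_not_top) (use w0 in \<open>auto simp: less_top[symmetric]\<close>)
  then have sw: "(\<Sum>i. ennreal (w i)) = ennreal (suminf w)"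
    using w0 by (intro suminf_ennreal2) auto
  have b: "suminf w < b"
    using Csum suminf_nonneg[OF \<open>summable w\<close> w0] unfolding w_eq sw by (simp add: ennreal_less_iff)
  define s where "s = b - suminf w"
  have s: "s > 0" using b by (simp add: s_def)
  have "\<exists>r. diameter (C i) < r \<and> r < \<delta> \<and> ?v * (r/2)^k < ?v * (diameter (C i) / 2) ^ k + s * (1/2)^Suc i" for i
  proof -
    let ?d = "diameter (C i)"
    have "((\<lambda>r. ?v * (r/2)^k) \<longlongrightarrow> ?v * (?d/2)^k) (at_right ?d)"
      by (intro tendsto_intros) simp
    then have 1: "\<forall>\<^sub>F r in at_right ?d. ?v * (r/2)^k < ?v * (?d / 2) ^ k + s * (1/2)^Suc i"
      using s by (intro order_tendstoD) auto
    have 2: "\<forall>\<^sub>F r in at_right ?d. ?d < r \<and> r < \<delta>"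
      using C(3)[of i] \<delta> by (intro eventually_conj eventually_at_right_less eventually_at_right_real
          eventually_at_right_field[THEN iffD2]) (auto intro!: exI[of _ \<delta>])
    have "\<forall>\<^sub>F r in at_right ?d. (?d < r \<and> r < \<delta>) \<and> ?v * (r/2)^k < ?v * (?d / 2) ^ k + s * (1/2)^Suc i"
      using 1 2 by (rule eventually_conj[rotated])
    then show ?thesis
      using eventually_happens'[OF trivial_limit_at_right_real] by blast
  qed
  then obtain r where r: "\<And>i. diameter (C i) < r i" "\<And>i. r i < \<delta>"
    "\<And>i. ?v * (r i/2)^k < ?v * (diameter (C i) / 2) ^ k + s * (1/2)^Suc i" by metis
  define J where "J = {i. C i \<inter> E \<noteq> {}}"
  define x where "x i = (SOME y. y \<in> C i \<inter> E)" for i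
  have x: "x i \<in> C i \<inter> E" if "i \<in> J" for i
    using that someI_ex[of "\<lambda>y. y \<in> C i \<inter> E"] by (auto simp: J_def x_def)
  show thesis
  proof (rule that[of J x r])
    show "x i \<in> E" if "i \<in> J" for i using x[OF that] by simp
    show "0 < r i" for i using r(1)[of i] diameter_ge_0[OF C(2), of i] by linarith
    show "r i < \<delta>" for i by fact
    show "E \<subseteq> (\<Union>i\<in>J. ball (x i) (r i))"
    proof
      fix y assume y: "y \<in> E"
      then obtain i where i: "y \<in> C i" using C(1) by blast
      then have iJ: "i \<in> J" using y by (auto simp: J_def)
      have "dist (x i) y \<le> diameter (C i)"
        using x[OF iJ] i C(2) by (intro diameter_bounded_bound) auto
      then show "y \<in> (\<Union>i\<in>J. ball (x i) (r i))" using iJ r(1)[of i] by force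
    qed
    fix I assume I: "finite I" "I \<subseteq> J"
    have "(\<Sum>i\<in>I. ?v * (r i / 2) ^ k) \<le> (\<Sum>i\<in>I. w i + s * (1/2)^Suc i)"
    proof (rule sum_mono)
      fix i assume "i \<in> I"
      then have "C i \<noteq> {}" using I by (auto simp: J_def)
      then show "?v * (r i / 2) ^ k \<le> w i + s * (1/2)^Suc i"
        using r(3)[of i] by (simp add: w_def)
    qed
    also have "\<dots> = sum w I + (\<Sum>i\<in>I. s * (1/2)^Suc i)" by (rule sum.distrib)
    also have "sum w I \<le> suminf w" using I w0 \<open>summable w\<close> by (intro sum_le_suminf) auto
    also have "(\<Sum>i\<in>I. s * (1/2)^Suc i) \<le> (\<Sum>i. s * (1/2)^Suc i)"
      using I s sums_summable[OF sums_mult[OF power_half_series, of s]] by (intro sum_le_suminf) auto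
    also have "(\<Sum>i. s * (1/2)^Suc i) = s"
      using sums_unique[OF sums_mult[OF power_half_series, of s]] by simp
    finally show "(\<Sum>i\<in>I. ?v * (r i / 2) ^ k) \<le> b" by (simp add: s_def)
  qed
qed

section \<open>Boundary estimate for integrals of derivatives\<close>

lemma Ck_closure_1D:
  assumes "Ck_closure 1 D f"
  shows "continuous_on (closure D) f" "\<And>x. x \<in> D \<Longrightarrow> f differentiable (at x)"
    "continuous_on (closure D) (part_deriv D k f)"
  using assms by (auto simp: eval_nat_numeral)

lemma set_integrable_continuous_closure:
  fixes g :: "'a::euclidean_space \<Rightarrow> real"
  assumes "open D" "bounded D" "continuous_on (closure D) g"
  shows "set_integrable lborel D g"
proof (rule set_integrable_subset)
  show "set_integrable lborel (closure D) g"
    unfolding set_integrable_def using assms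
    by (intro borel_integrable_compact) auto
qed (use assms closure_subset in auto)

lemma continuous_closure_bounded:
  fixes g :: "'a::euclidean_space \<Rightarrow> real"
  assumes "bounded D" "continuous_on (closure D) g"
  obtains M where "M > 0" "\<And>x. x \<in> closure D \<Longrightarrow> \<bar>g x\<bar> \<le> M"
proof -
  have "bounded (g ` closure D)"
    using assms by (intro compact_imp_bounded compact_continuous_image) auto
  then show thesis
    using that unfolding bounded_pos by auto
qed

lemma integral_translate:
  fixes g :: "'a::euclidean_space \<Rightarrow> real"
  assumes [measurable]: "g \<in> borel_measurable borel"
  shows "(LINT x|lborel. g (c + x)) = (LINT x|lborel. g x)"
  using integral_distr[of "(+) c" lborel borel g] by (simp add: lborel_distr_plus)

lemma difference_quotient_tendsto:
  fixes f :: "real^'n \<Rightarrow> real"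
  assumes f: "f differentiable (at x)" and t: "t \<longlonglongrightarrow> 0" "\<And>n. t n > 0"
  shows "(\<lambda>n. (f (x + t n *\<^sub>R axis k 1) - f x) / t n) \<longlonglongrightarrow> frechet_derivative f (at x) (axis k 1)"
proof -
  have "(f has_derivative frechet_derivative f (at x)) (at x)"
    using f frechet_derivative_works by blast
  then have "((\<lambda>s. f (x + s *\<^sub>R axis k 1)) has_derivative (\<lambda>s. frechet_derivative f (at x) (s *\<^sub>R axis k 1))) (at 0)"
    by (auto intro!: derivative_eq_intros has_derivative_compose[where f="\<lambda>s. x + s *\<^sub>R axis k 1" and x=0 and g=f, simplified])
  then have "((\<lambda>s. f (x + s *\<^sub>R axis k 1)) has_field_derivative frechet_derivative f (at x) (axis k 1)) (at 0)"
    unfolding has_field_derivative_def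
    by (rule has_derivative_eq_rhs)
       (use linear_frechet_derivative[OF f] in \<open>auto simp: linear_cmul fun_eq_iff\<close>)
  then have "((\<lambda>s. (f (x + s *\<^sub>R axis k 1) - f x) / s) \<longlongrightarrow> frechet_derivative f (at x) (axis k 1)) (at 0)"
    by (simp add: DERIV_def)
  moreover have "filterlim t (at 0) sequentially"
    using t by (auto simp: filterlim_at intro!: always_eventually) (metis less_irrefl)
  ultimately show ?thesis by (rule filterlim_compose)
qed

lemma difference_quotient_bound:
  fixes f :: "real^'n \<Rightarrow> real"
  assumes seg: "\<And>s. 0 \<le> s \<Longrightarrow> s \<le> t \<Longrightarrow> f differentiable (at (x + s *\<^sub>R axis k 1))"
    and M: "\<And>s. 0 \<le> s \<Longrightarrow> s \<le> t \<Longrightarrow> \<bar>frechet_derivative f (at (x + s *\<^sub>R axis k 1)) (axis k 1)\<bar> \<le> M"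
    and t: "t > 0"
  shows "\<bar>f (x + t *\<^sub>R axis k 1) - f x\<bar> \<le> t * M"
proof -
  let ?g = "\<lambda>s. f (x + s *\<^sub>R axis k 1)"
  let ?g' = "\<lambda>s. frechet_derivative f (at (x + s *\<^sub>R axis k 1)) (axis k 1)"
  have der: "(?g has_real_derivative ?g' s) (at s)" if "0 \<le> s" "s \<le> t" for s
  proof -
    note d = seg[OF that]
    have "(f has_derivative frechet_derivative f (at (x + s *\<^sub>R axis k 1))) (at (x + s *\<^sub>R axis k 1))"
      using d frechet_derivative_works by blast
    then have "(?g has_derivative (\<lambda>h. frechet_derivative f (at (x + s *\<^sub>R axis k 1)) (h *\<^sub>R axis k 1))) (at s)"
      by (auto intro!: derivative_eq_intros has_derivative_compose[where f="\<lambda>s. x + s *\<^sub>R axis k 1" and x=s and g=f])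
    then show ?thesis
      unfolding has_field_derivative_def
      by (rule has_derivative_eq_rhs)
         (use linear_frechet_derivative[OF d] in \<open>auto simp: linear_cmul fun_eq_iff\<close>)
  qed
  obtain z where z: "0 < z" "z < t" "?g t - ?g 0 = (t - 0) * ?g' z"
    using MVT2[of 0 t ?g ?g'] t der by auto
  then show ?thesis using M[of z] t by (simp add: abs_mult)
qed

text \<open>
  Integration by parts against a Lipschitz cutoff \<open>\<kappa>\<close> that vanishes near the boundary: move the
  difference quotient from \<open>f\<close> to \<open>\<kappa>\<close> by translation invariance and let the step tend to \<open>0\<close>.
  The local Lipschitz bound \<open>h\<close> of \<open>\<kappa>\<close> takes the place of \<open>|\<nabla>\<kappa>|\<close>.
\<close>

lemma cutoff_integral_bound:
  fixes f \<kappa> h :: "real^'n \<Rightarrow> real"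
  assumes D: "open D" "bounded D" and f: "Ck_closure 1 D f"
    and \<kappa>: "continuous_on UNIV \<kappa>" "\<And>x. 0 \<le> \<kappa> x" "\<And>x. \<kappa> x \<le> 1"
    and \<eta>: "\<eta> > 0" "\<And>x y. y \<in> frontier D \<Longrightarrow> dist y x < \<eta> \<Longrightarrow> \<kappa> x = 0"
    and h: "\<And>x t. 0 < t \<Longrightarrow> t < \<tau> \<Longrightarrow> \<bar>\<kappa> (x - t *\<^sub>R axis k 1) - \<kappa> x\<bar> \<le> t * h x" and \<tau>: "\<tau> > 0"
    and hint: "set_integrable lborel D (\<lambda>x. h x * \<bar>f x\<bar>)"
  shows "\<bar>LINT x:D|lborel. \<kappa> x * part_deriv D k f x\<bar> \<le> (LINT x:D|lborel. h x * \<bar>f x\<bar>)"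
proof -
  let ?e = "axis k 1 :: real^'n"
  let ?g = "part_deriv D k f"
  note f' = Ck_closure_1D[OF f]
  have g: "?g x = frechet_derivative f (at x) ?e" if "x \<in> D" for x
    using that by (simp add: part_deriv_def)
  obtain Mg where Mg: "Mg > 0" "\<And>x. x \<in> closure D \<Longrightarrow> \<bar>?g x\<bar> \<le> Mg"
    using continuous_closure_bounded[OF D(2) f'(3)] by blast
  define F where "F x = indicator D x * f x" for x
  have [measurable]: "D \<in> sets borel" using D by auto
  have F_int: "integrable lborel F"
    using set_integrable_continuous_closure[OF D f'(1)]
    unfolding set_integrable_def F_def by simp
  have [measurable]: "F \<in> borel_measurable borel"
    using borel_measurable_integrable[OF F_int] by simp
  have [measurable]: "\<kappa> \<in> borel_measurable borel"
    using \<kappa>(1) by (rule borel_measurable_continuous_onI)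
  have eDf: "emeasure lborel D < \<infinity>"
    using D(2) emeasure_bounded_finite by auto
  have int_mult: "integrable lborel (\<lambda>x. c x * F x)"
    if "c \<in> borel_measurable borel" "\<And>x. \<bar>c x\<bar> \<le> 1" for c
  proof (rule Bochner_Integration.integrable_bound[OF F_int])
    show "AE x in lborel. norm (c x * F x) \<le> norm (F x)"
      using that(2) by (auto simp: abs_mult intro!: mult_left_le_one_le)
    show "(\<lambda>x. c x * F x) \<in> borel_measurable lborel" using that(1) by measurable
  qed
  define t where "t n = min \<eta> \<tau> / 2 * inverse (real (Suc n))" for n
  have t_pos: "t n > 0" for n using \<eta> \<tau> by (simp add: t_def)
  have t_lt: "t n < min \<eta> \<tau>" for n
  proof -
    have "min \<eta> \<tau> / 2 * inverse (real (Suc n)) \<le> min \<eta> \<tau> / 2 * 1"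
      using \<eta> \<tau> by (intro mult_left_mono) (auto simp: field_simps)
    also have "\<dots> < min \<eta> \<tau>" using \<eta> \<tau> by auto
    finally show ?thesis by (simp add: t_def)
  qed
  have t_lim: "t \<longlonglongrightarrow> 0"
    unfolding t_def using tendsto_mult_right_zero[OF LIMSEQ_inverse_real_of_nat] by simp
  define s where "s n x = \<kappa> x * (F (x + t n *\<^sub>R ?e) - F x) / t n" for n x
  \<comment> \<open>where the cutoff does not vanish, short segments do not cross the boundary\<close>
  have seg: "x + u *\<^sub>R ?e \<in> D \<longleftrightarrow> x \<in> D" if "\<kappa> x \<noteq> 0" "0 \<le> u" "u < \<eta>" for x u
  proof (rule ccontr)
    assume neg: "\<not> ?thesis"
    let ?S = "closed_segment x (x + u *\<^sub>R ?e)"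
    have "?S \<inter> frontier D \<noteq> {}"
      using neg by (intro connected_Int_frontier) auto
    then obtain y where y: "y \<in> ?S" "y \<in> frontier D" by blast
    have "dist y x \<le> dist x (x + u *\<^sub>R ?e)"
      using dist_in_closed_segment[OF y(1)] by (auto simp: dist_commute)
    also have "\<dots> = u" using that by (simp add: dist_norm norm_axis_1)
    finally show False using \<eta>(2)[OF y(2), of x] that by auto
  qed
  have lim: "(\<lambda>n. s n x) \<longlonglongrightarrow> indicator D x * (\<kappa> x * ?g x)" for x
  proof (cases "\<kappa> x = 0")
    case True then show ?thesis by (simp add: s_def)
  next
    case nz: False
    have in_D: "x + t n *\<^sub>R ?e \<in> D \<longleftrightarrow> x \<in> D" for n
      using seg[OF nz] t_pos[of n] t_lt[of n] by auto
    show ?thesis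
    proof (cases "x \<in> D")
      case True
      have "(\<lambda>n. \<kappa> x * ((f (x + t n *\<^sub>R ?e) - f x) / t n)) \<longlonglongrightarrow> \<kappa> x * frechet_derivative f (at x) ?e"
        by (intro tendsto_mult_left difference_quotient_tendsto f'(2)[OF True] t_lim t_pos)
      then show ?thesis using True in_D by (simp add: s_def F_def g)
    next
      case False then show ?thesis using in_D by (simp add: s_def F_def)
    qed
  qed
  have bnd: "norm (s n x) \<le> indicator D x * Mg" for n x
  proof (cases "\<kappa> x = 0")
    case True then show ?thesis using Mg by (simp add: s_def)
  next
    case nz: False
    have in_D: "x + u *\<^sub>R ?e \<in> D \<longleftrightarrow> x \<in> D" if "0 \<le> u" "u \<le> t n" for u
      using seg[OF nz, of u] t_lt[of n] that by auto
    show ?thesis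
    proof (cases "x \<in> D")
      case True
      have "\<bar>f (x + t n *\<^sub>R ?e) - f x\<bar> \<le> t n * Mg"
      proof (rule difference_quotient_bound[OF _ _ t_pos])
        fix u assume u: "0 \<le> u" "u \<le> t n"
        then have xu: "x + u *\<^sub>R ?e \<in> D" using in_D True by simp
        then show "f differentiable (at (x + u *\<^sub>R ?e))" by (rule f'(2))
        show "\<bar>frechet_derivative f (at (x + u *\<^sub>R ?e)) ?e\<bar> \<le> Mg"
          using Mg(2)[of "x + u *\<^sub>R ?e"] xu g closure_subset by (metis subsetD)
      qed
      then have "\<bar>(f (x + t n *\<^sub>R ?e) - f x) / t n\<bar> \<le> Mg"
        using t_pos[of n] by (simp add: field_simps abs_divide)
      then have "\<bar>\<kappa> x\<bar> * \<bar>(f (x + t n *\<^sub>R ?e) - f x) / t n\<bar> \<le> 1 * Mg"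
        using \<kappa>(2,3)[of x] by (intro mult_mono) auto
      moreover have "s n x = \<kappa> x * ((f (x + t n *\<^sub>R ?e) - f x) / t n)"
        using True in_D[of "t n"] t_pos[of n] by (simp add: s_def F_def)
      ultimately show ?thesis using True by (simp add: abs_mult)
    next
      case False
      then show ?thesis using in_D[of "t n"] t_pos[of n] by (simp add: s_def F_def)
    qed
  qed
  have DM: "integrable lborel (\<lambda>x. indicator D x * Mg)"
    using eDf by (intro integrable_mult_left integrable_real_indicator) auto
  have lim2: "(\<lambda>n. LINT x|lborel. s n x) \<longlonglongrightarrow> (LINT x|lborel. indicator D x * (\<kappa> x * ?g x))"
  proof (rule integral_dominated_convergence[OF _ _ DM])
    show "(\<lambda>x. indicator D x * (\<kappa> x * ?g x)) \<in> borel_measurable lborel"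
    proof -
      have "(\<lambda>x. indicator D x *\<^sub>R ?g x) \<in> borel_measurable lborel"
        using set_integrable_continuous_closure[OF D f'(3)] unfolding set_integrable_def
        by (rule borel_measurable_integrable)
      then have "(\<lambda>x. \<kappa> x * (indicator D x *\<^sub>R ?g x)) \<in> borel_measurable lborel" by measurable
      then show ?thesis by (simp add: mult.left_commute)
    qed
    show "s n \<in> borel_measurable lborel" for n
      unfolding s_def by measurable
  qed (use lim bnd in auto)
  have "\<bar>LINT x|lborel. s n x\<bar> \<le> (LINT x:D|lborel. h x * \<bar>f x\<bar>)" for n
  proof -
    have i1: "integrable lborel (\<lambda>x. \<kappa> (x - t n *\<^sub>R ?e) * F x)"
      by (rule int_mult) (use \<kappa> in \<open>auto simp: abs_le_iff intro: order_trans[of _ 0]\<close>)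
    have i2: "integrable lborel (\<lambda>x. \<kappa> x * F x)"
      by (rule int_mult) (use \<kappa> in \<open>auto simp: abs_le_iff intro: order_trans[of _ 0]\<close>)
    have tr: "(LINT x|lborel. \<kappa> x * F (x + t n *\<^sub>R ?e)) = (LINT x|lborel. \<kappa> (x - t n *\<^sub>R ?e) * F x)"
      using integral_translate[of "\<lambda>x. \<kappa> (x - t n *\<^sub>R ?e) * F x" "t n *\<^sub>R ?e"]
      by (simp add: add.commute)
    have i3: "integrable lborel (\<lambda>x. \<kappa> x * F (x + t n *\<^sub>R ?e))"
    proof -
      have "integrable (distr lborel borel ((+) (t n *\<^sub>R ?e))) (\<lambda>x. \<kappa> (x - t n *\<^sub>R ?e) * F x)"
        unfolding lborel_distr_plus by (rule i1)
      then show ?thesis by (subst (asm) integrable_distr_eq) (auto simp: add.commute)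
    qed
    have "(LINT x|lborel. s n x) = (LINT x|lborel. (\<kappa> x * F (x + t n *\<^sub>R ?e) - \<kappa> x * F x) / t n)"
      by (simp add: s_def algebra_simps)
    also have "\<dots> = ((LINT x|lborel. \<kappa> x * F (x + t n *\<^sub>R ?e)) - (LINT x|lborel. \<kappa> x * F x)) / t n"
      using i2 i3 by simp
    also have "\<dots> = (LINT x|lborel. (\<kappa> (x - t n *\<^sub>R ?e) * F x - \<kappa> x * F x) / t n)"
      using i1 i2 by (simp add: tr)
    finally have eq: "(LINT x|lborel. s n x) = (LINT x|lborel. (\<kappa> (x - t n *\<^sub>R ?e) * F x - \<kappa> x * F x) / t n)" .
    have "\<bar>LINT x|lborel. s n x\<bar> \<le> (LINT x|lborel. \<bar>(\<kappa> (x - t n *\<^sub>R ?e) * F x - \<kappa> x * F x) / t n\<bar>)"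
      unfolding eq by (rule integral_abs_bound)
    also have "\<dots> \<le> (LINT x|lborel. indicator D x *\<^sub>R (h x * \<bar>f x\<bar>))"
    proof (rule integral_mono)
      show "integrable lborel (\<lambda>x. \<bar>(\<kappa> (x - t n *\<^sub>R ?e) * F x - \<kappa> x * F x) / t n\<bar>)"
        using i1 i2 by simp
      show "integrable lborel (\<lambda>x. indicator D x *\<^sub>R (h x * \<bar>f x\<bar>))"
        using hint by (simp add: set_integrable_def)
      fix x
      have "\<bar>\<kappa> (x - t n *\<^sub>R ?e) - \<kappa> x\<bar> / t n \<le> h x"
        using h[of "t n" x] t_pos[of n] t_lt[of n] by (simp add: field_simps)
      then have "\<bar>\<kappa> (x - t n *\<^sub>R ?e) - \<kappa> x\<bar> / t n * \<bar>F x\<bar> \<le> h x * \<bar>F x\<bar>"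
        by (intro mult_right_mono) auto
      moreover have "\<bar>(\<kappa> (x - t n *\<^sub>R ?e) * F x - \<kappa> x * F x) / t n\<bar> = \<bar>\<kappa> (x - t n *\<^sub>R ?e) - \<kappa> x\<bar> / t n * \<bar>F x\<bar>"
        using t_pos[of n] by (simp add: left_diff_distrib[symmetric] abs_mult abs_divide)
      ultimately show "\<bar>(\<kappa> (x - t n *\<^sub>R ?e) * F x - \<kappa> x * F x) / t n\<bar> \<le> indicator D x *\<^sub>R (h x * \<bar>f x\<bar>)"
        by (cases "x \<in> D") (auto simp: F_def)
    qed
    finally show ?thesis by (simp add: set_lebesgue_integral_def)
  qed
  then have "\<bar>LINT x|lborel. indicator D x * (\<kappa> x * ?g x)\<bar> \<le> (LINT x:D|lborel. h x * \<bar>f x\<bar>)"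
    using lim2 by (intro tendsto_upperbound[OF tendsto_rabs[OF lim2]]) auto
  then show ?thesis by (simp add: set_lebesgue_integral_def)
qed

text \<open>
  A piecewise linear function of the distance to \<open>p\<close>: cutoffs enter only through their difference
  quotients, so Lipschitz continuity is the regularity that counts.
\<close>

definition ball_cutoff :: "'a::real_normed_vector \<Rightarrow> real \<Rightarrow> 'a \<Rightarrow> real" where
  "ball_cutoff p r x = max 0 (min 1 (dist p x / r - 1))"

lemma ball_cutoff_bounds: "0 \<le> ball_cutoff p r x" "ball_cutoff p r x \<le> 1"
  by (auto simp: ball_cutoff_def)

lemma ball_cutoff_eq_0: "r > 0 \<Longrightarrow> x \<in> ball p r \<Longrightarrow> ball_cutoff p r x = 0"
  by (auto simp: ball_cutoff_def field_simps)

lemma ball_cutoff_eq_1: "r > 0 \<Longrightarrow> x \<notin> ball p (2 * r) \<Longrightarrow> ball_cutoff p r x = 1"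
  by (auto simp: ball_cutoff_def field_simps)

lemma continuous_on_ball_cutoff: "r > 0 \<Longrightarrow> continuous_on S (ball_cutoff p r)"
  unfolding ball_cutoff_def by (intro continuous_intros) auto

lemma ball_cutoff_diff:
  assumes r: "r > 0" and e: "norm e = 1" and t: "0 < t" "t < r"
  shows "\<bar>ball_cutoff p r (x - t *\<^sub>R e) - ball_cutoff p r x\<bar> \<le> t * (indicator (ball p (3*r)) x / r)"
proof (cases "x \<in> ball p (3*r)")
  case True
  have d: "\<bar>dist p (x - t *\<^sub>R e) - dist p x\<bar> \<le> t"
  proof -
    have "dist (x - t *\<^sub>R e) x = t" using e t by (simp add: dist_norm)
    then show ?thesis using dist_triangle[of p "x - t *\<^sub>R e" x] dist_triangle[of p x "x - t *\<^sub>R e"]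
      by (auto simp: abs_le_iff dist_commute)
  qed
  have "\<bar>ball_cutoff p r (x - t *\<^sub>R e) - ball_cutoff p r x\<bar> \<le> \<bar>dist p (x - t *\<^sub>R e) / r - dist p x / r\<bar>"
    by (auto simp: ball_cutoff_def)
  also have "\<dots> = \<bar>dist p (x - t *\<^sub>R e) - dist p x\<bar> / r"
    using r by (simp add: diff_divide_distrib[symmetric] abs_divide)
  also have "\<dots> \<le> t / r" using d r by (intro divide_right_mono) auto
  finally show ?thesis using True by simp
next
  case False
  have "dist (x - t *\<^sub>R e) x = t" using e t by (simp add: dist_norm)
  then have "x - t *\<^sub>R e \<notin> ball p (2*r)"
    using False t dist_triangle[of p x "x - t *\<^sub>R e"] by auto
  moreover have "x \<notin> ball p (2*r)" using False r by auto
  ultimately show ?thesis using r False by (simp add: ball_cutoff_eq_1)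
qed

text \<open>
  The product of the cutoffs of finitely many balls covering the boundary is an admissible \<open>\<kappa>\<close>;
  it differs from \<open>1\<close> only on the doubled balls.
\<close>

lemma integral_part_deriv_cover_bound:
  fixes f :: "real^'n \<Rightarrow> real" and p :: "'i \<Rightarrow> real^'n" and r s :: "'i \<Rightarrow> real"
  assumes D: "open D" "bounded D" and f: "Ck_closure 1 D f"
    and I: "finite I" and r: "\<And>i. i \<in> I \<Longrightarrow> r i > 0"
    and cov: "frontier D \<subseteq> (\<Union>i\<in>I. ball (p i) (r i))"
    and s: "\<And>i x. i \<in> I \<Longrightarrow> x \<in> D \<Longrightarrow> x \<in> ball (p i) (3 * r i) \<Longrightarrow> \<bar>f x\<bar> \<le> s i"
           "\<And>i. i \<in> I \<Longrightarrow> 0 \<le> s i"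
    and M: "\<And>x. x \<in> D \<Longrightarrow> \<bar>part_deriv D k f x\<bar> \<le> M" and M0: "0 \<le> M"
  shows "\<bar>LINT x:D|lborel. part_deriv D k f x\<bar>
    \<le> (\<Sum>i\<in>I. unit_ball_vol (real CARD('n)) * 3 ^ CARD('n) * s i * r i ^ (CARD('n) - 1))
      + M * (\<Sum>i\<in>I. unit_ball_vol (real CARD('n)) * 2 ^ CARD('n) * r i * r i ^ (CARD('n) - 1))"
proof -
  let ?n = "CARD('n)"
  let ?g = "part_deriv D k f"
  note f' = Ck_closure_1D[OF f]
  define \<kappa> where "\<kappa> x = (\<Prod>i\<in>I. ball_cutoff (p i) (r i) x)" for x
  have pw: "r i ^ ?n = r i * r i ^ (?n - 1)" for i
    by (metis power_eq_if zero_less_card_finite less_numeral_extra(3))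
  have \<kappa>0: "0 \<le> \<kappa> x" and \<kappa>1: "\<kappa> x \<le> 1" for x
    unfolding \<kappa>_def by (auto intro!: prod_nonneg prod_le_1 ball_cutoff_bounds)
  have \<kappa>c: "continuous_on UNIV \<kappa>"
    unfolding \<kappa>_def using r by (intro continuous_on_prod continuous_on_ball_cutoff) auto
  then have [measurable]: "\<kappa> \<in> borel_measurable borel"
    by (rule borel_measurable_continuous_onI)
  have [measurable]: "D \<in> sets borel" using D by auto
  obtain \<eta> where \<eta>: "\<eta> > 0" "(\<Union>y\<in>frontier D. ball y \<eta>) \<subseteq> (\<Union>i\<in>I. ball (p i) (r i))"
    using compact_subset_open_imp_ball_epsilon_subset[OF compact_frontier_bounded[OF D(2)] _ cov] by blast
  have \<kappa>_zero: "\<kappa> x = 0" if "y \<in> frontier D" "dist y x < \<eta>" for x y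
  proof -
    have "x \<in> (\<Union>i\<in>I. ball (p i) (r i))"
      using that \<eta>(1) by (intro subsetD[OF \<eta>(2)]) auto
    then obtain i where "i \<in> I" "ball_cutoff (p i) (r i) x = 0"
      using r ball_cutoff_eq_0 by blast
    then show ?thesis using I unfolding \<kappa>_def by (intro prod_zero) auto
  qed
  define h where "h x = (\<Sum>i\<in>I. indicator (ball (p i) (3 * r i)) x / r i)" for x
  have h0: "h x \<ge> 0" for x unfolding h_def using r by (intro sum_nonneg) (auto simp: less_imp_le)
  obtain \<tau> where \<tau>: "\<tau> > 0" "\<And>i. i \<in> I \<Longrightarrow> \<tau> \<le> r i"
  proof
    show "Min (insert 1 (r ` I)) > 0" using I r by auto
    show "Min (insert 1 (r ` I)) \<le> r i" if "i \<in> I" for i using I that by auto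
  qed
  have hb: "\<bar>\<kappa> (x - t *\<^sub>R axis k 1) - \<kappa> x\<bar> \<le> t * h x" if "0 < t" "t < \<tau>" for x t
  proof -
    have "\<bar>\<kappa> (x - t *\<^sub>R axis k 1) - \<kappa> x\<bar> \<le>
      (\<Sum>i\<in>I. norm (ball_cutoff (p i) (r i) (x - t *\<^sub>R axis k 1) - ball_cutoff (p i) (r i) x))"
      unfolding \<kappa>_def real_norm_def[symmetric]
      by (rule norm_prod_diff) (auto simp: ball_cutoff_bounds)
    also have "\<dots> \<le> (\<Sum>i\<in>I. t * (indicator (ball (p i) (3 * r i)) x / r i))"
      unfolding real_norm_def using that
      by (intro sum_mono ball_cutoff_diff r norm_axis_1) (auto intro: less_le_trans[OF _ \<tau>(2)])
    finally show ?thesis by (simp add: h_def sum_distrib_left)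
  qed
  have f_int: "set_integrable lborel D (\<lambda>x. \<bar>f x\<bar>)"
    using D f'(1) by (intro set_integrable_continuous_closure continuous_intros)
  have g_int: "set_integrable lborel D ?g"
    using D f'(3) by (intro set_integrable_continuous_closure)
  have ball_int: "integrable lborel (\<lambda>x. indicator (ball q \<rho>) x * c)" for q :: "real^'n" and \<rho> c :: real
    using emeasure_lborel_ball_finite[of q \<rho>] by (intro integrable_mult_left integrable_real_indicator) auto
  define H where "H x = (\<Sum>i\<in>I. indicator (ball (p i) (3 * r i)) x * (s i / r i))" for x
  have H_int: "integrable lborel H" unfolding H_def
    by (intro Bochner_Integration.integrable_sum ball_int)
  have hf_le: "indicator D x * (h x * \<bar>f x\<bar>) \<le> H x" for x
  proof (cases "x \<in> D")
    case True
    have "h x * \<bar>f x\<bar> = (\<Sum>i\<in>I. indicator (ball (p i) (3 * r i)) x * (\<bar>f x\<bar> / r i))"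
      by (simp add: h_def sum_distrib_right)
    also have "\<dots> \<le> H x"
      unfolding H_def
    proof (rule sum_mono)
      fix i assume i: "i \<in> I"
      show "indicator (ball (p i) (3 * r i)) x * (\<bar>f x\<bar> / r i) \<le> indicator (ball (p i) (3 * r i)) x * (s i / r i)"
        using s(1)[OF i True] r[OF i] by (auto simp: indicator_def intro!: divide_right_mono)
    qed
    finally show ?thesis using True by simp
  next
    case False
    then show ?thesis unfolding H_def using s(2) r
      by (auto intro!: sum_nonneg mult_nonneg_nonneg divide_nonneg_nonneg simp: less_imp_le)
  qed
  have hf_int: "set_integrable lborel D (\<lambda>x. h x * \<bar>f x\<bar>)"
    unfolding set_integrable_def
  proof (rule Bochner_Integration.integrable_bound[OF H_int])
    have "(\<lambda>x. indicator D x *\<^sub>R \<bar>f x\<bar>) \<in> borel_measurable lborel"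
      using f_int unfolding set_integrable_def by (rule borel_measurable_integrable)
    moreover have "h \<in> borel_measurable lborel"
      unfolding h_def by (intro borel_measurable_sum borel_measurable_divide borel_measurable_indicator) auto
    ultimately have "(\<lambda>x. h x * (indicator D x *\<^sub>R \<bar>f x\<bar>)) \<in> borel_measurable lborel"
      by (intro borel_measurable_times)
    then show "(\<lambda>x. indicator D x *\<^sub>R (h x * \<bar>f x\<bar>)) \<in> borel_measurable lborel"
      by (simp add: mult.left_commute)
    show "AE x in lborel. norm (indicator D x *\<^sub>R (h x * \<bar>f x\<bar>)) \<le> norm (H x)"
      using hf_le h0 by (auto simp: abs_mult intro!: order_trans[OF hf_le abs_ge_self])
  qed
  have A: "\<bar>LINT x:D|lborel. \<kappa> x * ?g x\<bar> \<le> (LINT x:D|lborel. h x * \<bar>f x\<bar>)"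
    by (rule cutoff_integral_bound[OF D f \<kappa>c \<kappa>0 \<kappa>1 \<eta>(1) \<kappa>_zero hb \<tau>(1) hf_int])
  have B: "(LINT x:D|lborel. h x * \<bar>f x\<bar>) \<le> (\<Sum>i\<in>I. unit_ball_vol (real ?n) * 3 ^ ?n * s i * r i ^ (?n - 1))"
  proof -
    have "(LINT x:D|lborel. h x * \<bar>f x\<bar>) \<le> (LINT x|lborel. H x)"
      unfolding set_lebesgue_integral_def
      using hf_int H_int hf_le by (intro integral_mono) (auto simp: set_integrable_def)
    also have "\<dots> = (\<Sum>i\<in>I. (LINT x|lborel. indicator (ball (p i) (3 * r i)) x * (s i / r i)))"
      unfolding H_def by (intro Bochner_Integration.integral_sum ball_int)
    also have "\<dots> = (\<Sum>i\<in>I. unit_ball_vol (real ?n) * 3 ^ ?n * s i * r i ^ (?n - 1))"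
    proof (rule sum.cong)
      fix i assume i: "i \<in> I"
      have "(LINT x|lborel. indicator (ball (p i) (3 * r i)) x * (s i / r i))
          = measure lborel (ball (p i) (3 * r i)) * (s i / r i)"
        by simp
      also have "\<dots> = unit_ball_vol (real ?n) * (3 * r i) ^ ?n * (s i / r i)"
        using r[OF i] by (simp add: content_ball)
      also have "\<dots> = unit_ball_vol (real ?n) * 3 ^ ?n * s i * r i ^ (?n - 1)"
        using r[OF i] by (simp add: power_mult_distrib pw field_simps)
      finally show "(LINT x|lborel. indicator (ball (p i) (3 * r i)) x * (s i / r i))
        = unit_ball_vol (real ?n) * 3 ^ ?n * s i * r i ^ (?n - 1)" .
    qed simp
    finally show ?thesis .
  qed
  define G where "G x = (\<Sum>i\<in>I. indicator (ball (p i) (2 * r i)) x * M)" for x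
  have G_int: "integrable lborel G" unfolding G_def
    by (intro Bochner_Integration.integrable_sum ball_int)
  have \<kappa>g_int: "set_integrable lborel D (\<lambda>x. \<kappa> x * ?g x)"
    using D f'(3) \<kappa>c by (intro set_integrable_continuous_closure continuous_intros) (auto intro: continuous_on_subset)
  have C: "\<bar>LINT x:D|lborel. (?g x - \<kappa> x * ?g x)\<bar>
      \<le> M * (\<Sum>i\<in>I. unit_ball_vol (real ?n) * 2 ^ ?n * r i * r i ^ (?n - 1))"
  proof -
    have d_int: "set_integrable lborel D (\<lambda>x. ?g x - \<kappa> x * ?g x)"
      using g_int \<kappa>g_int by (rule set_integral_diff(1))
    have "\<bar>LINT x:D|lborel. (?g x - \<kappa> x * ?g x)\<bar> \<le> (LINT x|lborel. \<bar>indicator D x *\<^sub>R (?g x - \<kappa> x * ?g x)\<bar>)"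
      unfolding set_lebesgue_integral_def by (rule integral_abs_bound)
    also have "\<dots> \<le> (LINT x|lborel. G x)"
    proof (rule integral_mono[OF _ G_int])
      show "integrable lborel (\<lambda>x. \<bar>indicator D x *\<^sub>R (?g x - \<kappa> x * ?g x)\<bar>)"
        using d_int unfolding set_integrable_def by (rule integrable_abs)
      fix x
      show "\<bar>indicator D x *\<^sub>R (?g x - \<kappa> x * ?g x)\<bar> \<le> G x"
      proof (cases "x \<in> D \<and> (\<exists>i\<in>I. x \<in> ball (p i) (2 * r i))")
        case True
        then obtain i where i: "i \<in> I" "x \<in> ball (p i) (2 * r i)" and xD: "x \<in> D" by blast
        have "\<bar>?g x - \<kappa> x * ?g x\<bar> = (1 - \<kappa> x) * \<bar>?g x\<bar>"
        proof -
          have "?g x - \<kappa> x * ?g x = (1 - \<kappa> x) * ?g x" by (simp add: algebra_simps)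
          then show ?thesis using \<kappa>1[of x] by (simp add: abs_mult)
        qed
        also have "\<dots> \<le> 1 * M"
          using \<kappa>0[of x] \<kappa>1[of x] M[OF xD] by (intro mult_mono) auto
        also have "\<dots> = indicator (ball (p i) (2 * r i)) x * M" using i by simp
        also have "\<dots> \<le> G x"
          unfolding G_def using I i M0 by (intro member_le_sum) auto
        finally show ?thesis using xD by simp
      next
        case False
        have "G x \<ge> 0" unfolding G_def using M0 by (intro sum_nonneg) auto
        moreover have "\<kappa> x = 1" if "x \<in> D"
          unfolding \<kappa>_def using False that r by (intro prod.neutral) (auto intro!: ball_cutoff_eq_1)
        ultimately show ?thesis by (cases "x \<in> D") auto
      qed
    qed
    also have "\<dots> = (\<Sum>i\<in>I. (LINT x|lborel. indicator (ball (p i) (2 * r i)) x * M))"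
      unfolding G_def by (intro Bochner_Integration.integral_sum ball_int)
    also have "\<dots> = (\<Sum>i\<in>I. M * (unit_ball_vol (real ?n) * 2 ^ ?n * r i * r i ^ (?n - 1)))"
    proof (rule sum.cong)
      fix i assume i: "i \<in> I"
      show "(LINT x|lborel. indicator (ball (p i) (2 * r i)) x * M)
        = M * (unit_ball_vol (real ?n) * 2 ^ ?n * r i * r i ^ (?n - 1))"
        using r[OF i] by (simp add: content_ball power_mult_distrib pw)
    qed simp
    finally show ?thesis by (simp add: sum_distrib_left)
  qed
  have "(LINT x:D|lborel. ?g x) = (LINT x:D|lborel. \<kappa> x * ?g x) + (LINT x:D|lborel. (?g x - \<kappa> x * ?g x))"
    using g_int \<kappa>g_int by (simp add: set_integral_diff)
  then show ?thesis using A B C by linarith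
qed

text \<open>
  The volume of a ball of radius \<open>3 r\<close>, divided by \<open>r\<close> and by the contribution of a set of diameter
  \<open>r\<close> to the Hausdorff measure of dimension \<open>n - 1\<close>.
\<close>

definition boundary_const :: "nat \<Rightarrow> real" where
  "boundary_const n = unit_ball_vol (real n) * 3 ^ n * 2 ^ (n - 1) / unit_ball_vol (real (n - 1))"

lemma boundary_const_pos: "boundary_const n > 0"
  by (simp add: boundary_const_def)

text \<open>
  The boundary is split into the finitely many Borel pieces on which \<open>|f|\<close> is almost constant, and
  each piece is covered by balls of small radius whose Hausdorff sum is almost optimal.
\<close>

lemma integral_part_deriv_le_boundary:
  fixes f :: "real^'n \<Rightarrow> real"
  assumes D: "open D" "bounded D" and f: "Ck_closure 1 D f"
    and fin: "emeasure surface_measure (frontier D) < \<infinity>"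
  shows "\<bar>LINT x:D|lborel. part_deriv D k f x\<bar>
    \<le> boundary_const CARD('n) * (LINT x:frontier D|surface_measure. \<bar>f x\<bar>)"
proof -
  let ?n = "CARD('n)"
  let ?g = "part_deriv D k f"
  let ?S = "surface_measure :: (real^'n) measure"
  let ?B = "frontier D"
  let ?v = "unit_ball_vol (real (?n - 1))"
  define W where "W = unit_ball_vol (real ?n) * 3 ^ ?n"
  define C where "C = W * 2 ^ (?n - 1) / ?v"
  have v: "?v > 0" and W: "W > 0" by (auto simp: W_def)
  then have C: "C > 0" by (simp add: C_def)
  note f' = Ck_closure_1D[OF f]
  obtain Mf where Mf: "Mf > 0" "\<And>x. x \<in> closure D \<Longrightarrow> \<bar>f x\<bar> \<le> Mf"
    using continuous_closure_bounded[OF D(2) f'(1)] by blast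
  obtain Mg where Mg: "Mg > 0" "\<And>x. x \<in> closure D \<Longrightarrow> \<bar>?g x\<bar> \<le> Mg"
    using continuous_closure_bounded[OF D(2) f'(3)] by blast
  have BD: "?B \<subseteq> closure D" by (auto simp: frontier_def)
  have Bc: "compact ?B" using D by (rule_tac compact_frontier_bounded)
  have [measurable]: "?B \<in> sets borel" by auto
  have fBm [measurable]: "(\<lambda>x. indicator ?B x *\<^sub>R f x) \<in> borel_measurable borel"
    using continuous_on_subset[OF f'(1) BD] by (intro borel_measurable_continuous_on_indicator) auto
  have fB_abs: "(\<lambda>x. indicator ?B x *\<^sub>R \<bar>f x\<bar>) \<in> borel_measurable borel"
    using continuous_on_subset[OF f'(1) BD]
    by (intro borel_measurable_continuous_on_indicator continuous_intros) auto
  have f_int: "integrable ?S (\<lambda>x. indicator ?B x *\<^sub>R \<bar>f x\<bar>)"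
    using fin Mf(2) BD fB_abs
    by (intro integrableI_bounded_set[where A="?B" and B=Mf]) (auto simp: measurable_cong_sets[OF sets_surface_measure refl])
  define L where "L = (LINT x:?B|?S. \<bar>f x\<bar>)"
  define hB where "hB = measure ?S ?B"
  have hB0: "hB \<ge> 0" by (simp add: hB_def)
  have key: "\<bar>LINT x:D|lborel. ?g x\<bar> \<le> C * (L + 2 * \<epsilon> * hB + \<epsilon>) + Mg * C * \<epsilon> * (hB + \<epsilon>)" if e: "0 < \<epsilon>" for \<epsilon>
  proof -
    \<comment> \<open>\<open>N\<close> steps of height \<open>\<epsilon>\<close> exhaust the range of \<open>|f|\<close>\<close>
    obtain N :: nat where N: "Mf < real N * \<epsilon>" using ex_less_of_nat_mult[OF e] by blast
    have N0: "N > 0" using N Mf(1) by (cases N) auto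
    \<comment> \<open>excess allowed for the covering of each piece: the two bounds keep the total excess of the
      measure and of the weighted sum below \<open>\<epsilon>\<close>\<close>
    define \<gamma> where "\<gamma> = min (\<epsilon> / real N) (1 / (real N * (real N + 2)))"
    have \<gamma>: "\<gamma> > 0" using N0 e by (auto simp: \<gamma>_def)
    define E where "E j = {x \<in> ?B. real j * \<epsilon> \<le> \<bar>f x\<bar> \<and> \<bar>f x\<bar> < (real j + 1) * \<epsilon>}" for j
    have E_eq: "E j = {x. real j * \<epsilon> \<le> \<bar>indicator ?B x *\<^sub>R f x\<bar> \<and> \<bar>indicator ?B x *\<^sub>R f x\<bar> < (real j + 1) * \<epsilon>} \<inter> ?B" for j
      by (auto simp: E_def)
    have [measurable]: "E j \<in> sets borel" for j
      unfolding E_eq by measurable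
    have E_sub: "E j \<subseteq> ?B" for j by (auto simp: E_def)
    have E_fin: "emeasure ?S (E j) < \<infinity>" for j
      using emeasure_mono[OF E_sub, of ?S j] fin by (auto simp: less_top[symmetric] top_unique)
    have B_eq: "?B = (\<Union>j<N. E j)"
    proof
      show "?B \<subseteq> (\<Union>j<N. E j)"
      proof
        fix x assume x: "x \<in> ?B"
        define j where "j = nat \<lfloor>\<bar>f x\<bar> / \<epsilon>\<rfloor>"
        have j: "real j \<le> \<bar>f x\<bar> / \<epsilon>" "\<bar>f x\<bar> / \<epsilon> < real j + 1"
          using e by (auto simp: j_def of_nat_nat) 
        have "\<bar>f x\<bar> / \<epsilon> < real N" using N Mf(2)[of x] x BD e by (auto simp: field_simps)
        then have "j < N" using j by linarith
        moreover have "x \<in> E j" using j x e by (auto simp: E_def field_simps)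
        ultimately show "x \<in> (\<Union>j<N. E j)" by blast
      qed
    qed (auto simp: E_def)
    have E_disj: "disjoint_family_on E {..<N}"
      unfolding disjoint_family_on_def
    proof (intro ballI impI)
      have *: "E i \<inter> E j = {}" if "i < j" for i j
      proof -
        have "(real i + 1) * \<epsilon> \<le> real j * \<epsilon>" using that e by (intro mult_right_mono) auto
        then show ?thesis by (auto simp: E_def)
      qed
      fix i j :: nat assume "i \<noteq> j"
      then show "E i \<inter> E j = {}" using *[of i j] *[of j i] by (cases "i < j") auto
    qed
    have sum_mE: "(\<Sum>j<N. measure ?S (E j)) = hB"
      unfolding hB_def B_eq using E_fin E_disj
      by (intro measure_finite_Union[symmetric]) (auto simp: less_top[symmetric])
    define b where "b j = measure ?S (E j) + \<gamma>" for j
    have hE: "hausdorff_outer (?n - 1) (E j) < ennreal (b j)" for j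
    proof -
      have "hausdorff_outer (?n - 1) (E j) = emeasure ?S (E j)"
        by (rule emeasure_surface_measure[symmetric]) measurable
      also have "\<dots> = ennreal (measure ?S (E j))"
        using E_fin[of j] by (intro emeasure_eq_ennreal_measure) (auto simp: less_top[symmetric])
      also have "\<dots> < ennreal (b j)" using \<gamma> by (simp add: b_def ennreal_less_iff)
      finally show ?thesis .
    qed
    have "uniformly_continuous_on (closure D) f"
      using f'(1) D(2) by (intro compact_uniformly_continuous) auto
    then obtain \<delta>0 where \<delta>0: "\<delta>0 > 0"
      "\<And>x y. x \<in> closure D \<Longrightarrow> y \<in> closure D \<Longrightarrow> dist y x < \<delta>0 \<Longrightarrow> dist (f y) (f x) < \<epsilon>"
      unfolding uniformly_continuous_on_def using e by metis
    define \<delta> where "\<delta> = min \<epsilon> (\<delta>0 / 3)"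
    have \<delta>: "\<delta> > 0" "\<delta> \<le> \<epsilon>" "3 * \<delta> \<le> \<delta>0" using \<delta>0 e by (auto simp: \<delta>_def)
    define Q where "Q j x r J \<longleftrightarrow> (\<forall>i\<in>J. x i \<in> E j) \<and> (\<forall>i. 0 < r i \<and> r i < \<delta>) \<and>
      E j \<subseteq> (\<Union>i\<in>J. ball (x i) (r i)) \<and>
      (\<forall>I. finite I \<longrightarrow> I \<subseteq> J \<longrightarrow> (\<Sum>i\<in>I. ?v * (r i / 2) ^ (?n - 1)) \<le> b j)"
      for j J and x :: "nat \<Rightarrow> real^'n" and r :: "nat \<Rightarrow> real"
    have "\<exists>x r J. Q j x r J" for j
      by (rule hausdorff_ball_cover[OF hE[of j] \<delta>(1)]) (unfold Q_def, blast)
    then obtain x r J where Q: "\<And>j. Q j (x j) (r j) (J j)" by metis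
    have xE: "\<And>j i. i \<in> J j \<Longrightarrow> x j i \<in> E j" and r: "\<And>j i. 0 < r j i" "\<And>j i. r j i < \<delta>" and
      cov: "\<And>j. E j \<subseteq> (\<Union>i\<in>J j. ball (x j i) (r j i))" and
      rsum: "\<And>j I. finite I \<Longrightarrow> I \<subseteq> J j \<Longrightarrow> (\<Sum>i\<in>I. ?v * (r j i / 2) ^ (?n - 1)) \<le> b j"
      using Q by (auto simp: Q_def)
    have rsum': "(\<Sum>i\<in>I. r j i ^ (?n - 1)) \<le> 2 ^ (?n - 1) / ?v * b j" if "finite I" "I \<subseteq> J j" for j I
    proof -
      have "(\<Sum>i\<in>I. ?v * (r j i / 2) ^ (?n - 1)) = ?v / 2 ^ (?n - 1) * (\<Sum>i\<in>I. r j i ^ (?n - 1))"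
        by (simp add: sum_distrib_left power_divide)
      then have "?v / 2 ^ (?n - 1) * (\<Sum>i\<in>I. r j i ^ (?n - 1)) \<le> b j"
        using rsum[OF that] by linarith
      then have "2 ^ (?n - 1) / ?v * (?v / 2 ^ (?n - 1) * (\<Sum>i\<in>I. r j i ^ (?n - 1))) \<le> 2 ^ (?n - 1) / ?v * b j"
        using v by (intro mult_left_mono) auto
      moreover have "a / w * (w / a * X) = X" if "w > 0" "a > 0" for a w X :: real
        using that by simp
      ultimately show ?thesis using v by (metis zero_less_numeral zero_less_power)
    qed
    define p where "p = (\<lambda>(j, i). x j i)"
    define \<rho> where "\<rho> = (\<lambda>(j, i). r j i)"
    have "?B \<subseteq> (\<Union>q\<in>Sigma {..<N} J. ball (p q) (\<rho> q))"
      unfolding B_eq using cov by (fastforce simp: p_def \<rho>_def)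
    then obtain I where I: "I \<subseteq> Sigma {..<N} J" "finite I" "?B \<subseteq> (\<Union>q\<in>I. ball (p q) (\<rho> q))"
      using compactE_image[OF Bc, of "Sigma {..<N} J" "\<lambda>q. ball (p q) (\<rho> q)"] by auto
    define I' where "I' j = {i. (j, i) \<in> I}" for j
    have I'fin: "finite (I' j)" for j
      using finite_imageI[OF I(2), of snd] by (rule finite_subset[rotated]) (force simp: I'_def)
    have I'J: "I' j \<subseteq> J j" for j using I(1) by (auto simp: I'_def)
    have I_eq: "I = Sigma {..<N} I'" using I(1) by (auto simp: I'_def)
    have sum_I: "(\<Sum>q\<in>I. F q) = (\<Sum>j<N. \<Sum>i\<in>I' j. F (j, i))" for F :: "nat \<times> nat \<Rightarrow> real"
      unfolding I_eq by (subst sum.Sigma) (auto simp: I'fin)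
    \<comment> \<open>one step for the width of the piece, one for the oscillation of \<open>f\<close> on a tripled ball\<close>
    define s where "s q = (real (fst q) + 2) * \<epsilon>" for q :: "nat \<times> nat"
    have s_bd: "\<bar>f y\<bar> \<le> s q" if q: "q \<in> I" and y: "y \<in> D" "y \<in> ball (p q) (3 * \<rho> q)" for q y
    proof -
      obtain j i where ji: "q = (j, i)" by (cases q)
      then have xj: "x j i \<in> E j" using q I(1) xE by auto
      have "dist y (x j i) < \<delta>0"
        using y(2) r(2)[of j i] \<delta>(3) ji by (auto simp: p_def \<rho>_def dist_commute)
      then have "dist (f y) (f (x j i)) < \<epsilon>"
        using xj E_sub BD y(1) closure_subset by (intro \<delta>0(2)) blast+
      moreover have "\<bar>f (x j i)\<bar> < (real j + 1) * \<epsilon>" using xj by (simp add: E_def)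
      ultimately show ?thesis using ji by (auto simp: s_def dist_real_def algebra_simps)
    qed
    have "\<bar>LINT x:D|lborel. ?g x\<bar> \<le> (\<Sum>q\<in>I. unit_ball_vol (real ?n) * 3 ^ ?n * s q * \<rho> q ^ (?n - 1))
      + Mg * (\<Sum>q\<in>I. unit_ball_vol (real ?n) * 2 ^ ?n * \<rho> q * \<rho> q ^ (?n - 1))"
      using e r(1) Mg closure_subset[of D]
      by (intro integral_part_deriv_cover_bound[OF D f I(2) _ I(3) s_bd])
         (auto simp: \<rho>_def s_def split: prod.splits)
    also have "(\<Sum>q\<in>I. unit_ball_vol (real ?n) * 3 ^ ?n * s q * \<rho> q ^ (?n - 1))
        = (\<Sum>j<N. W * ((real j + 2) * \<epsilon>) * (\<Sum>i\<in>I' j. r j i ^ (?n - 1)))"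
      unfolding sum_I by (simp add: sum_distrib_left W_def s_def \<rho>_def)
    also have "\<dots> \<le> (\<Sum>j<N. W * ((real j + 2) * \<epsilon>) * (2 ^ (?n - 1) / ?v * b j))"
      using W e by (intro sum_mono mult_left_mono rsum' I'fin I'J) auto
    also have "\<dots> = C * (\<Sum>j<N. (real j + 2) * \<epsilon> * b j)"
      by (simp add: C_def sum_distrib_left sum_divide_distrib mult_ac)
    also have "(\<Sum>j<N. (real j + 2) * \<epsilon> * b j) \<le> L + 2 * \<epsilon> * hB + \<epsilon>"
    proof -
      have "(\<Sum>j<N. real j * \<epsilon> * measure ?S (E j)) = (\<Sum>j<N. (LINT x|?S. indicator (E j) x * (real j * \<epsilon>)))"
        by (simp add: mult.commute)
      also have "\<dots> = (LINT x|?S. (\<Sum>j<N. indicator (E j) x * (real j * \<epsilon>)))"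
        using E_fin by (intro Bochner_Integration.integral_sum[symmetric] integrable_mult_left integrable_real_indicator) auto
      also have "\<dots> \<le> (LINT x|?S. indicator ?B x *\<^sub>R \<bar>f x\<bar>)"
      proof (rule integral_mono[OF _ f_int])
        show "integrable ?S (\<lambda>x. \<Sum>j<N. indicator (E j) x * (real j * \<epsilon>))"
          using E_fin by (intro Bochner_Integration.integrable_sum integrable_mult_left integrable_real_indicator) auto
        fix x
        show "(\<Sum>j<N. indicator (E j) x * (real j * \<epsilon>)) \<le> indicator ?B x *\<^sub>R \<bar>f x\<bar>"
        proof (cases "x \<in> ?B")
          case True
          then obtain j where j: "j < N" "x \<in> E j" using B_eq by blast
          have "indicator (E i) x * (real i * \<epsilon>) = (if i = j then real j * \<epsilon> else 0)" if "i < N" for i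
            using E_disj j that by (auto simp: disjoint_family_on_def indicator_def)
          then have "(\<Sum>i<N. indicator (E i) x * (real i * \<epsilon>)) = (\<Sum>i<N. if i = j then real j * \<epsilon> else 0)"
            by (intro sum.cong) auto
          also have "\<dots> = real j * \<epsilon>" using j by simp
          also have "\<dots> \<le> \<bar>f x\<bar>" using j by (simp add: E_def)
          finally show ?thesis using True by simp
        next
          case False
          then have "x \<notin> E j" for j using E_sub by blast
          then show ?thesis using False by simp
        qed
      qed
      finally have 1: "(\<Sum>j<N. real j * \<epsilon> * measure ?S (E j)) \<le> L"
        by (simp add: L_def set_lebesgue_integral_def)
      have "(\<Sum>j<N. (real j + 2) * \<epsilon> * \<gamma>) \<le> (\<Sum>j<N. (real N + 2) * \<epsilon> * (1 / (real N * (real N + 2))))"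
        using e \<gamma> by (intro sum_mono mult_mono) (auto simp: \<gamma>_def)
      also have "\<dots> = real N * ((real N + 2) * \<epsilon> * (1 / (real N * (real N + 2))))"
        by (simp only: sum_constant card_lessThan)
      also have "\<dots> = \<epsilon>"
      proof -
        have "u * (w * \<epsilon> * (1 / (u * w))) = \<epsilon>" if "u > 0" "w > 0" for u w :: real
          using that by simp
        then show ?thesis using N0 by simp
      qed
      finally have 2: "(\<Sum>j<N. (real j + 2) * \<epsilon> * \<gamma>) \<le> \<epsilon>" .
      have "(\<Sum>j<N. (real j + 2) * \<epsilon> * b j) = (\<Sum>j<N. real j * \<epsilon> * measure ?S (E j))
          + 2 * \<epsilon> * (\<Sum>j<N. measure ?S (E j)) + (\<Sum>j<N. (real j + 2) * \<epsilon> * \<gamma>)"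
        by (simp add: b_def sum.distrib[symmetric] sum_distrib_left algebra_simps)
      then show ?thesis using 1 2 by (simp add: sum_mE)
    qed
    also have "(\<Sum>q\<in>I. unit_ball_vol (real ?n) * 2 ^ ?n * \<rho> q * \<rho> q ^ (?n - 1)) \<le> C * \<epsilon> * (hB + \<epsilon>)"
    proof -
      have "(\<Sum>q\<in>I. unit_ball_vol (real ?n) * 2 ^ ?n * \<rho> q * \<rho> q ^ (?n - 1))
          \<le> (\<Sum>q\<in>I. W * \<epsilon> * \<rho> q ^ (?n - 1))"
      proof (rule sum_mono)
        fix q assume "q \<in> I"
        have \<rho>: "0 < \<rho> q" "\<rho> q < \<epsilon>"
          using r less_le_trans[OF r(2) \<delta>(2)] by (auto simp: \<rho>_def split: prod.splits)
        have "(2::real) ^ ?n \<le> 3 ^ ?n" by (intro power_mono) auto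
        then have "unit_ball_vol (real ?n) * 2 ^ ?n * \<rho> q \<le> W * \<epsilon>"
          unfolding W_def using \<rho> by (intro mult_mono) auto
        then show "unit_ball_vol (real ?n) * 2 ^ ?n * \<rho> q * \<rho> q ^ (?n - 1) \<le> W * \<epsilon> * \<rho> q ^ (?n - 1)"
          using \<rho> by (intro mult_right_mono) auto
      qed
      also have "\<dots> = (\<Sum>j<N. W * \<epsilon> * (\<Sum>i\<in>I' j. r j i ^ (?n - 1)))"
        unfolding sum_I by (simp add: sum_distrib_left \<rho>_def)
      also have "\<dots> \<le> (\<Sum>j<N. W * \<epsilon> * (2 ^ (?n - 1) / ?v * b j))"
        using W e by (intro sum_mono mult_left_mono rsum' I'fin I'J) auto
      also have "\<dots> = C * \<epsilon> * (\<Sum>j<N. b j)"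
        unfolding sum_distrib_left by (simp add: C_def mult_ac)
      also have "(\<Sum>j<N. b j) = hB + real N * \<gamma>" by (simp add: b_def sum.distrib sum_mE)
      also have "real N * \<gamma> \<le> real N * (\<epsilon> / real N)" by (intro mult_left_mono) (auto simp: \<gamma>_def)
      also have "\<dots> = \<epsilon>" using N0 by simp
      finally show ?thesis using C e by (simp add: mult_left_mono)
    qed
    finally show ?thesis using C Mg(1) by (simp add: mult_left_mono mult.assoc)
  qed
  have "((\<lambda>\<epsilon>. C * (L + 2 * \<epsilon> * hB + \<epsilon>) + Mg * C * \<epsilon> * (hB + \<epsilon>)) \<longlongrightarrow>
      C * (L + 2 * 0 * hB + 0) + Mg * C * 0 * (hB + 0)) (at_right 0)"
    by (intro tendsto_intros)
  then have "\<bar>LINT x:D|lborel. ?g x\<bar> \<le> C * (L + 2 * 0 * hB + 0) + Mg * C * 0 * (hB + 0)"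
    by (rule tendsto_lowerbound) (auto simp: eventually_at_right_less intro!: eventually_mono[OF eventually_at_right_less] key)
  then show ?thesis unfolding boundary_const_def by (simp add: C_def W_def L_def)
qed

section \<open>Functions that are smooth up to the boundary\<close>


lemma frechet_derivative_cong_open:
  assumes S: "open S" "x \<in> S" and eq: "\<And>y. y \<in> S \<Longrightarrow> f y = g y"
  shows "frechet_derivative f (at x) = frechet_derivative g (at x)"
proof -
  have "(f has_derivative f') (at x) \<longleftrightarrow> (g has_derivative f') (at x)" for f'
    using has_derivative_transform_within_open[OF _ S, of f f' UNIV g]
      has_derivative_transform_within_open[OF _ S, of g f' UNIV f] eq by auto
  then show ?thesis by (simp add: frechet_derivative_def)
qed

lemma not_bot_at_within_closure:
  fixes x :: "real^'n"
  assumes "open S" "x \<in> closure S"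
  shows "at x within S \<noteq> bot"
proof (cases "x \<in> S")
  case True
  show ?thesis unfolding at_within_open[OF True assms(1)] by (rule at_neq_bot)
next
  case False
  then show ?thesis using assms by (auto simp: trivial_limit_within closure_def)
qed

lemma part_deriv_boundary_eq:
  assumes S: "open S" and x: "x \<in> closure S" "x \<notin> S"
    and lim: "((\<lambda>y. frechet_derivative f (at y) (axis i 1)) \<longlongrightarrow> l) (at x within S)"
  shows "part_deriv S i f x = l"
  using tendsto_Lim[OF not_bot_at_within_closure[OF S x(1)] lim] x by (simp add: part_deriv_def)

lemma part_deriv_tendsto:
  assumes S: "open S" and x: "x \<in> closure S" and c: "continuous_on (closure S) (part_deriv S i f)"
  shows "((\<lambda>y. frechet_derivative f (at y) (axis i 1)) \<longlongrightarrow> part_deriv S i f x) (at x within S)"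
proof -
  have "(part_deriv S i f \<longlongrightarrow> part_deriv S i f x) (at x within S)"
    using c x closure_subset unfolding continuous_on_def by (meson tendsto_within_subset)
  then show ?thesis
    by (rule Lim_transform_eventually) (auto simp: eventually_at_filter part_deriv_def)
qed

lemma part_deriv_cong:
  assumes S: "open S" and eq: "\<And>y. y \<in> S \<Longrightarrow> f y = g y"
  shows "part_deriv S i f x = part_deriv S i g x"
proof -
  have eq': "frechet_derivative f (at y) = frechet_derivative g (at y)" if "y \<in> S" for y
    using frechet_derivative_cong_open[OF S that eq] .
  have "((\<lambda>y. frechet_derivative f (at y) (axis i 1)) \<longlongrightarrow> l) (at x within S) \<longleftrightarrow>
     ((\<lambda>y. frechet_derivative g (at y) (axis i 1)) \<longlongrightarrow> l) (at x within S)" for l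
    by (rule tendsto_cong) (auto simp: eventually_at_filter eq')
  then show ?thesis by (auto simp: part_deriv_def eq' t2_space_class.Lim_def)
qed

lemma Ck_closure_cong:
  assumes "open S" "Ck_closure k S f" "\<And>x. x \<in> closure S \<Longrightarrow> f x = g x"
  shows "Ck_closure k S g"
  using assms(2,3)
proof (induction k arbitrary: f g)
  case 0
  then show ?case by (auto cong: continuous_on_cong)
next
  case (Suc k)
  have eq: "f y = g y" if "y \<in> S" for y using Suc.prems(2) that closure_subset by blast
  have "g differentiable (at x)" if x: "x \<in> S" for x
  proof -
    have "f differentiable (at x)" using Suc.prems(1) x by simp
    then show ?thesis
      unfolding differentiable_def
      using has_derivative_transform_within_open[OF _ assms(1) x, of f _ UNIV g] eq by blast
  qed
  moreover have "continuous_on (closure S) g"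
    using Suc.prems by (auto cong: continuous_on_cong)
  moreover have "Ck_closure k S (part_deriv S i g)" for i
  proof (rule Suc.IH)
    show "Ck_closure k S (part_deriv S i f)" using Suc.prems(1) by simp
  qed (rule part_deriv_cong[OF assms(1) eq])
  ultimately show ?case by simp
qed

lemma Ck_closure_SucD: "Ck_closure (Suc k) S f \<Longrightarrow> Ck_closure k S f"
proof (induction k arbitrary: f)
  case (Suc k)
  show ?case
    unfolding Ck_closure.simps(2)[of k]
    using Suc.prems[unfolded Ck_closure.simps(2)[of "Suc k"]] Suc.IH by blast
qed simp

lemma Ck_closure_continuous: "Ck_closure k S f \<Longrightarrow> continuous_on (closure S) f"
  by (cases k) auto

lemma Ck_closure_Suc_1: "Ck_closure (Suc k) S f \<Longrightarrow> Ck_closure 1 S f"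
  using Ck_closure_continuous[of k S] by simp

lemma Ck_closure_2D:
  assumes "Ck_closure 2 S f"
  shows "Ck_closure 1 S f" "Ck_closure 1 S (part_deriv S i f)"
  using assms Ck_closure_SucD[of 1 S f] unfolding numeral_2_eq_2 One_nat_def by simp_all

lemma Ck_closure_1_iff:
  "Ck_closure 1 S f \<longleftrightarrow> continuous_on (closure S) f \<and> (\<forall>x\<in>S. f differentiable (at x)) \<and>
     (\<forall>i. continuous_on (closure S) (part_deriv S i f))"
  by (simp add: One_nat_def)

lemma part_deriv_subset:
  assumes D: "open D" "D \<subseteq> S" and f: "Ck_closure 1 S f" and S: "open S" and x: "x \<in> closure D"
  shows "part_deriv D i f x = part_deriv S i f x"
proof (cases "x \<in> D")
  case True
  then show ?thesis using D by (auto simp: part_deriv_def)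
next
  case False
  have "x \<in> closure S" using x D(2) closure_mono by blast
  then have "((\<lambda>y. frechet_derivative f (at y) (axis i 1)) \<longlongrightarrow> part_deriv S i f x) (at x within S)"
    using f S by (intro part_deriv_tendsto) (auto simp: Ck_closure_1_iff simp del: One_nat_def)
  then show ?thesis
    using D x False by (intro part_deriv_boundary_eq) (auto intro: tendsto_within_subset)
qed

lemma Ck_closure_subset:
  assumes D: "open D" "D \<subseteq> S" and S: "open S"
  shows "Ck_closure k S f \<Longrightarrow> Ck_closure k D f"
proof (induction k arbitrary: f)
  case 0
  then show ?case using closure_mono[OF D(2)] by (auto intro: continuous_on_subset)
next
  case (Suc k)
  have "Ck_closure k D (part_deriv D i f)" for i
  proof (cases k)
    case 0
    then have f: "Ck_closure 1 S f" using Suc.prems by simp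
    then have "continuous_on (closure D) (part_deriv S i f)"
      using closure_mono[OF D(2)] by (auto simp: Ck_closure_1_iff simp del: One_nat_def intro: continuous_on_subset)
    then show ?thesis
      using 0 part_deriv_subset[OF D f S] by (simp cong: continuous_on_cong)
  next
    case (Suc k')
    then have "Ck_closure (Suc (Suc k')) S f" using Suc.prems by simp
    then have f: "Ck_closure 1 S f" by (rule Ck_closure_Suc_1)
    have "Ck_closure k D (part_deriv S i f)" using Suc.IH Suc.prems by simp
    then show ?thesis
      by (rule Ck_closure_cong[OF D(1)]) (rule part_deriv_subset[OF D f S, symmetric])
  qed
  then show ?case
    using Suc.prems closure_mono[OF D(2)] D(2) by (auto intro: continuous_on_subset)
qed

lemma part_deriv_diff:
  assumes S: "open S" and f: "Ck_closure 1 S f" and g: "Ck_closure 1 S g" and x: "x \<in> closure S"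
  shows "part_deriv S i (\<lambda>y. f y - g y) x = part_deriv S i f x - part_deriv S i g x"
proof -
  note fg = f[unfolded Ck_closure_1_iff] g[unfolded Ck_closure_1_iff]
  have *: "frechet_derivative (\<lambda>y. f y - g y) (at y) (axis i 1)
      = frechet_derivative f (at y) (axis i 1) - frechet_derivative g (at y) (axis i 1)"
    if "y \<in> S" for y
  proof -
    have "(f has_derivative frechet_derivative f (at y)) (at y)" "(g has_derivative frechet_derivative g (at y)) (at y)"
      using fg that by (auto simp: frechet_derivative_works)
    from frechet_derivative_at[OF has_derivative_diff[OF this]] show ?thesis
      by (simp add: fun_eq_iff)
  qed
  show ?thesis
  proof (cases "x \<in> S")
    case True
    then show ?thesis using * by (simp add: part_deriv_def)
  next
    case False
    have "((\<lambda>y. frechet_derivative f (at y) (axis i 1) - frechet_derivative g (at y) (axis i 1)) \<longlongrightarrow>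
        part_deriv S i f x - part_deriv S i g x) (at x within S)"
      using S x fg by (intro tendsto_diff part_deriv_tendsto) auto
    then have "((\<lambda>y. frechet_derivative (\<lambda>y. f y - g y) (at y) (axis i 1)) \<longlongrightarrow>
        part_deriv S i f x - part_deriv S i g x) (at x within S)"
      by (rule Lim_transform_eventually) (auto simp: eventually_at_filter *)
    then show ?thesis by (rule part_deriv_boundary_eq[OF S x False])
  qed
qed

lemma Ck_closure_diff:
  assumes S: "open S"
  shows "Ck_closure k S f \<Longrightarrow> Ck_closure k S g \<Longrightarrow> Ck_closure k S (\<lambda>y. f y - g y)"
proof (induction k arbitrary: f g)
  case 0
  then show ?case by (auto intro: continuous_intros)
next
  case (Suc k)
  have 1: "Ck_closure 1 S h" if "Ck_closure (Suc k) S h" for h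
    using that by (rule Ck_closure_Suc_1)
  have "Ck_closure k S (part_deriv S i (\<lambda>y. f y - g y))" for i
  proof (rule Ck_closure_cong[OF S])
    show "Ck_closure k S (\<lambda>x. part_deriv S i f x - part_deriv S i g x)"
      using Suc.IH Suc.prems by simp
  qed (rule part_deriv_diff[OF S 1[OF Suc.prems(1)] 1[OF Suc.prems(2)], symmetric])
  then show ?case using Suc.prems by (auto intro: continuous_intros)
qed

lemma grad_subset:
  "open D \<Longrightarrow> D \<subseteq> S \<Longrightarrow> Ck_closure 1 S f \<Longrightarrow> open S \<Longrightarrow> x \<in> closure D \<Longrightarrow> grad D f x = grad S f x"
  by (simp add: grad_def part_deriv_subset vec_eq_iff)

lemma grad_diff:
  "open S \<Longrightarrow> Ck_closure 1 S f \<Longrightarrow> Ck_closure 1 S g \<Longrightarrow> x \<in> closure S \<Longrightarrow>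
    grad S (\<lambda>y. f y - g y) x = grad S f x - grad S g x"
  by (simp add: grad_def part_deriv_diff vec_eq_iff)

lemma continuous_on_grad:
  "Ck_closure 1 S f \<Longrightarrow> continuous_on (closure S) (grad S f)"
  unfolding grad_def Ck_closure_1_iff by (intro continuous_on_vec_lambda) auto

lemma has_derivative_grad:
  assumes "x \<in> S" "f differentiable (at x)"
  shows "(f has_derivative (\<lambda>h. grad S f x \<bullet> h)) (at x)"
proof -
  let ?F = "frechet_derivative f (at x)"
  have lin: "linear ?F" using assms(2) by (rule linear_frechet_derivative)
  have "?F h = grad S f x \<bullet> h" for h
  proof -
    have "?F h = ?F (\<Sum>i\<in>UNIV. h $ i *\<^sub>R axis i 1)"
      by (simp add: basis_expansion flip: scalar_mult_eq_scaleR)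
    also have "\<dots> = (\<Sum>i\<in>UNIV. h $ i * ?F (axis i 1))"
      using lin by (simp add: linear_sum linear_cmul)
    finally show ?thesis using assms(1) by (simp add: inner_vec_def grad_def part_deriv_def mult.commute)
  qed
  then have "?F = (\<lambda>h. grad S f x \<bullet> h)" by auto
  then show ?thesis using assms(2) frechet_derivative_works by metis
qed

text \<open>
  End points on the boundary are allowed because the mean value theorem asks for differentiability
  on the open segment only.
\<close>

lemma mean_value_closure:
  fixes a b :: "real^'n"
  assumes f: "Ck_closure 1 S f" and seg: "open_segment a b \<subseteq> S" "a \<in> closure S" "b \<in> closure S"
    and bd: "\<And>y. y \<in> open_segment a b \<Longrightarrow> norm (grad S f y - G) \<le> e"
  shows "\<bar>f b - f a - G \<bullet> (b - a)\<bar> \<le> e * norm (b - a)"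
proof (cases "a = b")
  case False
  define \<phi> where "\<phi> t = f (a + t *\<^sub>R (b - a)) - t * (G \<bullet> (b - a))" for t
  have in_seg: "a + t *\<^sub>R (b - a) \<in> open_segment a b" if "0 < t" "t < 1" for t
    using that False unfolding in_segment by (auto intro!: exI[of _ t] simp: algebra_simps)
  have in_cl: "a + t *\<^sub>R (b - a) \<in> closure S" if "0 \<le> t" "t \<le> 1" for t
  proof (cases "t = 0 \<or> t = 1")
    case True then show ?thesis using seg by auto
  next
    case False
    then show ?thesis using in_seg[of t] that seg(1) closure_subset by fastforce
  qed
  have der: "(\<phi> has_derivative (\<lambda>h. h * ((grad S f (a + t *\<^sub>R (b - a)) - G) \<bullet> (b - a)))) (at t)"
    if t: "0 < t" "t < 1" for t
  proof -
    have x: "a + t *\<^sub>R (b - a) \<in> S" using in_seg[OF t] seg(1) by blast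
    have "(f has_derivative (\<lambda>h. grad S f (a + t *\<^sub>R (b - a)) \<bullet> h)) (at (a + t *\<^sub>R (b - a)))"
      using f x by (intro has_derivative_grad) (auto simp: Ck_closure_1_iff simp del: One_nat_def)
    then have "((\<lambda>t. f (a + t *\<^sub>R (b - a))) has_derivative (\<lambda>h. grad S f (a + t *\<^sub>R (b - a)) \<bullet> (h *\<^sub>R (b - a)))) (at t)"
      by (rule has_derivative_compose[rotated]) (auto intro!: derivative_eq_intros)
    then show ?thesis unfolding \<phi>_def
      by (rule has_derivative_eq_rhs[OF has_derivative_diff[OF _ has_derivative_mult_left[OF has_derivative_ident]]])
         (auto simp: fun_eq_iff inner_diff_left algebra_simps)
  qed
  have "continuous_on {0..1} \<phi>"
    unfolding \<phi>_def
  proof (intro continuous_intros)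
    show "continuous_on {0..1} (\<lambda>t. f (a + t *\<^sub>R (b - a)))"
    proof (rule continuous_on_compose2[where g=f and f="\<lambda>t. a + t *\<^sub>R (b - a)" and t="closure S"])
      show "continuous_on (closure S) f" using f by (rule Ck_closure_continuous)
      show "continuous_on {0..1} (\<lambda>t. a + t *\<^sub>R (b - a))" by (intro continuous_intros)
      show "(\<lambda>t. a + t *\<^sub>R (b - a)) ` {0..1} \<subseteq> closure S" using in_cl by auto
    qed
  qed
  then obtain t where t: "0 < t" "t < 1" "\<phi> 1 - \<phi> 0 = (1 - 0) * ((grad S f (a + t *\<^sub>R (b - a)) - G) \<bullet> (b - a))"
    using mvt[of 0 1 \<phi>, OF _ _ der] by auto
  have "\<bar>f b - f a - G \<bullet> (b - a)\<bar> = \<bar>(grad S f (a + t *\<^sub>R (b - a)) - G) \<bullet> (b - a)\<bar>"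
    using t(3) by (simp add: \<phi>_def)
  also have "\<dots> \<le> norm (grad S f (a + t *\<^sub>R (b - a)) - G) * norm (b - a)"
    by (rule Cauchy_Schwarz_ineq2)
  also have "\<dots> \<le> e * norm (b - a)"
    using bd[OF in_seg[OF t(1,2)]] by (intro mult_right_mono) auto
  finally show ?thesis .
qed simp

section \<open>Normal and tangential derivatives on the boundary\<close>

lemma local_defining_funD:
  assumes "local_defining_fun k \<Omega> U g"
  shows "open U" "Ck_closure k U g" "\<And>x. x \<in> U \<Longrightarrow> grad U g x \<noteq> 0"
    "\<And>x. x \<in> U \<Longrightarrow> x \<in> \<Omega> \<longleftrightarrow> g x < 0" "\<And>x. x \<in> U \<Longrightarrow> x \<in> frontier \<Omega> \<longleftrightarrow> g x = 0"
  using assms unfolding local_defining_fun_def by blast+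

lemma local_defining_fun_2_1: "local_defining_fun 2 \<Omega> U g \<Longrightarrow> local_defining_fun 1 \<Omega> U g"
  unfolding local_defining_fun_def using Ck_closure_2D(1) by blast

lemma strict_differentiability:
  fixes g :: "real^'n \<Rightarrow> real"
  assumes U: "open U" "x \<in> U" and g: "Ck_closure 1 U g" and e: "e > 0"
  obtains \<delta> where "\<delta> > 0" "ball x \<delta> \<subseteq> U"
    "\<And>z w. z \<in> ball x \<delta> \<Longrightarrow> w \<in> ball x \<delta> \<Longrightarrow> \<bar>g z - g w - grad U g x \<bullet> (z - w)\<bar> \<le> e * norm (z - w)"
proof -
  have "continuous_on U (grad U g)"
    using continuous_on_grad[OF g] closure_subset by (rule continuous_on_subset)
  then obtain d where d: "d > 0" "\<And>y. y \<in> U \<Longrightarrow> dist y x < d \<Longrightarrow> dist (grad U g y) (grad U g x) < e"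
    unfolding continuous_on_iff using U e by metis
  obtain d' where d': "d' > 0" "ball x d' \<subseteq> U" using U open_contains_ball by metis
  show thesis
  proof
    show "min d d' > 0" using d d' by simp
    show sub: "ball x (min d d') \<subseteq> U" using d' by auto
    fix z w assume zw: "z \<in> ball x (min d d')" "w \<in> ball x (min d d')"
    then have seg: "open_segment w z \<subseteq> ball x (min d d')"
      by (meson convex_ball convex_contains_open_segment)
    show "\<bar>g z - g w - grad U g x \<bullet> (z - w)\<bar> \<le> e * norm (z - w)"
    proof (rule mean_value_closure[OF g])
      show "open_segment w z \<subseteq> U" using seg sub by blast
      show "w \<in> closure U" "z \<in> closure U" using zw sub closure_subset by blast+
      fix y assume "y \<in> open_segment w z"
      then have "y \<in> U" "dist y x < d" using seg sub by (auto simp: dist_commute)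
      then show "norm (grad U g y - grad U g x) \<le> e" using d(2) by (simp add: dist_norm less_imp_le)
    qed
  qed
qed

text \<open>
  A direction along which one defining function decreases enters the domain, so no other defining
  function can increase along it. Hence the gradients of any two defining functions are positive
  multiples of each other and the outward normal is well defined.
\<close>

lemma local_defining_fun_halfspace:
  fixes x h :: "real^'n"
  assumes 1: "local_defining_fun 1 \<Omega> U1 g1" "x \<in> U1" and 2: "local_defining_fun 1 \<Omega> U2 g2" "x \<in> U2"
    and x: "x \<in> frontier \<Omega>" and h: "grad U1 g1 x \<bullet> h < 0"
  shows "grad U2 g2 x \<bullet> h \<le> 0"
proof (rule ccontr)
  assume n: "\<not> ?thesis"
  note L1 = local_defining_funD[OF 1(1)] and L2 = local_defining_funD[OF 2(1)]
  define a1 where "a1 = grad U1 g1 x \<bullet> h"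
  define a2 where "a2 = grad U2 g2 x \<bullet> h"
  have a: "a1 < 0" "a2 > 0" using h n by (auto simp: a1_def a2_def)
  then have h0: "h \<noteq> 0" by (auto simp: a1_def)
  then have nh: "norm h > 0" by simp
  have pos: "- a1 / (2 * norm h) > 0" "a2 / (2 * norm h) > 0" using a nh by (auto simp: divide_neg_pos)
  obtain d1 where d1: "d1 > 0" "ball x d1 \<subseteq> U1"
    "\<And>z w. z \<in> ball x d1 \<Longrightarrow> w \<in> ball x d1 \<Longrightarrow> \<bar>g1 z - g1 w - grad U1 g1 x \<bullet> (z - w)\<bar> \<le> (- a1 / (2 * norm h)) * norm (z - w)"
    using strict_differentiability[OF L1(1) 1(2) L1(2) pos(1)] by blast
  obtain d2 where d2: "d2 > 0" "ball x d2 \<subseteq> U2"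
    "\<And>z w. z \<in> ball x d2 \<Longrightarrow> w \<in> ball x d2 \<Longrightarrow> \<bar>g2 z - g2 w - grad U2 g2 x \<bullet> (z - w)\<bar> \<le> (a2 / (2 * norm h)) * norm (z - w)"
    using strict_differentiability[OF L2(1) 2(2) L2(2) pos(2)] by blast
  define t where "t = min d1 d2 / (2 * norm h)"
  have t: "t > 0" using d1 d2 nh by (simp add: t_def)
  define z where "z = x + t *\<^sub>R h"
  have nz: "norm (z - x) = t * norm h" using t by (simp add: z_def)
  then have "dist x z < d1" "dist x z < d2"
    using d1(1) d2(1) nh by (auto simp: dist_norm norm_minus_commute t_def)
  then have z: "z \<in> ball x d1" "z \<in> ball x d2" by auto
  have x': "x \<in> ball x d1" "x \<in> ball x d2" using d1 d2 by auto
  have g0: "g1 x = 0" "g2 x = 0" using L1(5) L2(5) x 1(2) 2(2) by auto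
  have i: "grad U1 g1 x \<bullet> (z - x) = t * a1" "grad U2 g2 x \<bullet> (z - x) = t * a2"
    by (simp_all add: z_def a1_def a2_def)
  have "\<bar>g1 z - t * a1\<bar> \<le> (- a1 / (2 * norm h)) * (t * norm h)"
    using d1(3)[OF z(1) x'(1)] by (simp add: g0 i nz)
  also have "\<dots> = - (t * a1) / 2" using nh by (simp add: field_simps)
  finally have "g1 z \<le> t * a1 / 2" by linarith
  moreover have "t * a1 < 0" using t a by (simp add: mult_pos_neg)
  ultimately have "g1 z < 0" by linarith
  then have "z \<in> \<Omega>" using L1(4) z(1) d1(2) by auto
  then have neg: "g2 z < 0" using L2(4) z(2) d2(2) by auto
  have "\<bar>g2 z - t * a2\<bar> \<le> (a2 / (2 * norm h)) * (t * norm h)"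
    using d2(3)[OF z(2) x'(2)] by (simp add: g0 i nz)
  also have "\<dots> = (t * a2) / 2" using nh by (simp add: field_simps)
  finally have "g2 z \<ge> t * a2 / 2" by linarith
  moreover have "t * a2 > 0" using t a by simp
  ultimately show False using neg by linarith
qed

lemma unit_vectors_eq_of_halfspaces:
  fixes b1 b2 :: "'a::real_inner"
  assumes n: "norm b1 = 1" "norm b2 = 1" and h: "\<And>h. b1 \<bullet> h < 0 \<Longrightarrow> b2 \<bullet> h \<le> 0"
  shows "b1 = b2"
proof -
  define c where "c = b1 \<bullet> b2"
  have s: "b1 \<bullet> b1 = 1" "b2 \<bullet> b2 = 1" using n by (simp_all add: norm_eq_1)
  have "b2 \<bullet> (- b1) \<le> 0" by (rule h) (simp add: s)
  then have c0: "c \<ge> 0" by (simp add: c_def inner_commute)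
  have "1 - c * c \<le> \<eta> * c" if "\<eta> > 0" for \<eta>
  proof -
    have "b2 \<bullet> (b2 - c *\<^sub>R b1 - \<eta> *\<^sub>R b1) \<le> 0"
      using that by (intro h) (simp add: inner_diff_right s c_def)
    then show ?thesis by (simp add: inner_diff_right s c_def inner_commute)
  qed
  note * = this
  have "((\<lambda>\<eta>. \<eta> * c) \<longlongrightarrow> 0 * c) (at_right 0)" by (intro tendsto_intros)
  then have "1 - c * c \<le> 0 * c"
    by (rule tendsto_lowerbound) (auto intro!: eventually_mono[OF eventually_at_right_less] *)
  then have "c \<ge> 1" using c0 by (smt (verit) mult_left_le)
  then have "norm (b1 - b2) ^ 2 \<le> 0"
    by (simp add: power2_norm_eq_inner inner_diff_left inner_diff_right s inner_commute c_def)
  then show ?thesis by simp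
qed

lemma outward_normal_eq:
  fixes x :: "real^'n"
  assumes g: "local_defining_fun 1 \<Omega> U g" "x \<in> U" and x: "x \<in> frontier \<Omega>"
  shows "outward_normal \<Omega> x = sgn (grad U g x)"
  unfolding outward_normal_def
proof (rule the_equality)
  show "\<exists>U' g'. x \<in> U' \<and> local_defining_fun 1 \<Omega> U' g' \<and> sgn (grad U g x) = sgn (grad U' g' x)"
    using g by blast
  fix \<nu> assume "\<exists>U' g'. x \<in> U' \<and> local_defining_fun 1 \<Omega> U' g' \<and> \<nu> = sgn (grad U' g' x)"
  then obtain U' g' where g': "x \<in> U'" "local_defining_fun 1 \<Omega> U' g'" "\<nu> = sgn (grad U' g' x)"
    by blast
  have nz: "grad U g x \<noteq> 0" "grad U' g' x \<noteq> 0"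
    using local_defining_funD(3) g g' by blast+
  show "\<nu> = sgn (grad U g x)"
    unfolding g'(3)
  proof (rule unit_vectors_eq_of_halfspaces)
    fix h assume "sgn (grad U' g' x) \<bullet> h < 0"
    then have "grad U' g' x \<bullet> h < 0"
      using nz by (simp add: sgn_div_norm mult_less_0_iff)
    then have "grad U g x \<bullet> h \<le> 0"
      by (rule local_defining_fun_halfspace[OF g'(2,1) g x])
    then show "sgn (grad U g x) \<bullet> h \<le> 0"
      using nz by (simp add: sgn_div_norm mult_le_0_iff)
  qed (use nz in \<open>auto simp: norm_sgn\<close>)
qed

text \<open>
  Two boundary points are joined inside the domain by going in along the normal, across, and out
  again. On this path, whose length is comparable to the distance of the two points, the gradient is
  close to its limit at \<open>x\<close>.
\<close>

lemma has_derivative_within_frontier: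
  fixes u :: "real^'n \<Rightarrow> real"
  assumes u: "Ck_closure 1 \<Omega> u" and \<Omega>: "open \<Omega>"
    and g: "local_defining_fun 1 \<Omega> U g" "x \<in> U" and x: "x \<in> frontier \<Omega>"
  shows "(u has_derivative (\<lambda>h. grad \<Omega> u x \<bullet> h)) (at x within frontier \<Omega>)"
proof -
  let ?G = "grad \<Omega> u x" and ?a = "grad U g x"
  note L = local_defining_funD[OF g(1)]
  have cl: "x \<in> closure \<Omega>" using x by (simp add: frontier_def)
  define A where "A = norm ?a"
  have A: "A > 0" using L(3)[OF g(2)] by (simp add: A_def)
  define \<nu> where "\<nu> = sgn ?a"
  have \<nu>: "norm \<nu> = 1" using L(3)[OF g(2)] by (simp add: \<nu>_def norm_sgn)
  have a\<nu>: "?a \<bullet> \<nu> = A"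
    using L(3)[OF g(2)]
    by (simp add: \<nu>_def A_def sgn_div_norm power2_norm_eq_inner[symmetric] power2_eq_square divide_inverse)
  obtain \<delta>1 where \<delta>1: "\<delta>1 > 0" "ball x \<delta>1 \<subseteq> U"
    "\<And>z w. z \<in> ball x \<delta>1 \<Longrightarrow> w \<in> ball x \<delta>1 \<Longrightarrow> \<bar>g z - g w - ?a \<bullet> (z - w)\<bar> \<le> (A/8) * norm (z - w)"
    using strict_differentiability[OF L(1) g(2) L(2), of "A/8"] A by (metis divide_pos_pos zero_less_numeral)
  show ?thesis
    unfolding has_derivative_within_alt
  proof (intro conjI allI impI)
    show "bounded_linear (\<lambda>h. ?G \<bullet> h)" by (rule bounded_linear_inner_right)
    fix e :: real assume e: "e > 0"
    obtain \<delta>2 where \<delta>2: "\<delta>2 > 0"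
      "\<And>y. y \<in> closure \<Omega> \<Longrightarrow> dist y x < \<delta>2 \<Longrightarrow> dist (grad \<Omega> u y) ?G < e / 3"
      using continuous_on_grad[OF u] cl e unfolding continuous_on_iff by (metis divide_pos_pos zero_less_numeral)
    define \<delta> where "\<delta> = min \<delta>1 \<delta>2"
    have \<delta>: "\<delta> > 0" using \<delta>1 \<delta>2 by (simp add: \<delta>_def)
    have "\<bar>u y - u x - ?G \<bullet> (y - x)\<bar> \<le> e * norm (y - x)"
      if y: "y \<in> frontier \<Omega>" "norm (y - x) < \<delta> / 2" for y
    proof -
      define l where "l = norm (y - x)"
      \<comment> \<open>depth of the detour: it lowers \<open>g\<close> by \<open>A l / 2\<close>, more than the linearisation errors, which
        have slope \<open>A/8\<close>, can raise it\<close>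
      define s where "s = l / 2"
      have l0: "l \<ge> 0" by (simp add: l_def)
      show ?thesis
      proof (cases "l = 0")
        case True then show ?thesis by (simp add: l_def)
      next
        case False
        then have l: "l > 0" and s: "s > 0" using l0 by (auto simp: s_def)
        have near: "z \<in> ball x \<delta>1" "dist z x < \<delta>2" if "norm (z - x) \<le> 3/2 * l" for z
          using that y(2) \<delta>1(1) \<delta>2(1) by (auto simp: \<delta>_def l_def dist_norm norm_minus_commute)
        have pt: "norm (x + \<theta> *\<^sub>R (y - x) - \<tau> *\<^sub>R \<nu> - x) \<le> 3/2 * l" if "0 \<le> \<theta>" "\<theta> \<le> 1" "0 \<le> \<tau>" "\<tau> \<le> s" for \<theta> \<tau>
        proof -
          have "norm (x + \<theta> *\<^sub>R (y - x) - \<tau> *\<^sub>R \<nu> - x) \<le> norm (\<theta> *\<^sub>R (y - x)) + norm (\<tau> *\<^sub>R \<nu>)"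
            by (metis add_diff_cancel_left' add_diff_eq norm_triangle_ineq4)
          also have "\<dots> \<le> 1 * l + s" using that l0 \<nu> by (auto simp: l_def mult_left_le_one_le intro!: add_mono)
          finally show ?thesis by (simp add: s_def)
        qed
        have xb: "x \<in> ball x \<delta>1" using \<delta>1 by simp
        have yb: "y \<in> ball x \<delta>1" using near(1)[of y] l by (simp add: l_def)
        have gx: "g x = 0" using L(5) g x by blast
        have gy: "g y = 0" using L(5) y(1) yb \<delta>1(2) by blast
        have ay: "?a \<bullet> (y - x) \<le> A/8 * l"
          using \<delta>1(3)[OF yb xb] gx gy by (simp add: l_def)
        have in\<Omega>: "x + \<theta> *\<^sub>R (y - x) - \<tau> *\<^sub>R \<nu> \<in> \<Omega>"
          if c: "(\<theta> = 0 \<and> 0 < \<tau> \<and> \<tau> \<le> s) \<or> (\<theta> = 1 \<and> 0 < \<tau> \<and> \<tau> \<le> s) \<or> (0 \<le> \<theta> \<and> \<theta> \<le> 1 \<and> \<tau> = s)" for \<theta> \<tau>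
        proof -
          let ?z = "x + \<theta> *\<^sub>R (y - x) - \<tau> *\<^sub>R \<nu>"
          have \<theta>: "0 \<le> \<theta>" "\<theta> \<le> 1" "0 < \<tau>" "\<tau> \<le> s" using c s by auto
          have zb: "?z \<in> ball x \<delta>1" using near(1) pt \<theta> by simp
          have "g ?z < 0"
          proof (cases "\<theta> = 1")
            case True
            have eq: "?z - y = - (\<tau> *\<^sub>R \<nu>)" using True by simp
            have nrm: "norm (?z - y) = \<tau>" unfolding eq using \<theta> \<nu> by simp
            have inr: "?a \<bullet> (?z - y) = - (\<tau> * A)" unfolding eq by (simp add: a\<nu>)
            have "\<bar>g ?z - g y - ?a \<bullet> (?z - y)\<bar> \<le> A/8 * norm (?z - y)" by (rule \<delta>1(3)[OF zb yb])
            then have "\<bar>g ?z + \<tau> * A\<bar> \<le> A / 8 * \<tau>" unfolding gy nrm inr by simp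
            moreover have "\<tau> * A > 0" using \<theta> A by simp
            moreover have "A / 8 * \<tau> = (\<tau> * A) / 8" by simp
            ultimately show ?thesis by linarith
          next
            case F: False
            have eq: "?z - x = \<theta> *\<^sub>R (y - x) - \<tau> *\<^sub>R \<nu>" by simp
            have b: "\<bar>g ?z - g x - ?a \<bullet> (?z - x)\<bar> \<le> A/8 * norm (?z - x)" by (rule \<delta>1(3)[OF zb xb])
            have inr: "?a \<bullet> (?z - x) = \<theta> * (?a \<bullet> (y - x)) - \<tau> * A" unfolding eq by (simp add: a\<nu> inner_diff_right)
            show ?thesis
            proof (cases "\<theta> = 0")
              case True
              have nrm: "norm (?z - x) = \<tau>" using True \<theta> \<nu> by simp
              have "\<bar>g ?z - g x - (\<theta> * (?a \<bullet> (y - x)) - \<tau> * A)\<bar> \<le> A / 8 * \<tau>"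
                using b by (simp only: inr nrm)
              then have "\<bar>g ?z + \<tau> * A\<bar> \<le> A / 8 * \<tau>" by (simp add: gx True)
              moreover have "\<tau> * A > 0" using \<theta> A by simp
              moreover have "A / 8 * \<tau> = (\<tau> * A) / 8" by simp
              ultimately show ?thesis by linarith
            next
              case False
              with F c have \<tau>: "\<tau> = s" by auto
              have "\<theta> * (?a \<bullet> (y - x)) \<le> A/8 * l"
              proof (cases "?a \<bullet> (y - x) \<ge> 0")
                case True
                then have "\<theta> * (?a \<bullet> (y - x)) \<le> 1 * (?a \<bullet> (y - x))" using \<theta> by (intro mult_right_mono) auto
                then show ?thesis using ay by simp
              next
                case False
                then have "\<theta> * (?a \<bullet> (y - x)) \<le> 0" using \<theta> by (simp add: mult_nonneg_nonpos)
                moreover have "0 \<le> A/8 * l" using A l by simp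
                ultimately show ?thesis by linarith
              qed
              moreover have "A/8 * norm (?z - x) \<le> A/8 * (3/2 * l)"
                using pt[of \<theta> \<tau>] \<theta> A by (intro mult_left_mono) auto
              moreover have "A * l > 0" using A l by simp
              moreover have "A / 8 * l = (A * l) / 8" "A / 8 * (3 / 2 * l) = 3/16 * (A * l)" "\<tau> * A = (A * l) / 2"
                by (simp_all add: s_def \<tau>)
              moreover have "\<bar>g ?z - g x - (\<theta> * (?a \<bullet> (y - x)) - \<tau> * A)\<bar> \<le> A/8 * norm (?z - x)"
                using b by (simp only: inr)
              ultimately show ?thesis using gx by linarith
            qed
          qed
          then show ?thesis using L(4) zb \<delta>1(2) by blast
        qed
        have gradb: "norm (grad \<Omega> u z - ?G) \<le> e/3" if "z \<in> \<Omega>" "norm (z - x) \<le> 3/2 * l" for z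
          using \<delta>2(2)[of z] near(2)[OF that(2)] that(1) closure_subset
          by (metis dist_norm less_imp_le subsetD)
        have move: "\<bar>u b - u a - ?G \<bullet> (b - a)\<bar> \<le> e/3 * norm (b - a)"
          if ins: "\<And>z. z \<in> open_segment a b \<Longrightarrow> z \<in> \<Omega> \<and> norm (z - x) \<le> 3/2 * l" and ab: "a \<in> closure \<Omega>" "b \<in> closure \<Omega>"
          for a b
        proof (rule mean_value_closure[OF u])
          show "open_segment a b \<subseteq> \<Omega>" using ins by blast
          show "norm (grad \<Omega> u z - ?G) \<le> e/3" if "z \<in> open_segment a b" for z
            using ins[OF that] gradb by blast
        qed (rule ab)+
        have inner: "x - s *\<^sub>R \<nu> \<in> closure \<Omega>" "y - s *\<^sub>R \<nu> \<in> closure \<Omega>"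
          using in\<Omega>[of 0 s] in\<Omega>[of 1 s] s closure_subset by fastforce+
        have p1: "\<bar>u (x - s *\<^sub>R \<nu>) - u x - ?G \<bullet> (x - s *\<^sub>R \<nu> - x)\<bar> \<le> e/3 * norm (x - s *\<^sub>R \<nu> - x)"
        proof (rule move[OF _ cl inner(1)])
          fix z assume "z \<in> open_segment x (x - s *\<^sub>R \<nu>)"
          then obtain r where r: "0 < r" "r < 1" "z = (1 - r) *\<^sub>R x + r *\<^sub>R (x - s *\<^sub>R \<nu>)"
            by (auto simp: in_segment)
          then have zz: "z = x + 0 *\<^sub>R (y - x) - (r * s) *\<^sub>R \<nu>" by (simp add: algebra_simps)
          have "0 < r * s" "r * s \<le> s" using r s by (auto simp: mult_left_le_one_le)
          then show "z \<in> \<Omega> \<and> norm (z - x) \<le> 3/2 * l"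
            unfolding zz using in\<Omega>[of 0 "r * s"] pt[of 0 "r * s"] by auto
        qed
        have p2: "\<bar>u (y - s *\<^sub>R \<nu>) - u y - ?G \<bullet> (y - s *\<^sub>R \<nu> - y)\<bar> \<le> e/3 * norm (y - s *\<^sub>R \<nu> - y)"
        proof (rule move[OF _ _ inner(2)])
          fix z assume "z \<in> open_segment y (y - s *\<^sub>R \<nu>)"
          then obtain r where r: "0 < r" "r < 1" "z = (1 - r) *\<^sub>R y + r *\<^sub>R (y - s *\<^sub>R \<nu>)"
            by (auto simp: in_segment)
          then have zz: "z = x + 1 *\<^sub>R (y - x) - (r * s) *\<^sub>R \<nu>" by (simp add: algebra_simps)
          have "0 < r * s" "r * s \<le> s" using r s by (auto simp: mult_left_le_one_le)
          then show "z \<in> \<Omega> \<and> norm (z - x) \<le> 3/2 * l"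
            unfolding zz using in\<Omega>[of 1 "r * s"] pt[of 1 "r * s"] by auto
        qed (use y(1) in \<open>simp add: frontier_def\<close>)
        have p3: "\<bar>u (y - s *\<^sub>R \<nu>) - u (x - s *\<^sub>R \<nu>) - ?G \<bullet> (y - s *\<^sub>R \<nu> - (x - s *\<^sub>R \<nu>))\<bar>
            \<le> e/3 * norm (y - s *\<^sub>R \<nu> - (x - s *\<^sub>R \<nu>))"
        proof (rule move[OF _ inner])
          fix z assume "z \<in> open_segment (x - s *\<^sub>R \<nu>) (y - s *\<^sub>R \<nu>)"
          then obtain r where r: "0 < r" "r < 1" "z = (1 - r) *\<^sub>R (x - s *\<^sub>R \<nu>) + r *\<^sub>R (y - s *\<^sub>R \<nu>)"
            by (auto simp: in_segment)
          then have zz: "z = x + r *\<^sub>R (y - x) - s *\<^sub>R \<nu>" by (simp add: algebra_simps)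
          then show "z \<in> \<Omega> \<and> norm (z - x) \<le> 3/2 * l"
            unfolding zz using in\<Omega>[of r s] pt[of r s] r s by auto
        qed
        have n: "norm (x - s *\<^sub>R \<nu> - x) = s" "norm (y - s *\<^sub>R \<nu> - y) = s"
          "norm (y - s *\<^sub>R \<nu> - (x - s *\<^sub>R \<nu>)) = l"
          using s \<nu> by (simp_all add: l_def)
        have i: "?G \<bullet> (x - s *\<^sub>R \<nu> - x) = - (s * (?G \<bullet> \<nu>))" "?G \<bullet> (y - s *\<^sub>R \<nu> - y) = - (s * (?G \<bullet> \<nu>))"
          "?G \<bullet> (y - s *\<^sub>R \<nu> - (x - s *\<^sub>R \<nu>)) = ?G \<bullet> (y - x)"
          by (simp_all add: algebra_simps)
        have "\<bar>u y - u x - ?G \<bullet> (y - x)\<bar> \<le> e/3 * s + e/3 * s + e/3 * l"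
          using p1 p2 p3 unfolding n i by linarith
        also have "\<dots> = 2/3 * (e * l)" by (simp add: s_def)
        also have "\<dots> \<le> e * l" using e l by simp
        finally show ?thesis by (simp add: l_def)
      qed
    qed
    then show "\<exists>d>0. \<forall>y\<in>frontier \<Omega>. norm (y - x) < d \<longrightarrow> norm (u y - u x - ?G \<bullet> (y - x)) \<le> e * norm (y - x)"
      using \<delta> by (intro exI[of _ "\<delta>/2"]) auto
  qed
qed

lemma boundary_portion_2D:
  assumes "boundary_portion 2 \<Omega> \<Gamma>" "x \<in> \<Gamma>"
  obtains U g where "x \<in> U" "local_defining_fun 1 \<Omega> U g"
  using assms local_defining_fun_2_1 unfolding boundary_portion_def by blast

lemma boundary_portion_frontier: "boundary_portion k \<Omega> \<Gamma> \<Longrightarrow> \<Gamma> \<subseteq> frontier \<Omega>"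
  unfolding boundary_portion_def by (meson openin_imp_subset)

lemma norm_outward_normal:
  assumes "local_defining_fun 1 \<Omega> U g" "x \<in> U" "x \<in> frontier \<Omega>"
  shows "norm (outward_normal \<Omega> x) = 1"
  using outward_normal_eq[OF assms] local_defining_funD(3)[OF assms(1,2)] by (simp add: norm_sgn)

text \<open>
  The function \<open>g\<close> changes sign on the segment through \<open>x + t w\<close> in the direction of the normal, of
  half-length \<open>t |w|\<close>. Hence the hypersurface has secants at \<open>x\<close> close to any tangent direction \<open>w\<close>.
\<close>

lemma tangent_secant_point:
  fixes x w :: "real^'n"
  assumes g: "local_defining_fun 1 \<Omega> U g" "x \<in> U" and x: "x \<in> frontier \<Omega>"
    and w: "w \<bullet> outward_normal \<Omega> x = 0" "w \<noteq> 0" and \<eta>: "\<eta> > 0"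
  obtains y t s where "y \<in> frontier \<Omega>" "norm (y - x) < \<eta>" "t > 0" "\<bar>s\<bar> \<le> t * norm w"
    "y - x = t *\<^sub>R w + s *\<^sub>R outward_normal \<Omega> x"
proof -
  let ?a = "grad U g x"
  note L = local_defining_funD[OF g(1)]
  define A where "A = norm ?a"
  have A: "A > 0" using L(3)[OF g(2)] by (simp add: A_def)
  define \<nu> where "\<nu> = outward_normal \<Omega> x"
  have \<nu>_sgn: "\<nu> = sgn ?a" unfolding \<nu>_def by (rule outward_normal_eq[OF g x])
  have \<nu>: "norm \<nu> = 1" unfolding \<nu>_def by (rule norm_outward_normal[OF g x])
  have a: "?a = A *\<^sub>R \<nu>" using A by (simp add: \<nu>_sgn A_def sgn_div_norm)
  obtain \<delta> where \<delta>: "\<delta> > 0" "ball x \<delta> \<subseteq> U"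
    "\<And>z w. z \<in> ball x \<delta> \<Longrightarrow> w \<in> ball x \<delta> \<Longrightarrow> \<bar>g z - g w - ?a \<bullet> (z - w)\<bar> \<le> (A/8) * norm (z - w)"
    using strict_differentiability[OF L(1) g(2) L(2), of "A/8"] A by (metis divide_pos_pos zero_less_numeral)
  define n where "n = norm w"
  have n: "n > 0" using w by (simp add: n_def)
  define t where "t = min \<delta> \<eta> / (4 * n)"
  have t: "t > 0" using \<delta> \<eta> n by (simp add: t_def)
  have tn: "t * n = min \<delta> \<eta> / 4" using n by (simp add: t_def)
  define z where "z s = x + t *\<^sub>R w + s *\<^sub>R \<nu>" for s
  have z_norm: "norm (z s - x) \<le> 2 * (t * n)" if "\<bar>s\<bar> \<le> t * n" for s
  proof -
    have "norm (z s - x) \<le> norm (t *\<^sub>R w) + norm (s *\<^sub>R \<nu>)"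
      unfolding z_def by (metis add.assoc add_diff_cancel_left' norm_triangle_ineq)
    then show ?thesis using that t \<nu> by (simp add: n_def)
  qed
  have z_ball: "z s \<in> ball x \<delta>" "norm (z s - x) < \<eta>" if "\<bar>s\<bar> \<le> t * n" for s
    using z_norm[OF that] tn \<delta>(1) \<eta> by (auto simp: dist_norm norm_minus_commute)
  have gx: "g x = 0" using L(5) g x by blast
  have xb: "x \<in> ball x \<delta>" using \<delta> by simp
  have g_est: "\<bar>g (z s) - s * A\<bar> \<le> (A * (t * n)) / 4" if s: "\<bar>s\<bar> \<le> t * n" for s
  proof -
    have "?a \<bullet> (z s - x) = s * A"
      using w(1) \<nu> by (simp add: a z_def \<nu>_def[symmetric] inner_add_right inner_commute norm_eq_1)
    then have "\<bar>g (z s) - s * A\<bar> \<le> (A/8) * norm (z s - x)"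
      using \<delta>(3)[OF z_ball(1)[OF s] xb] by (simp add: gx)
    also have "\<dots> \<le> (A/8) * (2 * (t * n))" using z_norm[OF s] A by (intro mult_left_mono) auto
    finally show ?thesis by (simp add: mult_ac)
  qed
  have tn0: "t * n > 0" using t n by simp
  have Atn: "A * (t * n) > 0" using A tn0 by simp
  have "\<exists>s\<ge>- (t * n). s \<le> t * n \<and> g (z s) = 0"
  proof (rule IVT')
    have "\<bar>g (z (- (t * n))) - - (t * n) * A\<bar> \<le> (A * (t * n)) / 4" "\<bar>g (z (t * n)) - (t * n) * A\<bar> \<le> (A * (t * n)) / 4"
      by (rule g_est; use tn0 in simp)+
    moreover have "- (t * n) * A = - (A * (t * n))" "(t * n) * A = A * (t * n)" by simp_all
    ultimately show "g (z (- (t * n))) \<le> 0" "0 \<le> g (z (t * n))" using Atn by linarith+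
    show "- (t * n) \<le> t * n" using tn0 by simp
    show "continuous_on {- (t * n)..t * n} (\<lambda>s. g (z s))"
    proof (rule continuous_on_compose2[where g=g and f=z and t=U])
      show "continuous_on U g"
        using Ck_closure_continuous[OF L(2)] closure_subset by (rule continuous_on_subset)
      show "continuous_on {- (t * n)..t * n} z" unfolding z_def by (intro continuous_intros)
      show "z ` {- (t * n)..t * n} \<subseteq> U"
      proof clarify
        fix s assume "s \<in> {- (t * n)..t * n}"
        then show "z s \<in> U" using z_ball(1)[of s] \<delta>(2) by (auto simp: abs_le_iff)
      qed
    qed
  qed
  then obtain s where "- (t * n) \<le> s" "s \<le> t * n" and gz: "g (z s) = 0" by blast
  then have "\<bar>s\<bar> \<le> t * n" by (simp add: abs_le_iff)
  note s = this gz
  show thesis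
  proof (rule that[of "z s" t s])
    show "z s \<in> frontier \<Omega>" using L(5) z_ball(1)[OF s(1)] \<delta>(2) s(2) by blast
    show "norm (z s - x) < \<eta>" by (rule z_ball(2)[OF s(1)])
    show "\<bar>s\<bar> \<le> t * norm w" using s by (simp add: n_def)
    show "z s - x = t *\<^sub>R w + s *\<^sub>R outward_normal \<Omega> x" by (simp add: z_def \<nu>_def)
  qed (rule t)
qed

text \<open>
  The normal part may be removed from the derivative of \<open>u\<close> because \<open>g\<close>, which vanishes on \<open>\<Gamma>\<close>, has
  derivative zero along \<open>\<Gamma>\<close>. A tangential derivative is unique since secants of \<open>\<Gamma>\<close> come close to
  every tangent direction.
\<close>

lemma surface_grad_eq:
  fixes u p :: "real^'n \<Rightarrow> real"
  assumes \<Omega>: "open \<Omega>" and \<Gamma>: "boundary_portion 2 \<Omega> \<Gamma>" and u: "Ck_closure 1 \<Omega> u"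
    and p: "\<And>y. y \<in> \<Gamma> \<Longrightarrow> p y = u y" and x: "x \<in> \<Gamma>"
  defines "\<nu> \<equiv> outward_normal \<Omega> x"
  shows "surface_grad \<Omega> \<Gamma> p x = grad \<Omega> u x - (grad \<Omega> u x \<bullet> \<nu>) *\<^sub>R \<nu>"
proof -
  let ?G = "grad \<Omega> u x"
  obtain U g where g: "local_defining_fun 1 \<Omega> U g" "x \<in> U"
    using boundary_portion_2D[OF \<Gamma> x] by blast
  note L = local_defining_funD[OF g(1)]
  have \<Gamma>f: "\<Gamma> \<subseteq> frontier \<Omega>" by (rule boundary_portion_frontier[OF \<Gamma>])
  then have xf: "x \<in> frontier \<Omega>" using x by blast
  have \<nu>: "norm \<nu> = 1" unfolding \<nu>_def by (rule norm_outward_normal[OF g xf])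
  have \<nu>\<nu>: "\<nu> \<bullet> \<nu> = 1" using \<nu> by (simp add: norm_eq_1)
  have a: "grad U g x = norm (grad U g x) *\<^sub>R \<nu>"
    unfolding \<nu>_def outward_normal_eq[OF g xf] using L(3)[OF g(2)] by (simp add: sgn_div_norm)
  have du: "(u has_derivative (\<lambda>h. ?G \<bullet> h)) (at x within \<Gamma>)"
    using has_derivative_within_frontier[OF u \<Omega> g xf] \<Gamma>f by (rule has_derivative_subset)
  have "(g has_derivative (\<lambda>h. grad U g x \<bullet> h)) (at x)"
    using L(2) g(2) by (intro has_derivative_grad) (auto simp: Ck_closure_1_iff simp del: One_nat_def)
  then have dg: "(g has_derivative (\<lambda>h. grad U g x \<bullet> h)) (at x within \<Gamma>)"
    by (rule has_derivative_at_withinI)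
  obtain r where r: "r > 0" "ball x r \<subseteq> U" using L(1) g(2) open_contains_ball by metis
  have "((\<lambda>_. 0) has_derivative (\<lambda>h. grad U g x \<bullet> h)) (at x within \<Gamma>)"
  proof (rule has_derivative_transform_within[OF dg r(1) x])
    fix y assume "y \<in> \<Gamma>" "dist y x < r"
    then have "y \<in> U" "y \<in> frontier \<Omega>" using r(2) \<Gamma>f by (auto simp: dist_commute)
    then show "g y = 0" using L(5) by blast
  qed
  then have "((\<lambda>_. (?G \<bullet> \<nu>) / norm (grad U g x) * 0) has_derivative
      (\<lambda>h. (?G \<bullet> \<nu>) / norm (grad U g x) * (grad U g x \<bullet> h))) (at x within \<Gamma>)"
    by (rule has_derivative_mult_right)
  moreover have "(?G \<bullet> \<nu>) / norm (grad U g x) * (grad U g x \<bullet> h) = (?G \<bullet> \<nu>) * (\<nu> \<bullet> h)" for h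
    using L(3)[OF g(2)] by (subst a) simp
  ultimately have d0: "((\<lambda>_. 0) has_derivative (\<lambda>h. (?G \<bullet> \<nu>) * (\<nu> \<bullet> h))) (at x within \<Gamma>)"
    by simp
  have du': "(u has_derivative (\<lambda>h. (?G - (?G \<bullet> \<nu>) *\<^sub>R \<nu>) \<bullet> h)) (at x within \<Gamma>)"
    using has_derivative_diff[OF du d0] by (simp add: inner_diff_left)
  have dp: "(p has_derivative (\<lambda>h. (?G - (?G \<bullet> \<nu>) *\<^sub>R \<nu>) \<bullet> h)) (at x within \<Gamma>)"
    by (rule has_derivative_transform[OF x p du'])
  show ?thesis
    unfolding surface_grad_def \<nu>_def[symmetric]
  proof (rule the_equality)
    show "(?G - (?G \<bullet> \<nu>) *\<^sub>R \<nu>) \<bullet> \<nu> = 0 \<and>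
        (p has_derivative (\<lambda>h. (?G - (?G \<bullet> \<nu>) *\<^sub>R \<nu>) \<bullet> h)) (at x within \<Gamma>)"
      using dp by (simp add: inner_diff_left \<nu>\<nu>)
    fix q assume q: "q \<bullet> \<nu> = 0 \<and> (p has_derivative (\<lambda>h. q \<bullet> h)) (at x within \<Gamma>)"
    define w where "w = q - (?G - (?G \<bullet> \<nu>) *\<^sub>R \<nu>)"
    have w\<nu>: "w \<bullet> \<nu> = 0" using q by (simp add: w_def inner_diff_left \<nu>\<nu>)
    have dw: "((\<lambda>_. 0) has_derivative (\<lambda>h. w \<bullet> h)) (at x within \<Gamma>)"
      using has_derivative_diff[OF conjunct2[OF q] dp] by (simp add: w_def inner_diff_left)
    have "w = 0"
    proof (rule ccontr)
      assume w0: "w \<noteq> 0"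
      then have nw: "norm w > 0" by simp
      then obtain d where d: "d > 0" "\<And>y. y \<in> \<Gamma> \<Longrightarrow> norm (y - x) < d \<Longrightarrow> \<bar>w \<bullet> (y - x)\<bar> \<le> (norm w / 4) * norm (y - x)"
        using dw[unfolded has_derivative_within_alt] by (auto dest: spec[of _ "norm w / 4"])
      obtain T where T: "open T" "\<Gamma> = frontier \<Omega> \<inter> T"
        using \<Gamma> unfolding boundary_portion_def openin_open by blast
      then obtain r where r: "r > 0" "ball x r \<subseteq> T" using x open_contains_ball by (metis IntD2)
      obtain y t s where y: "y \<in> frontier \<Omega>" "norm (y - x) < min d r" "t > 0" "\<bar>s\<bar> \<le> t * norm w"
        "y - x = t *\<^sub>R w + s *\<^sub>R \<nu>"
        using tangent_secant_point[OF g xf w\<nu>[unfolded \<nu>_def] w0, of "min d r"] d r unfolding \<nu>_def by auto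
      have "y \<in> \<Gamma>" using T(2) y(1,2) r(2) by (auto simp: dist_norm norm_minus_commute)
      moreover have "norm (y - x) < d" using y(2) by simp
      ultimately have "\<bar>w \<bullet> (y - x)\<bar> \<le> (norm w / 4) * norm (y - x)" by (rule d(2))
      moreover have "w \<bullet> (y - x) = t * (norm w)\<^sup>2"
        by (simp add: y(5) inner_add_right w\<nu> power2_norm_eq_inner)
      moreover have "norm (y - x) \<le> 2 * (t * norm w)"
        unfolding y(5) using norm_triangle_ineq[of "t *\<^sub>R w" "s *\<^sub>R \<nu>"] y(3,4) \<nu> by simp
      ultimately have "t * (norm w)\<^sup>2 \<le> (norm w / 4) * (2 * (t * norm w))"
        using nw by (smt (verit) mult_left_mono divide_nonneg_nonneg norm_ge_zero)
      then have "t * (norm w)\<^sup>2 \<le> (t * (norm w)\<^sup>2) / 2" by (simp add: power2_eq_square field_simps)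
      moreover have "t * (norm w)\<^sup>2 > 0" using y(3) nw by simp
      ultimately show False by linarith
    qed
    then show "q = ?G - (?G \<bullet> \<nu>) *\<^sub>R \<nu>" by (simp add: w_def)
  qed
qed

text \<open>
  The tangential part of \<open>\<nabla>u\<close> depends on the Dirichlet datum alone, so the Cauchy data determine the
  full gradient on \<open>\<Gamma>\<close>.
\<close>

lemma norm_grad_boundary:
  fixes u p :: "real^'n \<Rightarrow> real"
  assumes \<Omega>: "open \<Omega>" and \<Gamma>: "boundary_portion 2 \<Omega> \<Gamma>" and u: "Ck_closure 1 \<Omega> u"
    and p: "\<And>y. y \<in> \<Gamma> \<Longrightarrow> p y = u y" and x: "x \<in> \<Gamma>"
  shows "(norm (grad \<Omega> u x))\<^sup>2 = (norm (surface_grad \<Omega> \<Gamma> p x))\<^sup>2 + (normal_deriv \<Omega> u x)\<^sup>2"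
proof -
  obtain U g where g: "local_defining_fun 1 \<Omega> U g" "x \<in> U"
    using boundary_portion_2D[OF \<Gamma> x] by blast
  have xf: "x \<in> frontier \<Omega>" using boundary_portion_frontier[OF \<Gamma>] x by blast
  have "norm (outward_normal \<Omega> x) = 1" by (rule norm_outward_normal[OF g xf])
  then have "outward_normal \<Omega> x \<bullet> outward_normal \<Omega> x = 1" by (simp add: norm_eq_1)
  moreover have "surface_grad \<Omega> \<Gamma> p x
      = grad \<Omega> u x - (grad \<Omega> u x \<bullet> outward_normal \<Omega> x) *\<^sub>R outward_normal \<Omega> x"
    using \<Omega> \<Gamma> u p x by (rule surface_grad_eq)
  ultimately show ?thesis
    unfolding normal_deriv_def power2_norm_eq_inner
    by (simp add: inner_diff_left inner_diff_right inner_commute power2_eq_square)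
qed

lemma continuous_on_outward_normal:
  fixes \<Gamma> :: "(real^'n) set"
  assumes \<Gamma>: "boundary_portion 2 \<Omega> \<Gamma>"
  shows "continuous_on \<Gamma> (outward_normal \<Omega>)"
  unfolding continuous_on_eq_continuous_within
proof
  fix x assume x: "x \<in> \<Gamma>"
  have \<Gamma>f: "\<Gamma> \<subseteq> frontier \<Omega>" by (rule boundary_portion_frontier[OF \<Gamma>])
  obtain U g where g: "local_defining_fun 1 \<Omega> U g" "x \<in> U"
    using boundary_portion_2D[OF \<Gamma> x] by blast
  note L = local_defining_funD[OF g(1)]
  have "continuous_on U (grad U g)"
    using continuous_on_grad[OF L(2)] closure_subset by (rule continuous_on_subset)
  then have "isCont (grad U g) x" using L(1) g(2) by (simp add: continuous_on_eq_continuous_at)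
  then have "isCont (\<lambda>y. sgn (grad U g y)) x"
    using L(3)[OF g(2)] unfolding sgn_div_norm by (intro continuous_intros) auto
  then have c: "continuous (at x within \<Gamma>) (\<lambda>y. sgn (grad U g y))"
    by (rule continuous_at_imp_continuous_at_within)
  obtain r where r: "r > 0" "ball x r \<subseteq> U" using L(1) g(2) open_contains_ball by metis
  show "continuous (at x within \<Gamma>) (outward_normal \<Omega>)"
  proof (rule continuous_transform_within[OF c r(1) x])
    fix y assume "y \<in> \<Gamma>" "dist y x < r"
    then have "y \<in> U" "y \<in> frontier \<Omega>" using r(2) \<Gamma>f by (auto simp: dist_commute)
    then show "sgn (grad U g y) = outward_normal \<Omega> y" using outward_normal_eq[OF g(1)] by simp
  qed
qed

section \<open>Multi-indices of low order\<close>

lemma finite_multiindex: "finite {\<alpha> :: 'n::finite multiindex. mi_order \<alpha> \<le> k}"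
proof (rule finite_subset)
  show "{\<alpha> :: 'n multiindex. mi_order \<alpha> \<le> k} \<subseteq> (\<Pi>\<^sub>E i\<in>UNIV. {..k})"
  proof
    fix \<alpha> :: "'n multiindex" assume "\<alpha> \<in> {\<alpha>. mi_order \<alpha> \<le> k}"
    moreover have "\<alpha> i \<le> mi_order \<alpha>" for i
      unfolding mi_order_def by (rule member_le_sum) auto
    ultimately show "\<alpha> \<in> (\<Pi>\<^sub>E i\<in>UNIV. {..k})"
      by (auto simp: PiE_def Pi_def extensional_def intro: order_trans)
  qed
  show "finite (\<Pi>\<^sub>E i\<in>(UNIV :: 'n set). {..k})" by (rule finite_PiE) auto
qed

lemma finite_multiindex_eq: "finite {\<alpha> :: 'n::finite multiindex. mi_order \<alpha> = k}"
  by (rule finite_subset[OF _ finite_multiindex[of k]]) auto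

lemma ex_list_count: "\<exists>is. \<forall>i. count_list is i = (\<alpha> :: 'n::finite multiindex) i"
proof (induction "mi_order \<alpha>" arbitrary: \<alpha>)
  case 0
  then show ?case by (intro exI[of _ "[]"]) (auto simp: mi_order_def)
next
  case (Suc k)
  then obtain i where i: "\<alpha> i > 0" unfolding mi_order_def by (metis nat.distinct(1) sum.neutral not_gr_zero)
  define \<beta> where "\<beta> = \<alpha>(i := \<alpha> i - 1)"
  have eq: "\<alpha> j = \<beta> j + (if j = i then 1 else 0)" for j using i by (auto simp: \<beta>_def)
  have "mi_order \<alpha> = mi_order \<beta> + 1"
  proof -
    have "(\<Sum>j\<in>UNIV. \<alpha> j) = (\<Sum>j\<in>UNIV. \<beta> j + (if j = i then 1 else 0))"
      by (rule sum.cong) (rule refl, rule eq)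
    then show ?thesis by (simp add: mi_order_def sum.distrib)
  qed
  then have "k = mi_order \<beta>" using Suc(2) by simp
  then obtain is' where "\<forall>j. count_list is' j = \<beta> j" using Suc(1)[of \<beta>] by blast
  then show ?case using eq by (intro exI[of _ "i # is'"]) auto
qed

lemma length_eq_mi_order:
  assumes "\<forall>i. count_list is i = (\<alpha> :: 'n::finite multiindex) i"
  shows "length is = mi_order \<alpha>"
  using sum_count_set[of "is" UNIV] assms by (simp add: mi_order_def)

text \<open>The list depends on \<open>\<alpha>\<close> only, so it serves all sets and functions at the same time.\<close>

lemma multi_deriv_list:
  fixes \<alpha> :: "'n::finite multiindex"
  obtains "is" where "\<forall>i. count_list is i = \<alpha> i" "length is = mi_order \<alpha>"
    "\<And>S f. multi_deriv S \<alpha> f = part_derivs S is f"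
proof -
  define is0 where "is0 = (SOME is. \<forall>i. count_list is i = \<alpha> i)"
  have "\<forall>i. count_list is0 i = \<alpha> i"
    unfolding is0_def by (rule someI_ex[OF ex_list_count])
  then show thesis
    using that[of is0] length_eq_mi_order[of is0 \<alpha>] unfolding multi_deriv_def is0_def by blast
qed

lemma multi_deriv_0: "mi_order \<alpha> = 0 \<Longrightarrow> multi_deriv S \<alpha> f = f"
  by (rule multi_deriv_list[of \<alpha>]) auto

lemma multi_deriv_1:
  assumes "mi_order (\<alpha> :: 'n::finite multiindex) = 1"
  obtains i where "\<And>S f. multi_deriv S \<alpha> f = part_deriv S i f"
proof (rule multi_deriv_list[of \<alpha>])
  fix "is" assume *: "length is = mi_order \<alpha>" "\<And>S f. multi_deriv S \<alpha> f = part_derivs S is f"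
  then obtain i where "is = [i]" using assms by (auto simp: length_Suc_conv)
  then show thesis using * by (intro that[of i]) auto
qed

lemma multi_deriv_2:
  assumes "mi_order (\<alpha> :: 'n::finite multiindex) = 2"
  obtains i j where "\<And>S f. multi_deriv S \<alpha> f = part_deriv S i (part_deriv S j f)"
proof (rule multi_deriv_list[of \<alpha>])
  fix "is" assume *: "length is = mi_order \<alpha>" "\<And>S f. multi_deriv S \<alpha> f = part_derivs S is f"
  then obtain i j where "is = [i, j]" using assms by (auto simp: length_Suc_conv numeral_2_eq_2)
  then show thesis using * by (intro that[of i j]) auto
qed

lemma part_deriv_eq_multi_deriv:
  fixes i :: "'n::finite"
  obtains \<alpha> where "mi_order \<alpha> = 1" "\<And>S f. multi_deriv S \<alpha> f = part_deriv S i f"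
proof -
  define \<alpha> :: "'n multiindex" where "\<alpha> j = (if j = i then 1 else 0)" for j
  have o: "mi_order \<alpha> = 1" by (simp add: mi_order_def \<alpha>_def)
  show thesis
  proof (rule multi_deriv_list[of \<alpha>])
    fix "is" assume *: "\<forall>j. count_list is j = \<alpha> j" "length is = mi_order \<alpha>"
      "\<And>S f. multi_deriv S \<alpha> f = part_derivs S is f"
    then obtain j where j: "is = [j]" using o by (auto simp: length_Suc_conv)
    have "count_list is i = 1" using *(1) by (simp add: \<alpha>_def)
    then have "j = i" using j by (auto split: if_splits)
    then show thesis using * j by (intro that[OF o]) auto
  qed
qed

lemma Ck_norm_1_term_bounds:
  fixes f :: "real^'n \<Rightarrow> real"
  assumes S: "bounded S" "S \<noteq> {}" and f: "Ck_closure 1 S f" and \<alpha>: "mi_order \<alpha> \<le> 1"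
  shows "x \<in> closure S \<Longrightarrow> \<bar>multi_deriv S \<alpha> f x\<bar> \<le> (SUP x\<in>closure S. \<bar>multi_deriv S \<alpha> f x\<bar>)"
    "0 \<le> (SUP x\<in>closure S. \<bar>multi_deriv S \<alpha> f x\<bar>)"
proof -
  have "continuous_on (closure S) (multi_deriv S \<alpha> f)"
  proof (cases "mi_order \<alpha> = 0")
    case True
    then show ?thesis using Ck_closure_continuous[OF f] by (simp add: multi_deriv_0)
  next
    case False
    then have "mi_order \<alpha> = 1" using \<alpha> by simp
    then obtain i where "\<And>S f. multi_deriv S \<alpha> f = part_deriv S i f" using multi_deriv_1 by blast
    then show ?thesis using f by (simp add: Ck_closure_1_iff del: One_nat_def)
  qed
  then have "bounded (multi_deriv S \<alpha> f ` closure S)"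
    using S by (intro compact_imp_bounded compact_continuous_image) auto
  then have bdd: "bdd_above ((\<lambda>x. \<bar>multi_deriv S \<alpha> f x\<bar>) ` closure S)"
    by (auto simp: bounded_iff bdd_above_def)
  show le: "\<bar>multi_deriv S \<alpha> f x\<bar> \<le> (SUP x\<in>closure S. \<bar>multi_deriv S \<alpha> f x\<bar>)" if "x \<in> closure S" for x
    using bdd that by (rule cSUP_upper2) auto
  obtain x0 where "x0 \<in> closure S" using S closure_subset by blast
  from le[OF this] show "0 \<le> (SUP x\<in>closure S. \<bar>multi_deriv S \<alpha> f x\<bar>)" by linarith
qed

lemma Ck_norm_1_bounds:
  fixes f :: "real^'n \<Rightarrow> real"
  assumes S: "bounded S" "S \<noteq> {}" and f: "Ck_closure 1 S f" and x: "x \<in> closure S"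
  shows "\<bar>f x\<bar> \<le> Ck_norm 1 S f" "\<bar>part_deriv S i f x\<bar> \<le> Ck_norm 1 S f"
proof -
  have le: "\<bar>multi_deriv S \<alpha> f x\<bar> \<le> Ck_norm 1 S f" if \<alpha>: "mi_order \<alpha> \<le> 1" for \<alpha>
  proof -
    have "\<bar>multi_deriv S \<alpha> f x\<bar> \<le> (SUP x\<in>closure S. \<bar>multi_deriv S \<alpha> f x\<bar>)"
      by (rule Ck_norm_1_term_bounds(1)[OF S f \<alpha> x])
    also have "\<dots> \<le> Ck_norm 1 S f"
      unfolding Ck_norm_def using \<alpha> Ck_norm_1_term_bounds(2)[OF S f]
      by (intro member_le_sum) (auto simp: finite_multiindex simp del: One_nat_def)
    finally show ?thesis .
  qed
  have o0: "mi_order (\<lambda>_::'n. 0) = 0" by (simp add: mi_order_def)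
  show "\<bar>f x\<bar> \<le> Ck_norm 1 S f" using le[of "\<lambda>_. 0"] o0 by (simp add: multi_deriv_0 del: One_nat_def)
  obtain \<alpha> where "mi_order \<alpha> = 1" "\<And>S f. multi_deriv S \<alpha> f = part_deriv S i f"
    using part_deriv_eq_multi_deriv[of i] by blast
  then show "\<bar>part_deriv S i f x\<bar> \<le> Ck_norm 1 S f" using le[of \<alpha>] by simp
qed

lemma Ck_norm_vec_component:
  assumes "Ck_norm_vec N k S V \<le> K" "j < N"
  shows "Ck_norm k S (V j) \<le> K"
proof -
  have "(Ck_norm k S (V j))\<^sup>2 \<le> (\<Sum>j<N. (Ck_norm k S (V j))\<^sup>2)"
    using assms(2) by (intro member_le_sum) auto
  then have "Ck_norm k S (V j) \<le> sqrt (\<Sum>j<N. (Ck_norm k S (V j))\<^sup>2)"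
    by (rule real_le_rsqrt)
  then show ?thesis using assms(1) by (simp add: Ck_norm_vec_def)
qed

lemma norm_grad_le:
  assumes "\<And>i. \<bar>part_deriv S i f x\<bar> \<le> K"
  shows "norm (grad S f x :: real^'n) \<le> real CARD('n) * K"
proof -
  have "norm (grad S f x) \<le> (\<Sum>i\<in>UNIV. \<bar>grad S f x $ i\<bar>)" by (rule norm_le_l1_cart)
  also have "\<dots> \<le> (\<Sum>i\<in>(UNIV :: 'n set). K)" using assms by (intro sum_mono) (simp add: grad_def)
  finally show ?thesis by simp
qed

lemma second_part_deriv_diff:
  assumes S: "open S" and u: "Ck_closure 2 S u" and v: "Ck_closure 2 S v" and x: "x \<in> S"
  shows "part_deriv S i (part_deriv S j (\<lambda>y. u y - v y)) x
    = part_deriv S i (part_deriv S j u) x - part_deriv S i (part_deriv S j v) x"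
proof -
  have "part_deriv S i (part_deriv S j (\<lambda>y. u y - v y)) x
      = part_deriv S i (\<lambda>y. part_deriv S j u y - part_deriv S j v y) x"
    using closure_subset
    by (intro part_deriv_cong[OF S] part_deriv_diff[OF S Ck_closure_2D(1)[OF u] Ck_closure_2D(1)[OF v]]) blast
  also have "\<dots> = part_deriv S i (part_deriv S j u) x - part_deriv S i (part_deriv S j v) x"
    using x closure_subset by (intro part_deriv_diff[OF S Ck_closure_2D(2)[OF u] Ck_closure_2D(2)[OF v]]) blast
  finally show ?thesis .
qed

lemma second_part_deriv_subset:
  assumes D: "open D" "D \<subseteq> S" and S: "open S" and u: "Ck_closure 2 S u" and x: "x \<in> D"
  shows "part_deriv D i (part_deriv D j u) x = part_deriv S i (part_deriv S j u) x"
proof -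
  have "part_deriv D i (part_deriv D j u) x = part_deriv D i (part_deriv S j u) x"
    using closure_subset by (intro part_deriv_cong[OF D(1)] part_deriv_subset[OF D Ck_closure_2D(1)[OF u] S]) blast
  also have "\<dots> = part_deriv S i (part_deriv S j u) x"
    using x closure_subset by (intro part_deriv_subset[OF D Ck_closure_2D(2)[OF u] S]) blast
  finally show ?thesis .
qed

lemma principal_part_diff:
  assumes S: "open S" and u: "Ck_closure 2 S u" and v: "Ck_closure 2 S v" and x: "x \<in> S"
  shows "principal_part a S (\<lambda>y. u y - v y) x = principal_part a S u x - principal_part a S v x"
proof -
  have "multi_deriv S \<alpha> (\<lambda>y. u y - v y) x = multi_deriv S \<alpha> u x - multi_deriv S \<alpha> v x"
    if \<alpha>: "mi_order \<alpha> = 2" for \<alpha>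
  proof (rule multi_deriv_2[OF \<alpha>])
    fix i j assume *: "\<And>S f. multi_deriv S \<alpha> f = part_deriv S i (part_deriv S j f)"
    show ?thesis unfolding * by (rule second_part_deriv_diff[OF S u v x])
  qed
  then show ?thesis
    unfolding principal_part_def sum_subtractf[symmetric]
    by (intro sum.cong) (auto simp: right_diff_distrib)
qed

lemma principal_part_subset:
  assumes D: "open D" "D \<subseteq> S" and S: "open S" and u: "Ck_closure 2 S u" and x: "x \<in> D"
  shows "principal_part a D u x = principal_part a S u x"
proof -
  have "multi_deriv D \<alpha> u x = multi_deriv S \<alpha> u x" if \<alpha>: "mi_order \<alpha> = 2" for \<alpha>
  proof (rule multi_deriv_2[OF \<alpha>])
    fix i j assume *: "\<And>S f. multi_deriv S \<alpha> f = part_deriv S i (part_deriv S j f)"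
    show ?thesis unfolding * by (rule second_part_deriv_subset[OF D S u x])
  qed
  then show ?thesis unfolding principal_part_def by (intro sum.cong) auto
qed

lemma principal_part_coeff_cong:
  assumes "\<And>\<alpha>. mi_order \<alpha> = 2 \<Longrightarrow> a \<alpha> = b \<alpha>"
  shows "principal_part a S u x = principal_part b S u x"
  unfolding principal_part_def using assms by (intro sum.cong) auto

section \<open>Sobolev and surface norms\<close>

lemma esqrt_mono: "s \<le> t \<Longrightarrow> esqrt s \<le> esqrt t"
  by (auto simp: esqrt_def top_unique intro!: ennreal_leI enn2real_mono)
     (auto simp: top.not_eq_extremum)

lemma esqrt_ennreal_square: "b \<ge> 0 \<Longrightarrow> esqrt (ennreal (b\<^sup>2)) = ennreal b"
  by (simp add: esqrt_def)

lemma le_square_of_esqrt_le: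
  assumes "esqrt t \<le> ennreal \<sigma>" "\<sigma> \<ge> 0"
  shows "t \<le> ennreal (\<sigma>\<^sup>2)"
proof (cases t)
  case (real r)
  then have "sqrt r \<le> \<sigma>" using assms by (simp add: esqrt_def)
  then have "r \<le> \<sigma>\<^sup>2" using real by (metis real_sqrt_le_iff real_sqrt_abs abs_of_nonneg assms(2))
  then show ?thesis using real by (simp add: ennreal_leI)
next
  case top
  then show ?thesis using assms(1) by (simp add: esqrt_def top_unique)
qed

lemma multi_deriv_square_le:
  fixes f :: "real^'n \<Rightarrow> real"
  assumes \<alpha>: "mi_order \<alpha> \<le> 1"
  shows "(multi_deriv S \<alpha> f x)\<^sup>2 \<le> (norm (grad S f x))\<^sup>2 + (f x)\<^sup>2"
proof (cases "mi_order \<alpha> = 0")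
  case True
  then show ?thesis by (simp add: multi_deriv_0)
next
  case False
  then have "mi_order \<alpha> = 1" using \<alpha> by simp
  then obtain i where *: "\<And>S f. multi_deriv S \<alpha> f = part_deriv S i f" using multi_deriv_1 by blast
  have "\<bar>part_deriv S i f x\<bar> \<le> norm (grad S f x)"
    using component_le_norm_cart[of "grad S f x" i] by (simp add: grad_def)
  then have "(part_deriv S i f x)\<^sup>2 \<le> (norm (grad S f x))\<^sup>2"
    by (metis abs_ge_zero power2_abs power_mono)
  then show ?thesis unfolding * using zero_le_power2[of "f x"] by linarith
qed


lemma Hk_norm_vec_1_le:
  fixes V :: "nat \<Rightarrow> real^'n \<Rightarrow> real"
  assumes b: "b \<ge> 0" and S: "S \<in> sets borel"
    and meas: "\<And>j. j < N \<Longrightarrow> (\<lambda>x. ennreal ((norm (grad S (V j) x))\<^sup>2 + (V j x)\<^sup>2) * indicator S x) \<in> borel_measurable borel"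
    and le: "(\<Sum>j<N. \<integral>\<^sup>+x\<in>S. ennreal ((norm (grad S (V j) x))\<^sup>2 + (V j x)\<^sup>2) \<partial>lborel) \<le> ennreal (b\<^sup>2)"
  shows "Hk_norm_vec N 1 S V
    \<le> ennreal (sqrt (card {\<alpha> :: 'n multiindex. mi_order \<alpha> \<le> 1}) * b)"
proof -
  let ?A = "{\<alpha> :: 'n multiindex. mi_order \<alpha> \<le> 1}"
  have "(\<Sum>j<N. \<Sum>\<alpha>\<in>?A. \<integral>\<^sup>+x\<in>S. ennreal ((multi_deriv S \<alpha> (V j) x)\<^sup>2) \<partial>lborel)
      \<le> (\<Sum>j<N. \<Sum>\<alpha>\<in>?A. \<integral>\<^sup>+x\<in>S. ennreal ((norm (grad S (V j) x))\<^sup>2 + (V j x)\<^sup>2) \<partial>lborel)"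
    by (intro sum_mono nn_integral_mono mult_right_mono ennreal_leI multi_deriv_square_le) auto
  also have "\<dots> = of_nat (card ?A) * (\<Sum>j<N. \<integral>\<^sup>+x\<in>S. ennreal ((norm (grad S (V j) x))\<^sup>2 + (V j x)\<^sup>2) \<partial>lborel)"
    by (simp add: sum_distrib_left)
  also have "\<dots> \<le> of_nat (card ?A) * ennreal (b\<^sup>2)" by (intro mult_left_mono le) auto
  also have "\<dots> = ennreal ((sqrt (card ?A) * b)\<^sup>2)"
    by (simp add: power_mult_distrib ennreal_mult flip: ennreal_of_nat_eq_real_of_nat)
  finally have "Hk_norm_vec N 1 S V \<le> esqrt (ennreal ((sqrt (card ?A) * b)\<^sup>2))"
    unfolding Hk_norm_vec_def by (rule esqrt_mono)
  also have "\<dots> = ennreal (sqrt (card ?A) * b)" using b by (intro esqrt_ennreal_square) auto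
  finally show ?thesis .
qed

section \<open>The quadratic nonlinearity is Lipschitz on bounded sets\<close>

text \<open>
  Gram-Schmidt only forms linear combinations of the functions \<open>t\<^sup>i exp t\<close>. In particular \<open>\<psi>\<^sub>k\<close> is
  smooth, and it is bounded on \<open>[0,1]\<close> together with its derivative.
\<close>

lemma psi_poly_exp: "\<exists>q. \<forall>t. psi k t = poly q t * exp t"
proof (induction k rule: less_induct)
  case (less k)
  then obtain q where q: "\<And>j t. j < k \<Longrightarrow> psi j t = poly (q j) t * exp t" by metis
  define c where "c j = L2_inner (\<lambda>s. s ^ k * exp s) (psi j)" for j
  define f where "f t = t ^ k * exp t - (\<Sum>j<k. c j * psi j t)" for t
  have f: "f t = poly (monom 1 k - (\<Sum>j<k. smult (c j) (q j))) t * exp t" for t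
    by (simp add: f_def q poly_monom poly_sum left_diff_distrib sum_distrib_right mult.assoc)
  have "psi k = L2_normalize f"
    unfolding psi.simps[of k] f_def[abs_def] c_def ..
  then have "psi k t = f t / sqrt (L2_inner f f)" for t
    by (simp add: L2_normalize_def)
  then show ?case
    by (intro exI[of _ "smult (1 / sqrt (L2_inner f f)) (monom 1 k - (\<Sum>j<k. smult (c j) (q j)))"]) (simp add: f)
qed

lemma continuous_psi: "continuous_on S (psi k)" "continuous_on S (deriv (psi k))"
proof -
  obtain q where q: "psi k = (\<lambda>t. poly q t * exp t)" using psi_poly_exp[of k] by blast
  show "continuous_on S (psi k)" unfolding q by (intro continuous_intros)
  have "(psi k has_real_derivative (poly (pderiv q) t + poly q t) * exp t) (at t)" for t
    unfolding q by (auto intro!: derivative_eq_intros poly_DERIV simp: algebra_simps)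
  then have "deriv (psi k) = (\<lambda>t. (poly (pderiv q) t + poly q t) * exp t)"
    by (auto intro: DERIV_imp_deriv)
  then show "continuous_on S (deriv (psi k))" by (auto intro!: continuous_intros)
qed

lemma psi_bounded:
  obtains B where "B > 0" "\<And>k t. k < N \<Longrightarrow> t \<in> {0..1} \<Longrightarrow> \<bar>psi k t\<bar> \<le> B"
    "\<And>k t. k < N \<Longrightarrow> t \<in> {0..1} \<Longrightarrow> \<bar>deriv (psi k) t\<bar> \<le> B"
proof -
  have "\<exists>b>0. \<forall>t\<in>{0..1}. \<bar>f t\<bar> \<le> b" if "continuous_on {0..1} f" for f :: "real \<Rightarrow> real"
    using compact_imp_bounded[OF compact_continuous_image[OF that compact_Icc]]
    unfolding bounded_pos by auto
  then have "\<forall>k. \<exists>b>0. \<forall>t\<in>{0..1}. \<bar>psi k t\<bar> \<le> b" "\<forall>k. \<exists>b>0. \<forall>t\<in>{0..1}. \<bar>deriv (psi k) t\<bar> \<le> b"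
    using continuous_psi by blast+
  then obtain b b' where b: "\<And>k. b k > 0" "\<And>k t. t \<in> {0..1} \<Longrightarrow> \<bar>psi k t\<bar> \<le> b k"
    and b': "\<And>k. b' k > 0" "\<And>k t. t \<in> {0..1} \<Longrightarrow> \<bar>deriv (psi k) t\<bar> \<le> b' k" by metis
  define B where "B = 1 + (\<Sum>k<N. b k + b' k)"
  have le: "b k + b' k \<le> B" if "k < N" for k
  proof -
    have "b k + b' k \<le> (\<Sum>k<N. b k + b' k)"
      using that b(1) b'(1) by (intro member_le_sum) (auto simp: add_nonneg_nonneg less_imp_le)
    then show ?thesis by (simp add: B_def)
  qed
  show thesis
  proof (rule that[of B])
    show "B > 0" using b(1) b'(1) unfolding B_def
      by (intro add_pos_nonneg sum_nonneg) (auto simp: add_nonneg_nonneg less_imp_le)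
    fix k :: nat and t :: real assume kt: "k < N" "t \<in> {0..1}"
    show "\<bar>psi k t\<bar> \<le> B" using b(2)[OF kt(2), of k] le[OF kt(1)] b'(1)[of k] by linarith
    show "\<bar>deriv (psi k) t\<bar> \<le> B" using b'(2)[OF kt(2), of k] le[OF kt(1)] b(1)[of k] by linarith
  qed
qed

definition bounded_lipschitz :: "('a::real_normed_vector \<Rightarrow> real) \<Rightarrow> bool" where
  "bounded_lipschitz f \<longleftrightarrow>
     (\<forall>R. \<exists>L\<ge>0. \<forall>x y. norm x \<le> R \<longrightarrow> norm y \<le> R \<longrightarrow> \<bar>f x - f y\<bar> \<le> L * norm (x - y))"

lemma bounded_lipschitzE:
  assumes "bounded_lipschitz f"
  obtains L where "L \<ge> 0" "\<And>x y. norm x \<le> R \<Longrightarrow> norm y \<le> R \<Longrightarrow> \<bar>f x - f y\<bar> \<le> L * norm (x - y)"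
  using assms unfolding bounded_lipschitz_def by blast

lemma bounded_lipschitz_const: "bounded_lipschitz (\<lambda>x. c)"
  unfolding bounded_lipschitz_def by auto

lemma bounded_lipschitz_linear:
  assumes "bounded_linear f"
  shows "bounded_lipschitz f"
proof -
  obtain K where K: "K > 0" "\<And>x. norm (f x) \<le> norm x * K" using bounded_linear.pos_bounded[OF assms] by blast
  have "\<bar>f x - f y\<bar> \<le> K * norm (x - y)" for x y
    using K(2)[of "x - y"] linear_diff[OF bounded_linear.linear[OF assms], of x y] by (simp add: mult.commute)
  then show ?thesis unfolding bounded_lipschitz_def using K(1) by (auto intro!: exI[of _ K])
qed

lemma bounded_lipschitz_add:
  assumes "bounded_lipschitz f" "bounded_lipschitz g"
  shows "bounded_lipschitz (\<lambda>x. f x + g x)"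
  unfolding bounded_lipschitz_def
proof
  fix R
  obtain Lf where Lf: "Lf \<ge> 0" "\<And>x y. norm x \<le> R \<Longrightarrow> norm y \<le> R \<Longrightarrow> \<bar>f x - f y\<bar> \<le> Lf * norm (x - y)"
    using bounded_lipschitzE[OF assms(1)] by blast
  obtain Lg where Lg: "Lg \<ge> 0" "\<And>x y. norm x \<le> R \<Longrightarrow> norm y \<le> R \<Longrightarrow> \<bar>g x - g y\<bar> \<le> Lg * norm (x - y)"
    using bounded_lipschitzE[OF assms(2)] by blast
  have "\<bar>f x + g x - (f y + g y)\<bar> \<le> (Lf + Lg) * norm (x - y)" if "norm x \<le> R" "norm y \<le> R" for x y
    using Lf(2)[OF that] Lg(2)[OF that] unfolding distrib_right by linarith
  then show "\<exists>L\<ge>0. \<forall>x y. norm x \<le> R \<longrightarrow> norm y \<le> R \<longrightarrow> \<bar>f x + g x - (f y + g y)\<bar> \<le> L * norm (x - y)"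
    using Lf(1) Lg(1) by (intro exI[of _ "Lf + Lg"]) auto
qed

lemma bounded_lipschitz_mult:
  assumes "bounded_lipschitz f" "bounded_lipschitz g"
  shows "bounded_lipschitz (\<lambda>x. f x * g x)"
  unfolding bounded_lipschitz_def
proof
  fix R
  obtain Lf where Lf: "Lf \<ge> 0" "\<And>x y. norm x \<le> \<bar>R\<bar> \<Longrightarrow> norm y \<le> \<bar>R\<bar> \<Longrightarrow> \<bar>f x - f y\<bar> \<le> Lf * norm (x - y)"
    using bounded_lipschitzE[OF assms(1)] by blast
  obtain Lg where Lg: "Lg \<ge> 0" "\<And>x y. norm x \<le> \<bar>R\<bar> \<Longrightarrow> norm y \<le> \<bar>R\<bar> \<Longrightarrow> \<bar>g x - g y\<bar> \<le> Lg * norm (x - y)"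
    using bounded_lipschitzE[OF assms(2)] by blast
  define Bf where "Bf = \<bar>f 0\<bar> + Lf * \<bar>R\<bar>"
  define Bg where "Bg = \<bar>g 0\<bar> + Lg * \<bar>R\<bar>"
  have B0: "Bf \<ge> 0" "Bg \<ge> 0" using Lf Lg by (auto simp: Bf_def Bg_def)
  have Bf: "\<bar>f x\<bar> \<le> Bf" if "norm x \<le> \<bar>R\<bar>" for x
  proof -
    have "Lf * norm x \<le> Lf * \<bar>R\<bar>" using that Lf by (intro mult_left_mono) auto
    then show ?thesis using Lf(2)[OF that, of 0] by (simp add: Bf_def)
  qed
  have Bg: "\<bar>g x\<bar> \<le> Bg" if "norm x \<le> \<bar>R\<bar>" for x
  proof -
    have "Lg * norm x \<le> Lg * \<bar>R\<bar>" using that Lg by (intro mult_left_mono) auto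
    then show ?thesis using Lg(2)[OF that, of 0] by (simp add: Bg_def)
  qed
  have "\<bar>f x * g x - f y * g y\<bar> \<le> (Bf * Lg + Bg * Lf) * norm (x - y)"
    if "norm x \<le> R" "norm y \<le> R" for x y
  proof -
    have n: "norm x \<le> \<bar>R\<bar>" "norm y \<le> \<bar>R\<bar>" using that by auto
    have "f x * g x - f y * g y = f x * (g x - g y) + g y * (f x - f y)" by (simp add: algebra_simps)
    then have "\<bar>f x * g x - f y * g y\<bar> \<le> \<bar>f x\<bar> * \<bar>g x - g y\<bar> + \<bar>g y\<bar> * \<bar>f x - f y\<bar>"
      by (metis abs_mult abs_triangle_ineq)
    also have "\<dots> \<le> Bf * (Lg * norm (x - y)) + Bg * (Lf * norm (x - y))"
      using Bf[OF n(1)] Bg[OF n(2)] Lf(2)[OF n] Lg(2)[OF n] B0 by (intro add_mono mult_mono) auto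
    finally show ?thesis by (simp add: distrib_right mult.assoc)
  qed
  then show "\<exists>L\<ge>0. \<forall>x y. norm x \<le> R \<longrightarrow> norm y \<le> R \<longrightarrow> \<bar>f x * g x - f y * g y\<bar> \<le> L * norm (x - y)"
    using B0 Lf(1) Lg(1) by (intro exI[of _ "Bf * Lg + Bg * Lf"]) auto
qed

lemma bounded_lipschitz_sum:
  "(\<And>i. i \<in> I \<Longrightarrow> bounded_lipschitz (f i)) \<Longrightarrow> bounded_lipschitz (\<lambda>x. \<Sum>i\<in>I. f i x)"
  by (induction I rule: infinite_finite_induct)
     (auto intro: bounded_lipschitz_const bounded_lipschitz_add)

lemma bounded_lipschitz_prod:
  "(\<And>i. i \<in> I \<Longrightarrow> bounded_lipschitz (f i)) \<Longrightarrow> bounded_lipschitz (\<lambda>x. \<Prod>i\<in>I. f i x)"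
  by (induction I rule: infinite_finite_induct)
     (auto intro: bounded_lipschitz_const bounded_lipschitz_mult)

lemma bounded_lipschitz_power:
  "bounded_lipschitz f \<Longrightarrow> bounded_lipschitz (\<lambda>x. f x ^ n)"
  by (induction n) (auto intro: bounded_lipschitz_const bounded_lipschitz_mult)

lemma bounded_lipschitz_continuous:
  assumes "bounded_lipschitz f"
  shows "continuous_on S f"
proof -
  have "isCont f x" for x
  proof -
    obtain L where L: "L \<ge> 0" "\<And>y z. norm y \<le> norm x + 1 \<Longrightarrow> norm z \<le> norm x + 1 \<Longrightarrow> \<bar>f y - f z\<bar> \<le> L * norm (y - z)"
      using bounded_lipschitzE[OF assms] by blast
    have lim: "((\<lambda>y. L * norm (y - x)) \<longlongrightarrow> 0) (at x)"
      by (rule tendsto_eq_intros refl | simp)+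
    have "\<forall>\<^sub>F y in at x. norm (y - x) < 1"
      by (auto simp: eventually_at dist_norm intro!: exI[of _ 1])
    then have "\<forall>\<^sub>F y in at x. norm (f y - f x) \<le> L * norm (y - x)"
    proof (rule eventually_mono)
      fix y assume "norm (y - x) < 1"
      then have "norm y \<le> norm x + 1" using norm_triangle_ineq2[of y x] by linarith
      then show "norm (f y - f x) \<le> L * norm (y - x)" using L(2)[of y x] by simp
    qed
    then have "((\<lambda>y. f y - f x) \<longlongrightarrow> 0) (at x)" using lim by (rule Lim_null_comparison)
    then show ?thesis unfolding isCont_def by (simp add: LIM_zero_iff)
  qed
  then show ?thesis by (rule continuous_at_imp_continuous_on[OF ballI])
qed

text \<open>The partial derivative of the monomial \<open>q\<^sup>\<alpha>\<close> in direction \<open>i\<close>, as the product rule gives it.\<close>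

definition mono_power_deriv :: "'n \<Rightarrow> 'n::finite multiindex \<Rightarrow> real^'n \<Rightarrow> real" where
  "mono_power_deriv i \<alpha> q =
     (\<Sum>l\<in>UNIV. real (\<alpha> l) * (q $ l) ^ (\<alpha> l - 1) * (axis i 1 :: real^'n) $ l * (\<Prod>j\<in>UNIV - {l}. (q $ j) ^ \<alpha> j))"

lemma has_derivative_mono_power:
  "((\<lambda>q. mono_power q \<alpha>) has_derivative (\<lambda>h. \<Sum>l\<in>UNIV. real (\<alpha> l) * (q $ l) ^ (\<alpha> l - 1) * h $ l *
      (\<Prod>j\<in>UNIV - {l}. (q $ j) ^ \<alpha> j))) (at q)"
  unfolding mono_power_def
proof (rule has_derivative_prod)
  fix l
  have "((\<lambda>q. q $ l) has_derivative (\<lambda>h. h $ l)) (at q)"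
    by (rule bounded_linear_imp_has_derivative) (rule bounded_linear_vec_nth)
  from has_derivative_power[OF this, of "\<alpha> l"]
  show "((\<lambda>q. (q $ l) ^ \<alpha> l) has_derivative (\<lambda>h. real (\<alpha> l) * (q $ l) ^ (\<alpha> l - 1) * h $ l)) (at q)"
    by (rule has_derivative_eq_rhs) (auto simp: mult_ac)
qed

lemma F2_expansion:
  fixes a :: "'n::finite multiindex \<Rightarrow> real^'n \<Rightarrow> real"
  shows "F2 a x q r = (\<Sum>i\<in>UNIV. \<Sum>\<alpha> | 1 \<le> mi_order \<alpha> \<and> mi_order \<alpha> \<le> 2. a \<alpha> x * (mono_power_deriv i \<alpha> q * r $ i))"
proof -
  let ?A = "{\<alpha> :: 'n multiindex. 1 \<le> mi_order \<alpha> \<and> mi_order \<alpha> \<le> 2}"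
  have "part_deriv UNIV i (F1 a x) q = (\<Sum>\<alpha>\<in>?A. a \<alpha> x * mono_power_deriv i \<alpha> q)" for i
  proof -
    have "(F1 a x has_derivative (\<lambda>h. \<Sum>\<alpha>\<in>?A. a \<alpha> x * (\<Sum>l\<in>UNIV. real (\<alpha> l) * (q $ l) ^ (\<alpha> l - 1) * h $ l *
      (\<Prod>j\<in>UNIV - {l}. (q $ j) ^ \<alpha> j)))) (at q)"
      unfolding F1_def by (intro has_derivative_sum has_derivative_mult_right has_derivative_mono_power)
    from frechet_derivative_at[OF this, symmetric] show ?thesis
      by (simp add: part_deriv_def mono_power_deriv_def)
  qed
  then show ?thesis by (simp add: F2_def sum_distrib_right mult.assoc)
qed

lemma bounded_lipschitz_F2_term:
  "bounded_lipschitz (\<lambda>z :: (real^'n) \<times> (real^'n). mono_power_deriv i \<alpha> (fst z) * snd z $ i)"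
  unfolding mono_power_deriv_def
  by (intro bounded_lipschitz_mult bounded_lipschitz_sum bounded_lipschitz_prod bounded_lipschitz_power
      bounded_lipschitz_const bounded_lipschitz_linear
      bounded_linear_compose[OF bounded_linear_vec_nth bounded_linear_fst]
      bounded_linear_compose[OF bounded_linear_vec_nth bounded_linear_snd])

lemma bounded_lipschitz_F2: "bounded_lipschitz (\<lambda>z. F2 a x (fst z) (snd z))"
  unfolding F2_expansion
  by (intro bounded_lipschitz_sum bounded_lipschitz_mult[OF bounded_lipschitz_const bounded_lipschitz_F2_term])

text \<open>The constant must be uniform in the coefficients \<open>a\<close>, of which only a bound is known.\<close>

lemma F2_lipschitz:
  assumes "Z \<ge> 0"
  obtains L where "L \<ge> 0"
    "\<And>(a :: 'n::finite multiindex \<Rightarrow> real^'n \<Rightarrow> real) x (z :: (real^'n) \<times> (real^'n)) z'.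
       (\<And>\<alpha>. 1 \<le> mi_order \<alpha> \<Longrightarrow> mi_order \<alpha> \<le> 2 \<Longrightarrow> \<bar>a \<alpha> x\<bar> \<le> Z) \<Longrightarrow> norm z \<le> R \<Longrightarrow> norm z' \<le> R \<Longrightarrow>
       \<bar>F2 a x (fst z) (snd z) - F2 a x (fst z') (snd z')\<bar> \<le> L * norm (z - z')"
proof -
  let ?A = "{\<alpha> :: 'n multiindex. 1 \<le> mi_order \<alpha> \<and> mi_order \<alpha> \<le> 2}"
  let ?h = "\<lambda>i \<alpha> (z :: (real^'n) \<times> (real^'n)). mono_power_deriv i \<alpha> (fst z) * snd z $ i"
  have "\<exists>l\<ge>0. \<forall>z z'. norm z \<le> R \<longrightarrow> norm z' \<le> R \<longrightarrow> \<bar>?h i \<alpha> z - ?h i \<alpha> z'\<bar> \<le> l * norm (z - z')" for i \<alpha>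
    using bounded_lipschitz_F2_term[of i \<alpha>] unfolding bounded_lipschitz_def by blast
  then obtain l where l: "\<And>i \<alpha>. l i \<alpha> \<ge> 0"
    "\<And>i \<alpha> z z'. norm z \<le> R \<Longrightarrow> norm z' \<le> R \<Longrightarrow> \<bar>?h i \<alpha> z - ?h i \<alpha> z'\<bar> \<le> l i \<alpha> * norm (z - z')"
    by metis
  define L where "L = (\<Sum>i\<in>UNIV. \<Sum>\<alpha>\<in>?A. Z * l i \<alpha>)"
  show thesis
  proof (rule that[of L])
    show "L \<ge> 0" unfolding L_def using assms l by (intro sum_nonneg) auto
    fix a :: "'n multiindex \<Rightarrow> real^'n \<Rightarrow> real" and x and z z' :: "(real^'n) \<times> (real^'n)"
    assume a: "\<And>\<alpha>. 1 \<le> mi_order \<alpha> \<Longrightarrow> mi_order \<alpha> \<le> 2 \<Longrightarrow> \<bar>a \<alpha> x\<bar> \<le> Z" and z: "norm z \<le> R" "norm z' \<le> R"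
    have "\<bar>F2 a x (fst z) (snd z) - F2 a x (fst z') (snd z')\<bar>
      = \<bar>\<Sum>i\<in>UNIV. \<Sum>\<alpha>\<in>?A. a \<alpha> x * (?h i \<alpha> z - ?h i \<alpha> z')\<bar>"
      unfolding F2_expansion by (simp add: sum_subtractf right_diff_distrib)
    also have "\<dots> \<le> (\<Sum>i\<in>UNIV. \<Sum>\<alpha>\<in>?A. \<bar>a \<alpha> x * (?h i \<alpha> z - ?h i \<alpha> z')\<bar>)"
      by (rule order_trans[OF sum_abs sum_mono[OF sum_abs]])
    also have "\<dots> \<le> (\<Sum>i\<in>UNIV. \<Sum>\<alpha>\<in>?A. Z * (l i \<alpha> * norm (z - z')))"
      unfolding abs_mult using a l(2)[OF z] assms by (intro sum_mono mult_mono) auto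
    also have "\<dots> = L * norm (z - z')" by (simp add: L_def sum_distrib_right mult.assoc)
    finally show "\<bar>F2 a x (fst z) (snd z) - F2 a x (fst z') (snd z')\<bar> \<le> L * norm (z - z')" .
  qed
qed

lemma F_vec_lipschitz:
  assumes "Z \<ge> 0" "K \<ge> 0"
  obtains M where "M \<ge> 0"
    "\<And>(a :: 'n::finite multiindex \<Rightarrow> real^'n \<Rightarrow> real) x (G :: nat \<Rightarrow> real^'n) G' m.
       (\<And>\<alpha>. 1 \<le> mi_order \<alpha> \<Longrightarrow> mi_order \<alpha> \<le> 2 \<Longrightarrow> \<bar>a \<alpha> x\<bar> \<le> Z) \<Longrightarrow>
       (\<And>k. k < N \<Longrightarrow> norm (G k) \<le> K) \<Longrightarrow> (\<And>k. k < N \<Longrightarrow> norm (G' k) \<le> K) \<Longrightarrow> m < N \<Longrightarrow>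
       \<bar>F_vec a N x G m - F_vec a N x G' m\<bar> \<le> M * (\<Sum>k<N. norm (G k - G' k))"
proof -
  obtain B where B: "B > 0" "\<And>k t. k < N \<Longrightarrow> t \<in> {0..1} \<Longrightarrow> \<bar>psi k t\<bar> \<le> B"
    "\<And>k t. k < N \<Longrightarrow> t \<in> {0..1} \<Longrightarrow> \<bar>deriv (psi k) t\<bar> \<le> B"
    using psi_bounded[of N] by blast
  define R where "R = 2 * (real N * (B * K))"
  obtain L where L: "L \<ge> 0"
    "\<And>(a :: 'n::finite multiindex \<Rightarrow> real^'n \<Rightarrow> real) x (z :: (real^'n) \<times> (real^'n)) z'.
       (\<And>\<alpha>. 1 \<le> mi_order \<alpha> \<Longrightarrow> mi_order \<alpha> \<le> 2 \<Longrightarrow> \<bar>a \<alpha> x\<bar> \<le> Z) \<Longrightarrow> norm z \<le> R \<Longrightarrow> norm z' \<le> R \<Longrightarrow>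
       \<bar>F2 a x (fst z) (snd z) - F2 a x (fst z') (snd z')\<bar> \<le> L * norm (z - z')"
    using F2_lipschitz[OF assms(1)] by blast
  define w :: "(nat \<Rightarrow> real^'n) \<Rightarrow> real \<Rightarrow> (real^'n) \<times> (real^'n)"
    where "w G t = (\<Sum>k<N. psi k t *\<^sub>R G k, \<Sum>k<N. deriv (psi k) t *\<^sub>R G k)" for G t
  have wc: "continuous_on S (w G)" for S G
    unfolding w_def by (intro continuous_intros continuous_psi)
  have w_le: "norm (w G t) \<le> 2 * (B * (\<Sum>k<N. norm (G k)))" if "t \<in> {0..1}" for G t
  proof -
    have "norm (\<Sum>k<N. psi k t *\<^sub>R G k) \<le> (\<Sum>k<N. B * norm (G k))"
      using B(2) that by (intro order_trans[OF norm_sum sum_mono]) (auto intro!: mult_right_mono)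
    moreover have "norm (\<Sum>k<N. deriv (psi k) t *\<^sub>R G k) \<le> (\<Sum>k<N. B * norm (G k))"
      using B(3) that by (intro order_trans[OF norm_sum sum_mono]) (auto intro!: mult_right_mono)
    ultimately show ?thesis
      unfolding w_def using norm_Pair_le[of "\<Sum>k<N. psi k t *\<^sub>R G k" "\<Sum>k<N. deriv (psi k) t *\<^sub>R G k"]
      by (simp add: sum_distrib_left[symmetric])
  qed
  have w_diff: "w G t - w G' t = w (\<lambda>k. G k - G' k) t" for G G' t
    by (simp add: w_def scaleR_right_diff_distrib sum_subtractf)
  have w_R: "norm (w G t) \<le> R" if "t \<in> {0..1}" "\<And>k. k < N \<Longrightarrow> norm (G k) \<le> K" for G t
  proof -
    have "(\<Sum>k<N. norm (G k)) \<le> real N * K"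
      using sum_bounded_above[of "{..<N}" "\<lambda>k. norm (G k)" K] that(2) by simp
    then have "2 * (B * (\<Sum>k<N. norm (G k))) \<le> 2 * (B * (real N * K))" using B(1) by simp
    then show ?thesis using w_le[OF that(1), of G] by (simp add: R_def mult_ac)
  qed
  define M where "M = L * (2 * B) * B"
  show thesis
  proof (rule that[of M])
    show "M \<ge> 0" using L(1) B(1) by (simp add: M_def)
    fix a :: "'n multiindex \<Rightarrow> real^'n \<Rightarrow> real" and x and G G' :: "nat \<Rightarrow> real^'n" and m
    assume a: "\<And>\<alpha>. 1 \<le> mi_order \<alpha> \<Longrightarrow> mi_order \<alpha> \<le> 2 \<Longrightarrow> \<bar>a \<alpha> x\<bar> \<le> Z"
      and G: "\<And>k. k < N \<Longrightarrow> norm (G k) \<le> K" and G': "\<And>k. k < N \<Longrightarrow> norm (G' k) \<le> K" and m: "m < N"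
    define \<Delta> where "\<Delta> = (\<Sum>k<N. norm (G k - G' k))"
    define f where "f G t = F2 a x (fst (w G t)) (snd (w G t)) * psi m t" for G t
    have fc: "continuous_on {0..1} (f G)" for G
      unfolding f_def
      by (intro continuous_on_mult continuous_psi continuous_on_compose2[OF bounded_lipschitz_continuous[OF bounded_lipschitz_F2] wc]) auto
    have f_int: "set_integrable lborel {0<..<1} (f G)" for G
    proof (rule set_integrable_subset)
      show "set_integrable lborel {0..1} (f G)"
        unfolding set_integrable_def by (rule borel_integrable_compact[OF compact_Icc fc])
    qed auto
    have eq: "F_vec a N x H m = - (LINT t:{0<..<1}|lborel. f H t)" for H
      by (simp add: F_vec_def L2_inner_def f_def w_def)
    have "\<bar>F_vec a N x G m - F_vec a N x G' m\<bar> = \<bar>LINT t:{0<..<1}|lborel. (f G t - f G' t)\<bar>"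
      unfolding eq using set_integral_diff(2)[OF f_int f_int, of G G'] by simp
    also have "\<dots> \<le> (LINT t:{0<..<1::real}|lborel. M * \<Delta>)"
    proof -
      have "\<bar>LINT t:{0<..<1}|lborel. (f G t - f G' t)\<bar> \<le> (LINT t|lborel. \<bar>indicator {0<..<1} t *\<^sub>R (f G t - f G' t)\<bar>)"
        unfolding set_lebesgue_integral_def by (rule integral_abs_bound)
      also have "\<dots> \<le> (LINT t|lborel. indicator {0<..<1::real} t *\<^sub>R (M * \<Delta>))"
      proof (rule integral_mono)
        show "integrable lborel (\<lambda>t. \<bar>indicator {0<..<1} t *\<^sub>R (f G t - f G' t)\<bar>)"
          using set_integral_diff(1)[OF f_int f_int, of G G'] unfolding set_integrable_def by (rule integrable_abs)
        show "integrable lborel (\<lambda>t::real. indicator {0<..<1} t *\<^sub>R (M * \<Delta>))"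
          by (intro integrable_scaleR_left integrable_real_indicator) auto
        fix t :: real
        show "\<bar>indicator {0<..<1} t *\<^sub>R (f G t - f G' t)\<bar> \<le> indicator {0<..<1} t *\<^sub>R (M * \<Delta>)"
        proof (cases "t \<in> {0<..<1}")
          case True
          then have t: "t \<in> {0..1}" by auto
          have "\<bar>f G t - f G' t\<bar> = \<bar>F2 a x (fst (w G t)) (snd (w G t)) - F2 a x (fst (w G' t)) (snd (w G' t))\<bar> * \<bar>psi m t\<bar>"
            unfolding f_def left_diff_distrib[symmetric] by (rule abs_mult)
          also have "\<dots> \<le> (L * norm (w G t - w G' t)) * B"
            using L(1) B(2)[OF m t] L(2)[of a x, OF a w_R[OF t G] w_R[OF t G']] by (intro mult_mono) auto
          also have "\<dots> \<le> (L * (2 * (B * \<Delta>))) * B"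
            unfolding w_diff \<Delta>_def using w_le[OF t] L(1) B(1) by (intro mult_right_mono mult_left_mono) auto
          finally show ?thesis using True by (simp add: M_def mult_ac)
        qed simp
      qed
      finally show ?thesis by (simp add: set_lebesgue_integral_def)
    qed
    also have "\<dots> = M * \<Delta>" by (simp add: set_lebesgue_integral_def)
    finally show "\<bar>F_vec a N x G m - F_vec a N x G' m\<bar> \<le> M * (\<Sum>k<N. norm (G k - G' k))"
      by (simp add: \<Delta>_def)
  qed
qed

lemma P_vec_lipschitz:
  assumes "Z \<ge> 0" "K \<ge> 0"
  obtains M where "M \<ge> 0"
    "\<And>(a :: 'n::finite multiindex \<Rightarrow> real^'n \<Rightarrow> real) x (G :: nat \<Rightarrow> real^'n) G' m.
       (\<And>\<alpha>. 1 \<le> mi_order \<alpha> \<Longrightarrow> mi_order \<alpha> \<le> 2 \<Longrightarrow> \<bar>a \<alpha> x\<bar> \<le> Z) \<Longrightarrow>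
       (\<And>k. k < N \<Longrightarrow> norm (G k) \<le> K) \<Longrightarrow> (\<And>k. k < N \<Longrightarrow> norm (G' k) \<le> K) \<Longrightarrow> m < N \<Longrightarrow>
       \<bar>P_vec a N x G m - P_vec a N x G' m\<bar> \<le> M * (\<Sum>k<N. norm (G k - G' k))"
proof -
  obtain M where M: "M \<ge> 0"
    "\<And>(a :: 'n::finite multiindex \<Rightarrow> real^'n \<Rightarrow> real) x (G :: nat \<Rightarrow> real^'n) G' m.
       (\<And>\<alpha>. 1 \<le> mi_order \<alpha> \<Longrightarrow> mi_order \<alpha> \<le> 2 \<Longrightarrow> \<bar>a \<alpha> x\<bar> \<le> Z) \<Longrightarrow>
       (\<And>k. k < N \<Longrightarrow> norm (G k) \<le> K) \<Longrightarrow> (\<And>k. k < N \<Longrightarrow> norm (G' k) \<le> K) \<Longrightarrow> m < N \<Longrightarrow>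
       \<bar>F_vec a N x G m - F_vec a N x G' m\<bar> \<le> M * (\<Sum>k<N. norm (G k - G' k))"
    using F_vec_lipschitz[OF assms] by blast
  let ?B = "inverse_matrix N psi_matrix"
  define W where "W = (\<Sum>m<N. \<Sum>j<N. \<bar>?B m j\<bar>)"
  show thesis
  proof (rule that[of "W * M"])
    show "W * M \<ge> 0" using M(1) by (simp add: W_def sum_nonneg)
    fix a :: "'n multiindex \<Rightarrow> real^'n \<Rightarrow> real" and x and G G' :: "nat \<Rightarrow> real^'n" and m
    assume a: "\<And>\<alpha>. 1 \<le> mi_order \<alpha> \<Longrightarrow> mi_order \<alpha> \<le> 2 \<Longrightarrow> \<bar>a \<alpha> x\<bar> \<le> Z"
      and G: "\<And>k. k < N \<Longrightarrow> norm (G k) \<le> K" and G': "\<And>k. k < N \<Longrightarrow> norm (G' k) \<le> K" and m: "m < N"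
    let ?\<Delta> = "\<Sum>k<N. norm (G k - G' k)"
    have "\<bar>P_vec a N x G m - P_vec a N x G' m\<bar> = \<bar>\<Sum>j<N. ?B m j * (F_vec a N x G j - F_vec a N x G' j)\<bar>"
      by (simp add: P_vec_def sum_subtractf right_diff_distrib)
    also have "\<dots> \<le> (\<Sum>j<N. \<bar>?B m j\<bar> * \<bar>F_vec a N x G j - F_vec a N x G' j\<bar>)"
      unfolding abs_mult[symmetric] by (rule sum_abs)
    also have "\<dots> \<le> (\<Sum>j<N. \<bar>?B m j\<bar> * (M * ?\<Delta>))"
    proof (intro sum_mono mult_left_mono)
      fix j assume "j \<in> {..<N}"
      then show "\<bar>F_vec a N x G j - F_vec a N x G' j\<bar> \<le> M * ?\<Delta>"
        by (intro M(2) a G G') auto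
    qed auto
    also have "\<dots> = (\<Sum>j<N. \<bar>?B m j\<bar>) * (M * ?\<Delta>)" by (simp add: sum_distrib_right)
    also have "\<dots> \<le> W * (M * ?\<Delta>)"
    proof (rule mult_right_mono)
      show "(\<Sum>j<N. \<bar>?B m j\<bar>) \<le> W"
        unfolding W_def using m by (intro member_le_sum[of m "{..<N}" "\<lambda>m. \<Sum>j<N. \<bar>?B m j\<bar>"]) (auto intro: sum_nonneg)
      show "0 \<le> M * ?\<Delta>" using M(1) by (simp add: sum_nonneg)
    qed
    finally show "\<bar>P_vec a N x G m - P_vec a N x G' m\<bar> \<le> W * M * ?\<Delta>" by (simp add: mult.assoc)
  qed
qed

section \<open>The Carleman estimate in integrated form\<close>

lemma set_integrable_frontier:
  fixes f :: "real^'n \<Rightarrow> real"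
  assumes D: "bounded D" and fin: "emeasure surface_measure (frontier D) < \<infinity>"
    and f: "continuous_on (closure D) f" and S: "S \<in> sets borel" "S \<subseteq> frontier D"
  shows "set_integrable surface_measure S f"
proof -
  have BD: "frontier D \<subseteq> closure D" by (auto simp: frontier_def)
  obtain M where M: "M > 0" "\<And>x. x \<in> closure D \<Longrightarrow> \<bar>f x\<bar> \<le> M"
    using continuous_closure_bounded[OF D f] by blast
  have "set_integrable surface_measure (frontier D) f"
    unfolding set_integrable_def
  proof (rule integrableI_bounded_set[where A="frontier D" and B=M])
    show "(\<lambda>x. indicator (frontier D) x *\<^sub>R f x) \<in> borel_measurable surface_measure"
      using continuous_on_subset[OF f BD]
      by (subst measurable_cong_sets[OF sets_surface_measure refl])
        (intro borel_measurable_continuous_on_indicator; auto)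
    show "AE x in surface_measure. x \<in> frontier D \<longrightarrow> norm (indicator (frontier D) x *\<^sub>R f x) \<le> M"
      using M(2) BD by auto
  qed (use fin in auto)
  then show ?thesis by (rule set_integrable_subset) (use S in auto)
qed

lemma carleman_integrated:
  fixes u \<xi> Q :: "real^'n \<Rightarrow> real" and l C1 :: real
  defines "w \<equiv> \<lambda>x. (carleman_weight \<xi> l x)\<^sup>2"
  assumes D: "open D" "bounded D" and fin: "emeasure surface_measure (frontier D) < \<infinity>"
    and \<xi>: "continuous_on (closure D) \<xi>" and u: "Ck_closure 2 D u"
    and Q: "continuous_on (closure D) Q" "\<And>x. x \<in> D \<Longrightarrow> (principal_part a D u x)\<^sup>2 \<le> Q x"
    and U: "\<And>i. Ck_closure 1 D (\<lambda>y. U y $ i)"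
    and carl: "\<And>x. x \<in> closure D \<Longrightarrow> (principal_part a D u x)\<^sup>2 * w x
        \<ge> C1 * l * (norm (grad D u x))\<^sup>2 * w x + C1 * l ^ 3 * (u x)\<^sup>2 * w x + divergence D U x"
    and Ub: "\<And>x. x \<in> closure D \<Longrightarrow> norm (U x) \<le> C1 * l ^ 3 * ((norm (grad D u x))\<^sup>2 + (u x)\<^sup>2) * w x"
  shows "C1 * l * (LINT x:D|lborel. (norm (grad D u x))\<^sup>2 * w x) + C1 * l ^ 3 * (LINT x:D|lborel. (u x)\<^sup>2 * w x)
    \<le> (LINT x:D|lborel. Q x * w x) + real CARD('n) * boundary_const CARD('n) * (C1 * l ^ 3) *
        (LINT x:frontier D|surface_measure. ((norm (grad D u x))\<^sup>2 + (u x)\<^sup>2) * w x)"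
proof -
  let ?B = "frontier D" and ?S = "surface_measure :: (real^'n) measure"
  have BD: "?B \<subseteq> closure D" by (auto simp: frontier_def)
  have wc: "continuous_on (closure D) w"
    unfolding w_def carleman_weight_def using \<xi> by (intro continuous_intros)
  have w0: "w x \<ge> 0" for x by (simp add: w_def)
  have uc: "continuous_on (closure D) u" using u by (rule Ck_closure_continuous)
  have gc: "continuous_on (closure D) (grad D u)"
    using Ck_closure_2D(1)[OF u] by (rule continuous_on_grad)
  have gwc: "continuous_on (closure D) (\<lambda>x. (norm (grad D u x))\<^sup>2 * w x)"
    using gc wc by (intro continuous_intros)
  have uwc: "continuous_on (closure D) (\<lambda>x. (u x)\<^sup>2 * w x)"
    using uc wc by (intro continuous_intros)
  have Qwc: "continuous_on (closure D) (\<lambda>x. Q x * w x)"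
    using Q(1) wc by (intro continuous_intros)
  have bc: "continuous_on (closure D) (\<lambda>x. ((norm (grad D u x))\<^sup>2 + (u x)\<^sup>2) * w x)"
    using gc uc wc by (intro continuous_intros)
  have Uic: "continuous_on (closure D) (\<lambda>y. U y $ i)" for i
    using U by (rule Ck_closure_continuous)
  have pc: "continuous_on (closure D) (part_deriv D i (\<lambda>y. U y $ i))" for i
    using U[of i] by (simp add: Ck_closure_1_iff del: One_nat_def)
  have dc: "continuous_on (closure D) (divergence D U)"
    unfolding divergence_def using pc by (intro continuous_intros)
  note int = set_integrable_continuous_closure[OF D]
  have "\<bar>LINT x:D|lborel. divergence D U x\<bar> \<le> real CARD('n) * boundary_const CARD('n) * (C1 * l ^ 3) *
        (LINT x:?B|?S. ((norm (grad D u x))\<^sup>2 + (u x)\<^sup>2) * w x)"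
  proof -
    have "(LINT x:D|lborel. divergence D U x) = (\<Sum>i\<in>UNIV. LINT x:D|lborel. part_deriv D i (\<lambda>y. U y $ i) x)"
    proof -
      have "(LINT x:D|lborel. divergence D U x)
          = (LINT x|lborel. (\<Sum>i\<in>UNIV. indicator D x *\<^sub>R part_deriv D i (\<lambda>y. U y $ i) x))"
        by (simp add: set_lebesgue_integral_def divergence_def sum_distrib_left)
      also have "\<dots> = (\<Sum>i\<in>UNIV. LINT x:D|lborel. part_deriv D i (\<lambda>y. U y $ i) x)"
        unfolding set_lebesgue_integral_def
        by (rule Bochner_Integration.integral_sum) (use int[OF pc] in \<open>simp add: set_integrable_def\<close>)
      finally show ?thesis .
    qed
    then have "\<bar>LINT x:D|lborel. divergence D U x\<bar> \<le> (\<Sum>i\<in>UNIV. \<bar>LINT x:D|lborel. part_deriv D i (\<lambda>y. U y $ i) x\<bar>)"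
      by simp
    also have "\<dots> \<le> (\<Sum>i\<in>(UNIV::'n set). boundary_const CARD('n) * (C1 * l ^ 3 *
        (LINT x:?B|?S. ((norm (grad D u x))\<^sup>2 + (u x)\<^sup>2) * w x)))"
    proof (rule sum_mono)
      fix i :: 'n
      have "\<bar>LINT x:D|lborel. part_deriv D i (\<lambda>y. U y $ i) x\<bar>
          \<le> boundary_const CARD('n) * (LINT x:?B|?S. \<bar>U x $ i\<bar>)"
        by (rule integral_part_deriv_le_boundary[OF D U fin])
      also have "(LINT x:?B|?S. \<bar>U x $ i\<bar>) \<le> (LINT x:?B|?S. C1 * l ^ 3 * (((norm (grad D u x))\<^sup>2 + (u x)\<^sup>2) * w x))"
      proof (rule set_integral_mono)
        show "set_integrable ?S ?B (\<lambda>x. \<bar>U x $ i\<bar>)"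
          by (intro set_integrable_frontier[OF D(2) fin] continuous_on_rabs Uic) auto
        show "set_integrable ?S ?B (\<lambda>x. C1 * l ^ 3 * (((norm (grad D u x))\<^sup>2 + (u x)\<^sup>2) * w x))"
          using bc by (intro set_integrable_frontier[OF D(2) fin] continuous_on_mult_left) auto
        fix x assume "x \<in> ?B"
        then show "\<bar>U x $ i\<bar> \<le> C1 * l ^ 3 * (((norm (grad D u x))\<^sup>2 + (u x)\<^sup>2) * w x)"
          using Ub[of x] component_le_norm_cart[of "U x" i] BD by (auto simp: mult.assoc)
      qed
      finally show "\<bar>LINT x:D|lborel. part_deriv D i (\<lambda>y. U y $ i) x\<bar> \<le> boundary_const CARD('n) * (C1 * l ^ 3 *
        (LINT x:?B|?S. ((norm (grad D u x))\<^sup>2 + (u x)\<^sup>2) * w x))"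
        using boundary_const_pos[of "CARD('n)"] by (simp add: mult_left_mono)
    qed
    also have "\<dots> = real CARD('n) * boundary_const CARD('n) * (C1 * l ^ 3) *
        (LINT x:?B|?S. ((norm (grad D u x))\<^sup>2 + (u x)\<^sup>2) * w x)"
      by (simp add: mult.assoc)
    finally show ?thesis .
  qed
  moreover have "C1 * l * (LINT x:D|lborel. (norm (grad D u x))\<^sup>2 * w x) + C1 * l ^ 3 * (LINT x:D|lborel. (u x)\<^sup>2 * w x)
      + (LINT x:D|lborel. divergence D U x) \<le> (LINT x:D|lborel. Q x * w x)"
  proof -
    have i1: "set_integrable lborel D (\<lambda>x. C1 * l * ((norm (grad D u x))\<^sup>2 * w x))"
      using gwc by (intro int continuous_on_mult_left)
    have i2: "set_integrable lborel D (\<lambda>x. C1 * l ^ 3 * ((u x)\<^sup>2 * w x))"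
      using uwc by (intro int continuous_on_mult_left)
    have "C1 * l * (LINT x:D|lborel. (norm (grad D u x))\<^sup>2 * w x) + C1 * l ^ 3 * (LINT x:D|lborel. (u x)\<^sup>2 * w x)
      + (LINT x:D|lborel. divergence D U x)
      = (LINT x:D|lborel. C1 * l * ((norm (grad D u x))\<^sup>2 * w x) + C1 * l ^ 3 * ((u x)\<^sup>2 * w x) + divergence D U x)"
      using i1 i2 int[OF dc] by (simp add: set_integral_add)
    also have "\<dots> \<le> (LINT x:D|lborel. Q x * w x)"
    proof (rule set_integral_mono)
      show "set_integrable lborel D (\<lambda>x. C1 * l * ((norm (grad D u x))\<^sup>2 * w x) + C1 * l ^ 3 * ((u x)\<^sup>2 * w x) + divergence D U x)"
        using i1 i2 int[OF dc] by (intro set_integral_add)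
      show "set_integrable lborel D (\<lambda>x. Q x * w x)" by (rule int[OF Qwc])
      fix x assume x: "x \<in> D"
      then have "x \<in> closure D" using closure_subset by blast
      from carl[OF this] have "C1 * l * ((norm (grad D u x))\<^sup>2 * w x) + C1 * l ^ 3 * ((u x)\<^sup>2 * w x) + divergence D U x
          \<le> (principal_part a D u x)\<^sup>2 * w x" by (simp add: mult.assoc)
      also have "\<dots> \<le> Q x * w x" by (intro mult_right_mono Q(2) x w0)
      finally show "C1 * l * ((norm (grad D u x))\<^sup>2 * w x) + C1 * l ^ 3 * ((u x)\<^sup>2 * w x) + divergence D U x \<le> Q x * w x" .
    qed
    finally show ?thesis .
  qed
  ultimately show ?thesis by linarith
qed

text \<open>
  The large weight \<open>exp (l m)\<close> is paid only on \<open>\<Gamma>\<close>, where the data will control \<open>f\<close>. Elsewhere on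
  \<open>\<partial>D\<close> nothing but the bound \<open>\<kappa>\<close> is available, but there the weight is at most \<open>exp (l d)\<close>.
\<close>

lemma weighted_boundary_integral_le:
  fixes f \<xi> :: "real^'n \<Rightarrow> real"
  assumes D: "open D" "bounded D" and fin: "emeasure surface_measure (frontier D) < \<infinity>"
    and \<xi>: "continuous_on (closure D) \<xi>" "\<And>x. x \<in> closure D \<Longrightarrow> \<xi> x \<le> m"
    and \<Gamma>: "\<Gamma> \<in> sets borel" "\<And>x. x \<in> frontier D \<Longrightarrow> x \<notin> \<Gamma> \<Longrightarrow> \<xi> x \<le> d"
    and f: "continuous_on (closure D) f" "\<And>x. 0 \<le> f x" "\<And>x. x \<in> frontier D \<Longrightarrow> f x \<le> \<kappa>"
    and l: "l > 0"
  shows "(LINT x:frontier D|surface_measure. f x * (carleman_weight \<xi> l x)\<^sup>2)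
    \<le> exp (2 * l * m) * (LINT x:(\<Gamma> \<inter> frontier D)|surface_measure. f x)
      + exp (2 * l * d) * (\<kappa> * measure surface_measure (frontier D))"
proof -
  let ?B = "frontier D" and ?S = "surface_measure :: (real^'n) measure"
  have BD: "?B \<subseteq> closure D" by (auto simp: frontier_def)
  have w: "(carleman_weight \<xi> l x)\<^sup>2 = exp (2 * l * \<xi> x)" for x
    by (simp add: carleman_weight_def power2_eq_square flip: exp_add)
  have i1: "set_integrable ?S (\<Gamma> \<inter> ?B) f"
    using \<Gamma>(1) by (intro set_integrable_frontier[OF D(2) fin f(1)]) auto
  have i0: "set_integrable ?S ?B (\<lambda>x. f x * (carleman_weight \<xi> l x)\<^sup>2)"
    unfolding w using f(1) \<xi>(1) by (intro set_integrable_frontier[OF D(2) fin] continuous_intros) auto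
  have i2: "integrable ?S (\<lambda>x. indicator ?B x * (exp (2 * l * d) * \<kappa>))"
    using fin by (intro integrable_mult_left integrable_real_indicator) auto
  have "(LINT x:?B|?S. f x * (carleman_weight \<xi> l x)\<^sup>2)
     \<le> (LINT x|?S. exp (2 * l * m) * (indicator (\<Gamma> \<inter> ?B) x *\<^sub>R f x) + indicator ?B x * (exp (2 * l * d) * \<kappa>))"
    unfolding set_lebesgue_integral_def
  proof (rule integral_mono)
    show "integrable ?S (\<lambda>x. indicator ?B x *\<^sub>R (f x * (carleman_weight \<xi> l x)\<^sup>2))"
      using i0 by (simp add: set_integrable_def)
    show "integrable ?S (\<lambda>x. exp (2 * l * m) * (indicator (\<Gamma> \<inter> ?B) x *\<^sub>R f x) + indicator ?B x * (exp (2 * l * d) * \<kappa>))"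
      using i1 i2 by (intro Bochner_Integration.integrable_add integrable_mult_right) (auto simp: set_integrable_def)
    fix x
    show "indicator ?B x *\<^sub>R (f x * (carleman_weight \<xi> l x)\<^sup>2)
      \<le> exp (2 * l * m) * (indicator (\<Gamma> \<inter> ?B) x *\<^sub>R f x) + indicator ?B x * (exp (2 * l * d) * \<kappa>)"
    proof (cases "x \<in> ?B")
      case True
      have \<kappa>: "0 \<le> \<kappa>" using f(2)[of x] f(3)[OF True] by linarith
      show ?thesis
      proof (cases "x \<in> \<Gamma>")
        case xG: True
        have "exp (2 * l * \<xi> x) \<le> exp (2 * l * m)" using \<xi>(2)[of x] True BD l by auto
        then have "f x * exp (2 * l * \<xi> x) \<le> f x * exp (2 * l * m)" by (intro mult_left_mono f(2))
        moreover have "0 \<le> exp (2 * l * d) * \<kappa>" using \<kappa> by simp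
        ultimately show ?thesis using True xG by (simp add: w mult.commute)
      next
        case False
        have "exp (2 * l * \<xi> x) \<le> exp (2 * l * d)" using \<Gamma>(2)[OF True False] l by auto
        then have "f x * exp (2 * l * \<xi> x) \<le> \<kappa> * exp (2 * l * d)" using f(2,3) True \<kappa> by (intro mult_mono) auto
        then show ?thesis using True False by (simp add: w mult.commute)
      qed
    qed simp
  qed
  also have "\<dots> = exp (2 * l * m) * (LINT x:(\<Gamma> \<inter> ?B)|?S. f x) + exp (2 * l * d) * (\<kappa> * measure ?S ?B)"
    using i1 i2 by (simp add: set_integrable_def set_lebesgue_integral_def)
  finally show ?thesis .
qed

text \<open>
  Pointwise this is \<open>norm_grad_boundary\<close>. Splitting the integral requires measurability of the data,
  which holds because they coincide on \<open>\<Gamma>\<close> with continuous functions.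
\<close>

lemma boundary_data_bound:
  fixes u p q :: "nat \<Rightarrow> real^'n \<Rightarrow> real"
  assumes \<Omega>: "open \<Omega>" and \<Gamma>: "boundary_portion 2 \<Omega> \<Gamma>" and u: "\<And>j. j < N \<Longrightarrow> Ck_closure 1 \<Omega> (u j)"
    and p: "\<And>j y. j < N \<Longrightarrow> y \<in> \<Gamma> \<Longrightarrow> p j y = u j y"
    and q: "\<And>j y. j < N \<Longrightarrow> y \<in> \<Gamma> \<Longrightarrow> q j y = normal_deriv \<Omega> (u j) y"
    and \<Gamma>b: "\<Gamma> \<in> sets borel" and \<sigma>: "\<sigma> \<ge> 0"
    and H1: "H1_surface_norm_vec N \<Omega> \<Gamma> p \<le> ennreal \<sigma>" and L2: "L2_surface_norm_vec N \<Gamma> q \<le> ennreal \<sigma>"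
  shows "(\<Sum>j<N. \<integral>\<^sup>+x\<in>\<Gamma>. ennreal ((norm (grad \<Omega> (u j) x))\<^sup>2 + (u j x)\<^sup>2) \<partial>surface_measure) \<le> ennreal (2 * \<sigma>\<^sup>2)"
proof -
  let ?S = "surface_measure :: (real^'n) measure"
  have \<Gamma>c: "\<Gamma> \<subseteq> closure \<Omega>" using boundary_portion_frontier[OF \<Gamma>] by (auto simp: frontier_def)
  have eq: "(\<integral>\<^sup>+x\<in>\<Gamma>. ennreal ((norm (grad \<Omega> (u j) x))\<^sup>2 + (u j x)\<^sup>2) \<partial>?S)
    = (\<integral>\<^sup>+x\<in>\<Gamma>. ennreal ((p j x)\<^sup>2 + (norm (surface_grad \<Omega> \<Gamma> (p j) x))\<^sup>2) \<partial>?S) + (\<integral>\<^sup>+x\<in>\<Gamma>. ennreal ((q j x)\<^sup>2) \<partial>?S)"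
    if j: "j < N" for j
  proof -
    have g: "(norm (grad \<Omega> (u j) x))\<^sup>2 = (norm (surface_grad \<Omega> \<Gamma> (p j) x))\<^sup>2 + (q j x)\<^sup>2" if "x \<in> \<Gamma>" for x
      using norm_grad_boundary[OF \<Omega> \<Gamma> u[OF j] p[OF j] that] q[OF j that] by simp
    have c1: "continuous_on \<Gamma> (u j)"
      using Ck_closure_continuous[OF u[OF j]] \<Gamma>c by (rule continuous_on_subset)
    have c2: "continuous_on \<Gamma> (grad \<Omega> (u j))"
      using continuous_on_grad[OF u[OF j]] \<Gamma>c by (rule continuous_on_subset)
    have "continuous_on \<Gamma> (\<lambda>x. outward_normal \<Omega> x \<bullet> grad \<Omega> (u j) x)"
      using continuous_on_outward_normal[OF \<Gamma>] c2 by (rule continuous_on_inner)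
    then have c3: "continuous_on \<Gamma> (normal_deriv \<Omega> (u j))"
      by (simp add: normal_deriv_def[abs_def])
    then have "continuous_on \<Gamma> (q j)"
      by (rule continuous_on_cong[THEN iffD1, OF refl, rotated]) (simp add: q[OF j])
    then have "continuous_on \<Gamma> (\<lambda>x. (q j x)\<^sup>2)" by (intro continuous_intros)
    then have "(\<lambda>x. indicator \<Gamma> x *\<^sub>R (q j x)\<^sup>2) \<in> borel_measurable borel"
      using \<Gamma>b by (intro borel_measurable_continuous_on_indicator)
    then have "(\<lambda>x. ennreal (indicator \<Gamma> x *\<^sub>R (q j x)\<^sup>2)) \<in> borel_measurable ?S"
      by (subst measurable_cong_sets[OF sets_surface_measure refl]) (intro measurable_compose[OF _ measurable_ennreal])
    then have m2: "(\<lambda>x. ennreal ((q j x)\<^sup>2) * indicator \<Gamma> x) \<in> borel_measurable ?S"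
      by (rule measurable_cong[THEN iffD1, rotated]) (auto simp: indicator_def)
    have "continuous_on \<Gamma> (\<lambda>x. (u j x)\<^sup>2 + ((norm (grad \<Omega> (u j) x))\<^sup>2 - (normal_deriv \<Omega> (u j) x)\<^sup>2))"
      using c1 c2 c3 by (intro continuous_intros)
    then have "continuous_on \<Gamma> (\<lambda>x. (p j x)\<^sup>2 + (norm (surface_grad \<Omega> \<Gamma> (p j) x))\<^sup>2)"
      by (rule continuous_on_cong[THEN iffD1, OF refl, rotated])
         (use g p[OF j] q[OF j] in simp)
    then have "(\<lambda>x. indicator \<Gamma> x *\<^sub>R ((p j x)\<^sup>2 + (norm (surface_grad \<Omega> \<Gamma> (p j) x))\<^sup>2)) \<in> borel_measurable borel"
      using \<Gamma>b by (intro borel_measurable_continuous_on_indicator)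
    then have "(\<lambda>x. ennreal (indicator \<Gamma> x *\<^sub>R ((p j x)\<^sup>2 + (norm (surface_grad \<Omega> \<Gamma> (p j) x))\<^sup>2))) \<in> borel_measurable ?S"
      by (subst measurable_cong_sets[OF sets_surface_measure refl]) (intro measurable_compose[OF _ measurable_ennreal])
    then have m1: "(\<lambda>x. ennreal ((p j x)\<^sup>2 + (norm (surface_grad \<Omega> \<Gamma> (p j) x))\<^sup>2) * indicator \<Gamma> x) \<in> borel_measurable ?S"
      by (rule measurable_cong[THEN iffD1, rotated]) (auto simp: indicator_def)
    have "(\<integral>\<^sup>+x\<in>\<Gamma>. ennreal ((norm (grad \<Omega> (u j) x))\<^sup>2 + (u j x)\<^sup>2) \<partial>?S) =
      (\<integral>\<^sup>+x. ennreal ((p j x)\<^sup>2 + (norm (surface_grad \<Omega> \<Gamma> (p j) x))\<^sup>2) * indicator \<Gamma> x + ennreal ((q j x)\<^sup>2) * indicator \<Gamma> x \<partial>?S)"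
    proof (rule nn_integral_cong)
      fix x
      show "ennreal ((norm (grad \<Omega> (u j) x))\<^sup>2 + (u j x)\<^sup>2) * indicator \<Gamma> x =
        ennreal ((p j x)\<^sup>2 + (norm (surface_grad \<Omega> \<Gamma> (p j) x))\<^sup>2) * indicator \<Gamma> x + ennreal ((q j x)\<^sup>2) * indicator \<Gamma> x"
        using g[of x] p[OF j, of x] by (cases "x \<in> \<Gamma>") (auto simp: ennreal_plus[symmetric] add_ac simp del: ennreal_plus)
    qed
    also have "\<dots> = (\<integral>\<^sup>+x\<in>\<Gamma>. ennreal ((p j x)\<^sup>2 + (norm (surface_grad \<Omega> \<Gamma> (p j) x))\<^sup>2) \<partial>?S) + (\<integral>\<^sup>+x\<in>\<Gamma>. ennreal ((q j x)\<^sup>2) \<partial>?S)"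
      by (rule nn_integral_add[OF m1 m2])
    finally show ?thesis .
  qed
  have "(\<Sum>j<N. \<integral>\<^sup>+x\<in>\<Gamma>. ennreal ((norm (grad \<Omega> (u j) x))\<^sup>2 + (u j x)\<^sup>2) \<partial>?S)
    = (\<Sum>j<N. \<integral>\<^sup>+x\<in>\<Gamma>. ennreal ((p j x)\<^sup>2 + (norm (surface_grad \<Omega> \<Gamma> (p j) x))\<^sup>2) \<partial>?S)
      + (\<Sum>j<N. \<integral>\<^sup>+x\<in>\<Gamma>. ennreal ((q j x)\<^sup>2) \<partial>?S)"
    using eq by (simp add: sum.distrib[symmetric])
  also have "\<dots> \<le> ennreal (\<sigma>\<^sup>2) + ennreal (\<sigma>\<^sup>2)"
    using H1 L2 \<sigma> unfolding H1_surface_norm_vec_def L2_surface_norm_vec_def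
    by (intro add_mono le_square_of_esqrt_le)
  also have "\<dots> = ennreal (2 * \<sigma>\<^sup>2)" by (simp add: ennreal_plus[symmetric] del: ennreal_plus)
  finally show ?thesis .
qed

section \<open>The difference of two solutions\<close>

lemma vec_diff_eq: "vec_diff V W j = (\<lambda>x. V j x - W j x)"
  by (simp add: vec_diff_def fun_eq_iff)

lemma bounded_domainD:
  assumes "bounded_domain \<Omega>"
  shows "open \<Omega>" "bounded \<Omega>" "\<Omega> \<noteq> {}"
  using assms by (auto simp: bounded_domain_def)

text \<open>
  The lower order coefficients \<open>a\<close> are hidden by the existential quantifier, since all constants have
  to be uniform in them.
\<close>

definition cauchy_solution_pair where
  "cauchy_solution_pair A\<^sub>0 N \<Omega> \<Gamma> Z K V\<^sub>1 V\<^sub>2 p0\<^sub>1 p0\<^sub>2 p1\<^sub>1 p1\<^sub>2 \<longleftrightarrow>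
     (\<exists>a. (\<forall>\<alpha>. mi_order \<alpha> = 2 \<longrightarrow> a \<alpha> = A\<^sub>0 \<alpha>) \<and>
       (\<forall>\<alpha>. mi_order \<alpha> \<le> 1 \<longrightarrow> admissible_coeff \<Omega> (a \<alpha>) \<and> Ck_norm 1 \<Omega> (a \<alpha>) \<le> Z) \<and>
       solves_cauchy_problem a N \<Omega> \<Gamma> V\<^sub>1 p0\<^sub>1 p1\<^sub>1 \<and>
       solves_cauchy_problem a N \<Omega> \<Gamma> V\<^sub>2 p0\<^sub>2 p1\<^sub>2 \<and>
       Ck_norm_vec N 1 \<Omega> V\<^sub>1 \<le> K \<and> Ck_norm_vec N 1 \<Omega> V\<^sub>2 \<le> K)"

lemma leading_coefficients_bounded:
  fixes A\<^sub>0 :: "'n::finite multiindex \<Rightarrow> real^'n \<Rightarrow> real"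
  assumes \<Omega>: "bounded \<Omega>" and A\<^sub>0: "\<forall>\<alpha>. mi_order \<alpha> = 2 \<longrightarrow> admissible_coeff \<Omega> (A\<^sub>0 \<alpha>)"
  obtains Z where "Z \<ge> 0" "\<And>\<alpha> x. mi_order \<alpha> = 2 \<Longrightarrow> x \<in> closure \<Omega> \<Longrightarrow> \<bar>A\<^sub>0 \<alpha> x\<bar> \<le> Z"
proof -
  have "\<exists>b>0. \<forall>x\<in>closure \<Omega>. \<bar>A\<^sub>0 \<alpha> x\<bar> \<le> b" if "mi_order \<alpha> = 2" for \<alpha>
  proof -
    have "continuous_on UNIV (A\<^sub>0 \<alpha>)"
      using A\<^sub>0[rule_format, OF that] Ck_closure_continuous[of 1 UNIV] by (auto simp: admissible_coeff_def)
    then have "continuous_on (closure \<Omega>) (A\<^sub>0 \<alpha>)" by (rule continuous_on_subset) simp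
    then obtain b where "b > 0" "\<And>x. x \<in> closure \<Omega> \<Longrightarrow> \<bar>A\<^sub>0 \<alpha> x\<bar> \<le> b"
      using continuous_closure_bounded[OF \<Omega>] by blast
    then show ?thesis by blast
  qed
  then obtain b where b: "\<And>\<alpha>. mi_order \<alpha> = 2 \<Longrightarrow> b \<alpha> > 0"
    "\<And>\<alpha> x. mi_order \<alpha> = 2 \<Longrightarrow> x \<in> closure \<Omega> \<Longrightarrow> \<bar>A\<^sub>0 \<alpha> x\<bar> \<le> b \<alpha>" by metis
  show thesis
  proof (rule that[of "\<Sum>\<alpha> | mi_order \<alpha> = 2. b \<alpha>"])
    show "(\<Sum>\<alpha> | mi_order \<alpha> = 2. b \<alpha>) \<ge> 0" using b(1) by (intro sum_nonneg) (auto simp: less_imp_le)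
    fix \<alpha> x assume *: "mi_order (\<alpha> :: 'n multiindex) = 2" "x \<in> closure \<Omega>"
    have "b \<alpha> \<le> (\<Sum>\<alpha> | mi_order \<alpha> = 2. b \<alpha>)"
      using *(1) b(1) by (intro member_le_sum) (auto simp: less_imp_le finite_multiindex_eq)
    then show "\<bar>A\<^sub>0 \<alpha> x\<bar> \<le> (\<Sum>\<alpha> | mi_order \<alpha> = 2. b \<alpha>)" using b(2)[OF *] by linarith
  qed
qed

text \<open>
  Subtracting the two systems turns them into a differential inequality for the difference, because
  \<open>P\<close> is Lipschitz on the set of gradients that are allowed by the bound \<open>K\<close>.
\<close>

lemma difference_inequality:
  fixes A\<^sub>0 :: "'n::finite multiindex \<Rightarrow> real^'n \<Rightarrow> real"
  assumes dom: "bounded_domain \<Omega>" and A\<^sub>0: "\<forall>\<alpha>. mi_order \<alpha> = 2 \<longrightarrow> admissible_coeff \<Omega> (A\<^sub>0 \<alpha>)"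
    and Z: "Z > 0" and K: "K > 0"
  obtains M \<kappa> where "M \<ge> 0" "\<kappa> \<ge> 0"
    "\<And>\<Gamma> V\<^sub>1 V\<^sub>2 p0\<^sub>1 p0\<^sub>2 p1\<^sub>1 p1\<^sub>2 j.
      cauchy_solution_pair A\<^sub>0 N \<Omega> \<Gamma> Z K V\<^sub>1 V\<^sub>2 p0\<^sub>1 p0\<^sub>2 p1\<^sub>1 p1\<^sub>2 \<Longrightarrow> j < N \<Longrightarrow>
      \<Gamma> \<subseteq> closure \<Omega> \<Longrightarrow>
      Ck_closure 2 \<Omega> (vec_diff V\<^sub>1 V\<^sub>2 j) \<and>
      (\<forall>x\<in>closure \<Omega>. (norm (grad \<Omega> (vec_diff V\<^sub>1 V\<^sub>2 j) x))\<^sup>2 + (vec_diff V\<^sub>1 V\<^sub>2 j x)\<^sup>2 \<le> \<kappa>) \<and>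
      (\<forall>x\<in>\<Omega>. (principal_part A\<^sub>0 \<Omega> (vec_diff V\<^sub>1 V\<^sub>2 j) x)\<^sup>2
          \<le> M * (\<Sum>k<N. (norm (grad \<Omega> (vec_diff V\<^sub>1 V\<^sub>2 k) x))\<^sup>2)) \<and>
      (\<forall>x\<in>\<Gamma>. vec_diff p0\<^sub>1 p0\<^sub>2 j x = vec_diff V\<^sub>1 V\<^sub>2 j x \<and>
          vec_diff p1\<^sub>1 p1\<^sub>2 j x = normal_deriv \<Omega> (vec_diff V\<^sub>1 V\<^sub>2 j) x)"
proof -
  note \<Omega> = bounded_domainD[OF dom]
  obtain Z2 where Z2: "Z2 \<ge> 0" "\<And>\<alpha> x. mi_order \<alpha> = 2 \<Longrightarrow> x \<in> closure \<Omega> \<Longrightarrow> \<bar>A\<^sub>0 \<alpha> x\<bar> \<le> Z2"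
    by (rule leading_coefficients_bounded[OF \<Omega>(2) A\<^sub>0]) (rule that, assumption+)
  define K' where "K' = real CARD('n) * K"
  have K': "K' \<ge> 0" using K by (simp add: K'_def)
  have ZZ: "max Z Z2 \<ge> 0" using Z by simp
  show thesis
  proof (rule P_vec_lipschitz[OF ZZ K', where N=N])
    fix L assume L: "L \<ge> 0"
    "\<And>(a :: 'n multiindex \<Rightarrow> real^'n \<Rightarrow> real) x (G :: nat \<Rightarrow> real^'n) G' m.
       (\<And>\<alpha>. 1 \<le> mi_order \<alpha> \<Longrightarrow> mi_order \<alpha> \<le> 2 \<Longrightarrow> \<bar>a \<alpha> x\<bar> \<le> max Z Z2) \<Longrightarrow>
       (\<And>k. k < N \<Longrightarrow> norm (G k) \<le> K') \<Longrightarrow> (\<And>k. k < N \<Longrightarrow> norm (G' k) \<le> K') \<Longrightarrow> m < N \<Longrightarrow>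
       \<bar>P_vec a N x G m - P_vec a N x G' m\<bar> \<le> L * (\<Sum>k<N. norm (G k - G' k))"
  define M where "M = L\<^sup>2 * real N"
  define \<kappa> where "\<kappa> = (2 * K')\<^sup>2 + (2 * K)\<^sup>2"
  show thesis
  proof (rule that[of M \<kappa>])
    show "M \<ge> 0" by (simp add: M_def)
    show "\<kappa> \<ge> 0" by (simp add: \<kappa>_def)
    fix \<Gamma> V\<^sub>1 V\<^sub>2 p0\<^sub>1 p0\<^sub>2 p1\<^sub>1 p1\<^sub>2 j
    assume pair: "cauchy_solution_pair A\<^sub>0 N \<Omega> \<Gamma> Z K V\<^sub>1 V\<^sub>2 p0\<^sub>1 p0\<^sub>2 p1\<^sub>1 p1\<^sub>2" and j: "j < N"
      and \<Gamma>: "\<Gamma> \<subseteq> closure \<Omega>"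
    obtain a where a2: "\<And>\<alpha>. mi_order \<alpha> = 2 \<Longrightarrow> a \<alpha> = A\<^sub>0 \<alpha>"
      and a1: "\<And>\<alpha>. mi_order \<alpha> \<le> 1 \<Longrightarrow> admissible_coeff \<Omega> (a \<alpha>) \<and> Ck_norm 1 \<Omega> (a \<alpha>) \<le> Z"
      and s1: "solves_cauchy_problem a N \<Omega> \<Gamma> V\<^sub>1 p0\<^sub>1 p1\<^sub>1" and s2: "solves_cauchy_problem a N \<Omega> \<Gamma> V\<^sub>2 p0\<^sub>2 p1\<^sub>2"
      and n1: "Ck_norm_vec N 1 \<Omega> V\<^sub>1 \<le> K" and n2: "Ck_norm_vec N 1 \<Omega> V\<^sub>2 \<le> K"
      using pair unfolding cauchy_solution_pair_def by blast
    have C2: "Ck_closure 2 \<Omega> (V\<^sub>1 k)" "Ck_closure 2 \<Omega> (V\<^sub>2 k)" if "k < N" for k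
      using s1 s2 that by (auto simp: solves_cauchy_problem_def)
    note C1 = C2[THEN Ck_closure_2D(1)]
    have bounds: "\<bar>V k x\<bar> \<le> K \<and> norm (grad \<Omega> (V k) x) \<le> K'"
      if "Ck_closure 1 \<Omega> (V k)" "Ck_norm_vec N 1 \<Omega> V \<le> K" "k < N" "x \<in> closure \<Omega>" for V k x
    proof -
      have n: "Ck_norm 1 \<Omega> (V k) \<le> K" by (rule Ck_norm_vec_component[OF that(2,3)])
      note b = Ck_norm_1_bounds[OF \<Omega>(2,3) that(1,4)]
      have "norm (grad \<Omega> (V k) x) \<le> real CARD('n) * K"
        using b(2) n by (intro norm_grad_le) (meson order_trans)
      then show ?thesis using b(1) n by (simp add: K'_def)
    qed
    have a_bd: "\<bar>a \<alpha> x\<bar> \<le> max Z Z2" if \<alpha>: "1 \<le> mi_order \<alpha>" "mi_order \<alpha> \<le> 2" and x: "x \<in> closure \<Omega>" for \<alpha> x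
    proof (cases "mi_order \<alpha> = 2")
      case True
      then show ?thesis using Z2(2)[OF True x] a2[OF True] by simp
    next
      case False
      then have o: "mi_order \<alpha> \<le> 1" using \<alpha> by simp
      have "Ck_closure 1 UNIV (a \<alpha>)" using a1[OF o] by (simp add: admissible_coeff_def)
      then have "Ck_closure 1 \<Omega> (a \<alpha>)" by (rule Ck_closure_subset[OF \<Omega>(1) subset_UNIV open_UNIV])
      then have "\<bar>a \<alpha> x\<bar> \<le> Ck_norm 1 \<Omega> (a \<alpha>)" by (rule Ck_norm_1_bounds(1)[OF \<Omega>(2,3) _ x])
      then show ?thesis using conjunct2[OF a1[OF o]] by linarith
    qed
    have gd: "grad \<Omega> (vec_diff V\<^sub>1 V\<^sub>2 k) x = grad \<Omega> (V\<^sub>1 k) x - grad \<Omega> (V\<^sub>2 k) x"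
      if "k < N" "x \<in> closure \<Omega>" for k x
      unfolding vec_diff_eq by (rule grad_diff[OF \<Omega>(1) C1[OF that(1)] that(2)])
    have 1: "Ck_closure 2 \<Omega> (vec_diff V\<^sub>1 V\<^sub>2 j)"
      unfolding vec_diff_eq by (rule Ck_closure_diff[OF \<Omega>(1) C2[OF j]])
    have 2: "(norm (grad \<Omega> (vec_diff V\<^sub>1 V\<^sub>2 j) x))\<^sup>2 + (vec_diff V\<^sub>1 V\<^sub>2 j x)\<^sup>2 \<le> \<kappa>" if x: "x \<in> closure \<Omega>" for x
    proof -
      note b = bounds[OF C1(1)[OF j] n1 j x] bounds[OF C1(2)[OF j] n2 j x]
      have "norm (grad \<Omega> (vec_diff V\<^sub>1 V\<^sub>2 j) x) \<le> 2 * K'"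
        unfolding gd[OF j x] using b norm_triangle_ineq4[of "grad \<Omega> (V\<^sub>1 j) x" "grad \<Omega> (V\<^sub>2 j) x"] by linarith
      then have g: "(norm (grad \<Omega> (vec_diff V\<^sub>1 V\<^sub>2 j) x))\<^sup>2 \<le> (2 * K')\<^sup>2" by (intro power_mono) auto
      have "\<bar>vec_diff V\<^sub>1 V\<^sub>2 j x\<bar> \<le> 2 * K" unfolding vec_diff_eq using b by linarith
      then have "\<bar>vec_diff V\<^sub>1 V\<^sub>2 j x\<bar>\<^sup>2 \<le> (2 * K)\<^sup>2" by (intro power_mono) auto
      then show ?thesis using g by (simp add: \<kappa>_def)
    qed
    have 3: "(principal_part A\<^sub>0 \<Omega> (vec_diff V\<^sub>1 V\<^sub>2 j) x)\<^sup>2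
          \<le> M * (\<Sum>k<N. (norm (grad \<Omega> (vec_diff V\<^sub>1 V\<^sub>2 k) x))\<^sup>2)" if x: "x \<in> \<Omega>" for x
    proof -
      have xc: "x \<in> closure \<Omega>" using x closure_subset by blast
      have "principal_part A\<^sub>0 \<Omega> (vec_diff V\<^sub>1 V\<^sub>2 j) x = principal_part a \<Omega> (vec_diff V\<^sub>1 V\<^sub>2 j) x"
        using a2 by (intro principal_part_coeff_cong) simp
      also have "\<dots> = principal_part a \<Omega> (V\<^sub>1 j) x - principal_part a \<Omega> (V\<^sub>2 j) x"
        unfolding vec_diff_eq by (rule principal_part_diff[OF \<Omega>(1) C2[OF j] x])
      also have "\<dots> = P_vec a N x (\<lambda>k. grad \<Omega> (V\<^sub>1 k) x) j - P_vec a N x (\<lambda>k. grad \<Omega> (V\<^sub>2 k) x) j"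
        using s1 s2 j x by (auto simp: solves_cauchy_problem_def)
      finally have eq: "\<bar>principal_part A\<^sub>0 \<Omega> (vec_diff V\<^sub>1 V\<^sub>2 j) x\<bar>
          = \<bar>P_vec a N x (\<lambda>k. grad \<Omega> (V\<^sub>1 k) x) j - P_vec a N x (\<lambda>k. grad \<Omega> (V\<^sub>2 k) x) j\<bar>" by simp
      also have "\<dots> \<le> L * (\<Sum>k<N. norm (grad \<Omega> (V\<^sub>1 k) x - grad \<Omega> (V\<^sub>2 k) x))"
        by (rule L(2)) (use a_bd[OF _ _ xc] bounds[OF C1(1) n1 _ xc] bounds[OF C1(2) n2 _ xc] j in auto)
      also have "\<dots> = L * (\<Sum>k<N. norm (grad \<Omega> (vec_diff V\<^sub>1 V\<^sub>2 k) x))"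
        using gd[OF _ xc] by simp
      finally have "\<bar>principal_part A\<^sub>0 \<Omega> (vec_diff V\<^sub>1 V\<^sub>2 j) x\<bar>\<^sup>2 \<le> (L * (\<Sum>k<N. norm (grad \<Omega> (vec_diff V\<^sub>1 V\<^sub>2 k) x)))\<^sup>2"
        by (intro power_mono) auto
      also have "\<dots> = L\<^sup>2 * (\<Sum>k<N. norm (grad \<Omega> (vec_diff V\<^sub>1 V\<^sub>2 k) x))\<^sup>2" by (simp add: power_mult_distrib)
      also have "\<dots> \<le> L\<^sup>2 * (real N * (\<Sum>k<N. (norm (grad \<Omega> (vec_diff V\<^sub>1 V\<^sub>2 k) x))\<^sup>2))"
        using Cauchy_Schwarz_ineq_sum[of "\<lambda>_. 1" "\<lambda>k. norm (grad \<Omega> (vec_diff V\<^sub>1 V\<^sub>2 k) x)" "{..<N}"]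
        by (intro mult_left_mono) auto
      finally show ?thesis by (simp add: M_def mult.assoc)
    qed
    have 4: "vec_diff p0\<^sub>1 p0\<^sub>2 j x = vec_diff V\<^sub>1 V\<^sub>2 j x \<and>
          vec_diff p1\<^sub>1 p1\<^sub>2 j x = normal_deriv \<Omega> (vec_diff V\<^sub>1 V\<^sub>2 j) x" if x: "x \<in> \<Gamma>" for x
    proof -
      have xc: "x \<in> closure \<Omega>" using x \<Gamma> by blast
      show ?thesis
        using s1 s2 j x by (simp add: solves_cauchy_problem_def vec_diff_def normal_deriv_def gd[OF j xc] inner_diff_right)
    qed
    show "Ck_closure 2 \<Omega> (vec_diff V\<^sub>1 V\<^sub>2 j) \<and>
      (\<forall>x\<in>closure \<Omega>. (norm (grad \<Omega> (vec_diff V\<^sub>1 V\<^sub>2 j) x))\<^sup>2 + (vec_diff V\<^sub>1 V\<^sub>2 j x)\<^sup>2 \<le> \<kappa>) \<and>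
      (\<forall>x\<in>\<Omega>. (principal_part A\<^sub>0 \<Omega> (vec_diff V\<^sub>1 V\<^sub>2 j) x)\<^sup>2
          \<le> M * (\<Sum>k<N. (norm (grad \<Omega> (vec_diff V\<^sub>1 V\<^sub>2 k) x))\<^sup>2)) \<and>
      (\<forall>x\<in>\<Gamma>. vec_diff p0\<^sub>1 p0\<^sub>2 j x = vec_diff V\<^sub>1 V\<^sub>2 j x \<and>
          vec_diff p1\<^sub>1 p1\<^sub>2 j x = normal_deriv \<Omega> (vec_diff V\<^sub>1 V\<^sub>2 j) x)"
      using 1 2 3 4 by blast
  qed
  qed
qed

lemma open_superlevel:
  assumes "open \<Omega>" "continuous_on (closure \<Omega>) \<xi>"
  shows "open (superlevel \<Omega> \<xi> d)"
proof -
  have "continuous_on \<Omega> \<xi>" using assms(2) closure_subset by (rule continuous_on_subset)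
  then have "open (\<xi> -` {d<..} \<inter> \<Omega>)"
    using assms(1) by (intro continuous_on_open_vimage[THEN iffD1, rule_format]) auto
  moreover have "\<xi> -` {d<..} \<inter> \<Omega> = superlevel \<Omega> \<xi> d" by (auto simp: superlevel_def)
  ultimately show ?thesis by simp
qed

text \<open>
  Choosing \<open>l\<close> large absorbs the right-hand side of the differential inequality into the left-hand
  side of the Carleman estimate; only the boundary terms remain.
\<close>

lemma weighted_stability_estimate:
  fixes \<Omega> \<Gamma> :: "(real^'n) set" and A\<^sub>0 :: "'n multiindex \<Rightarrow> real^'n \<Rightarrow> real" and \<xi> :: "real^'n \<Rightarrow> real"
  defines "w \<equiv> \<lambda>l x. (carleman_weight \<xi> l x)\<^sup>2"
  assumes dom: "bounded_domain \<Omega>" and A\<^sub>0: "\<forall>\<alpha>. mi_order \<alpha> = 2 \<longrightarrow> admissible_coeff \<Omega> (A\<^sub>0 \<alpha>)"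
    and \<Gamma>: "boundary_portion 2 \<Omega> \<Gamma>" and \<xi>: "continuous_on (closure \<Omega>) \<xi>"
    and D_def: "D = superlevel \<Omega> \<xi> d"
    and side: "superlevel (closure D \<inter> frontier \<Omega>) \<xi> d = superlevel \<Gamma> \<xi> d"
    and bd: "frontier D = closure (level_set \<Omega> \<xi> d) \<union> closure (superlevel \<Gamma> \<xi> d)"
    and fin: "emeasure surface_measure (frontier D) < \<infinity>"
    and m: "\<And>x. x \<in> closure D \<Longrightarrow> \<xi> x \<le> m"
    and carl: "carleman_estimate A\<^sub>0 D \<xi>" and Z: "Z > 0" and K: "K > 0"
  obtains l1 C where "l1 > 1" "C > 0"
    "\<And>V\<^sub>1 V\<^sub>2 p0\<^sub>1 p0\<^sub>2 p1\<^sub>1 p1\<^sub>2 \<sigma> l.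
      cauchy_solution_pair A\<^sub>0 N \<Omega> \<Gamma> Z K V\<^sub>1 V\<^sub>2 p0\<^sub>1 p0\<^sub>2 p1\<^sub>1 p1\<^sub>2 \<Longrightarrow> 0 \<le> \<sigma> \<Longrightarrow>
      H1_surface_norm_vec N \<Omega> \<Gamma> (vec_diff p0\<^sub>1 p0\<^sub>2) \<le> ennreal \<sigma> \<Longrightarrow>
      L2_surface_norm_vec N \<Gamma> (vec_diff p1\<^sub>1 p1\<^sub>2) \<le> ennreal \<sigma> \<Longrightarrow> l1 \<le> l \<Longrightarrow>
      (\<Sum>j<N. LINT x:D|lborel. ((norm (grad D (vec_diff V\<^sub>1 V\<^sub>2 j) x))\<^sup>2 + (vec_diff V\<^sub>1 V\<^sub>2 j x)\<^sup>2) * w l x)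
        \<le> C * l\<^sup>2 * (exp (2 * l * m) * \<sigma>\<^sup>2 + exp (2 * l * d))"
proof -
  let ?S = "surface_measure :: (real^'n) measure" and ?B = "frontier D"
  note \<Omega> = bounded_domainD[OF dom]
  have D_sub: "D \<subseteq> \<Omega>" by (auto simp: D_def superlevel_def)
  have D: "open D" "bounded D"
    using open_superlevel[OF \<Omega>(1) \<xi>] bounded_subset[OF \<Omega>(2) D_sub] by (auto simp: D_def)
  have Dc: "closure D \<subseteq> closure \<Omega>" using D_sub by (rule closure_mono)
  have \<xi>D: "continuous_on (closure D) \<xi>" using \<xi> Dc by (rule continuous_on_subset)
  have BD: "?B \<subseteq> closure D" by (auto simp: frontier_def)
  have \<Gamma>f: "\<Gamma> \<subseteq> frontier \<Omega>" by (rule boundary_portion_frontier[OF \<Gamma>])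
  then have \<Gamma>c: "\<Gamma> \<subseteq> closure \<Omega>" by (auto simp: frontier_def)
  obtain T where "open T" "\<Gamma> = frontier \<Omega> \<inter> T" using \<Gamma> unfolding boundary_portion_def openin_open by blast
  then have \<Gamma>b: "\<Gamma> \<in> sets borel" by auto
  have off\<Gamma>: "\<xi> x \<le> d" if x: "x \<in> ?B" "x \<notin> \<Gamma>" for x
  proof (rule ccontr)
    assume gt: "\<not> \<xi> x \<le> d"
    have "x \<notin> closure (level_set \<Omega> \<xi> d)"
    proof
      assume x': "x \<in> closure (level_set \<Omega> \<xi> d)"
      have sub: "level_set \<Omega> \<xi> d \<subseteq> \<Omega>" by (auto simp: level_set_def)
      have "\<xi> x = d"
        by (rule continuous_constant_on_closure[OF continuous_on_subset[OF \<xi> closure_mono[OF sub]] _ x'])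
           (simp add: level_set_def)
      then show False using gt by simp
    qed
    then have "x \<in> closure (superlevel \<Gamma> \<xi> d)" using x(1) bd by blast
    moreover have "closure (superlevel \<Gamma> \<xi> d) \<subseteq> frontier \<Omega>"
      using \<Gamma>f by (intro closure_minimal) (auto simp: superlevel_def)
    ultimately have "x \<in> superlevel (closure D \<inter> frontier \<Omega>) \<xi> d"
      using x(1) BD gt by (auto simp: superlevel_def)
    then show False using side x(2) by (auto simp: superlevel_def)
  qed
  obtain M \<kappa> where M\<kappa>: "M \<ge> 0" "\<kappa> \<ge> 0" and diff:
    "\<And>\<Gamma> V\<^sub>1 V\<^sub>2 p0\<^sub>1 p0\<^sub>2 p1\<^sub>1 p1\<^sub>2 j.
      cauchy_solution_pair A\<^sub>0 N \<Omega> \<Gamma> Z K V\<^sub>1 V\<^sub>2 p0\<^sub>1 p0\<^sub>2 p1\<^sub>1 p1\<^sub>2 \<Longrightarrow> j < N \<Longrightarrow>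
      \<Gamma> \<subseteq> closure \<Omega> \<Longrightarrow>
      Ck_closure 2 \<Omega> (vec_diff V\<^sub>1 V\<^sub>2 j) \<and>
      (\<forall>x\<in>closure \<Omega>. (norm (grad \<Omega> (vec_diff V\<^sub>1 V\<^sub>2 j) x))\<^sup>2 + (vec_diff V\<^sub>1 V\<^sub>2 j x)\<^sup>2 \<le> \<kappa>) \<and>
      (\<forall>x\<in>\<Omega>. (principal_part A\<^sub>0 \<Omega> (vec_diff V\<^sub>1 V\<^sub>2 j) x)\<^sup>2
          \<le> M * (\<Sum>k<N. (norm (grad \<Omega> (vec_diff V\<^sub>1 V\<^sub>2 k) x))\<^sup>2)) \<and>
      (\<forall>x\<in>\<Gamma>. vec_diff p0\<^sub>1 p0\<^sub>2 j x = vec_diff V\<^sub>1 V\<^sub>2 j x \<and>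
          vec_diff p1\<^sub>1 p1\<^sub>2 j x = normal_deriv \<Omega> (vec_diff V\<^sub>1 V\<^sub>2 j) x)"
    by (rule difference_inequality[OF dom A\<^sub>0 Z K, where N=N]) (rule that, assumption+)
  obtain l0 C1 where l0: "l0 > 1" and C1: "C1 > 0" and carl':
    "\<And>l u. l \<ge> l0 \<Longrightarrow> Ck_closure 2 D u \<Longrightarrow>
        (\<exists>U. (\<forall>i. Ck_closure 1 D (\<lambda>y. U y $ i)) \<and>
           (\<forall>x\<in>closure D.
              (principal_part A\<^sub>0 D u x)\<^sup>2 * (carleman_weight \<xi> l x)\<^sup>2
                \<ge> C1 * l * (norm (grad D u x))\<^sup>2 * (carleman_weight \<xi> l x)\<^sup>2
                  + C1 * l ^ 3 * (u x)\<^sup>2 * (carleman_weight \<xi> l x)\<^sup>2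
                  + divergence D U x \<and>
              norm (U x)
                \<le> C1 * l ^ 3 * ((norm (grad D u x))\<^sup>2 + (u x)\<^sup>2) * (carleman_weight \<xi> l x)\<^sup>2))"
    using carl unfolding carleman_estimate_def by blast
  define B where "B = real CARD('n) * boundary_const CARD('n)"
  have B: "B > 0" using boundary_const_pos[of "CARD('n)"] by (simp add: B_def)
  define hB where "hB = measure ?S ?B"
  have hB: "hB \<ge> 0" by (simp add: hB_def)
  define C where "C = 2 * B * (2 + real N * \<kappa> * hB)"
  \<comment> \<open>beyond \<open>2 N M / C1\<close> the gradient terms on the right are at most half of those on the left\<close>
  define l1 where "l1 = max l0 (2 * (real N * M) / C1)"
  show thesis
  proof (rule that[of l1 C])
    show "l1 > 1" using l0 by (simp add: l1_def)
    have NkB: "0 \<le> real N * \<kappa> * hB" using M\<kappa> hB by simp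
    show "C > 0" unfolding C_def using B NkB by (intro mult_pos_pos) auto
    fix V\<^sub>1 V\<^sub>2 p0\<^sub>1 p0\<^sub>2 p1\<^sub>1 p1\<^sub>2 \<sigma> l
    assume pair: "cauchy_solution_pair A\<^sub>0 N \<Omega> \<Gamma> Z K V\<^sub>1 V\<^sub>2 p0\<^sub>1 p0\<^sub>2 p1\<^sub>1 p1\<^sub>2" and \<sigma>: "0 \<le> \<sigma>"
      and H1: "H1_surface_norm_vec N \<Omega> \<Gamma> (vec_diff p0\<^sub>1 p0\<^sub>2) \<le> ennreal \<sigma>"
      and L2: "L2_surface_norm_vec N \<Gamma> (vec_diff p1\<^sub>1 p1\<^sub>2) \<le> ennreal \<sigma>" and l: "l1 \<le> l"
    define u where "u = vec_diff V\<^sub>1 V\<^sub>2"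
    have ll0: "l \<ge> l0" and l_pos: "l > 1" using l l0 by (auto simp: l1_def)
    have NM: "real N * M \<le> C1 * l / 2" using l C1 by (auto simp: l1_def field_simps)
    note dj = diff[OF pair _ \<Gamma>c, folded u_def]
    have u2: "Ck_closure 2 \<Omega> (u j)" if "j < N" for j using dj[OF that] by blast
    have u2D: "Ck_closure 2 D (u j)" if "j < N" for j
      using u2[OF that] by (rule Ck_closure_subset[OF D(1) D_sub \<Omega>(1)])
    have gradD: "grad D (u j) x = grad \<Omega> (u j) x" if "j < N" "x \<in> closure D" for j x
      using that by (intro grad_subset D D_sub \<Omega> Ck_closure_2D(1)[OF u2])
    define f where "f j x = (norm (grad D (u j) x))\<^sup>2 + (u j x)\<^sup>2" for j x
    have f0: "f j x \<ge> 0" for j x by (simp add: f_def)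
    have wc: "continuous_on (closure D) (w l)"
      unfolding w_def carleman_weight_def using \<xi>D by (intro continuous_intros)
    have gc: "continuous_on (closure D) (grad D (u j))" if "j < N" for j
      using Ck_closure_2D(1)[OF u2D[OF that]] by (rule continuous_on_grad)
    have uc: "continuous_on (closure D) (u j)" if "j < N" for j
      using u2D[OF that] by (rule Ck_closure_continuous)
    have fc: "continuous_on (closure D) (f j)" if "j < N" for j
      unfolding f_def using gc[OF that] uc[OF that] by (intro continuous_intros)
    have Jint: "set_integrable lborel D (\<lambda>x. (norm (grad D (u j) x))\<^sup>2 * w l x)" if "j < N" for j
      using gc[OF that] wc by (intro set_integrable_continuous_closure[OF D] continuous_intros)
    have Eint: "set_integrable lborel D (\<lambda>x. (u j x)\<^sup>2 * w l x)" if "j < N" for j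
      using uc[OF that] wc by (intro set_integrable_continuous_closure[OF D] continuous_intros)
    define J where "J j = (LINT x:D|lborel. (norm (grad D (u j) x))\<^sup>2 * w l x)" for j
    define E where "E j = (LINT x:D|lborel. (u j x)\<^sup>2 * w l x)" for j
    define I where "I j = (LINT x:?B|?S. f j x * w l x)" for j
    have E0: "E j \<ge> 0" for j
      unfolding E_def set_lebesgue_integral_def by (intro integral_nonneg_AE) (auto simp: w_def)
    have ineq: "C1 * l * J j + C1 * l ^ 3 * E j \<le> M * (\<Sum>k<N. J k) + B * (C1 * l ^ 3) * I j" if j: "j < N" for j
    proof -
      from carl'[OF ll0 u2D[OF j]] obtain U where U: "\<And>i. Ck_closure 1 D (\<lambda>y. U y $ i)"
        and U1: "\<And>x. x \<in> closure D \<Longrightarrow> (principal_part A\<^sub>0 D (u j) x)\<^sup>2 * (carleman_weight \<xi> l x)\<^sup>2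
                \<ge> C1 * l * (norm (grad D (u j) x))\<^sup>2 * (carleman_weight \<xi> l x)\<^sup>2
                  + C1 * l ^ 3 * (u j x)\<^sup>2 * (carleman_weight \<xi> l x)\<^sup>2
                  + divergence D U x"
        and U2: "\<And>x. x \<in> closure D \<Longrightarrow> norm (U x)
                \<le> C1 * l ^ 3 * ((norm (grad D (u j) x))\<^sup>2 + (u j x)\<^sup>2) * (carleman_weight \<xi> l x)\<^sup>2"
        by blast
      define Q where "Q x = M * (\<Sum>k<N. (norm (grad D (u k) x))\<^sup>2)" for x
      have Qc: "continuous_on (closure D) Q"
        unfolding Q_def using gc by (intro continuous_intros) auto
      have Qle: "(principal_part A\<^sub>0 D (u j) x)\<^sup>2 \<le> Q x" if x: "x \<in> D" for x
      proof -
        have x': "x \<in> \<Omega>" "x \<in> closure D" using x D_sub closure_subset by blast+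
        have "(principal_part A\<^sub>0 \<Omega> (u j) x)\<^sup>2 \<le> M * (\<Sum>k<N. (norm (grad \<Omega> (u k) x))\<^sup>2)"
          using dj[OF j] x' by blast
        then show ?thesis
          unfolding Q_def principal_part_subset[OF D(1) D_sub \<Omega>(1) u2[OF j] x]
          using gradD[OF _ x'(2)] by simp
      qed
      have Qint: "(LINT x:D|lborel. Q x * w l x) = M * (\<Sum>k<N. J k)"
      proof -
        have "(LINT x:D|lborel. Q x * w l x)
          = (LINT x|lborel. (\<Sum>k<N. M * (indicator D x *\<^sub>R ((norm (grad D (u k) x))\<^sup>2 * w l x))))"
          by (simp add: set_lebesgue_integral_def Q_def sum_distrib_left sum_distrib_right mult_ac)
        also have "\<dots> = (\<Sum>k<N. (LINT x|lborel. M * (indicator D x *\<^sub>R ((norm (grad D (u k) x))\<^sup>2 * w l x))))"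
          using Jint by (intro Bochner_Integration.integral_sum integrable_mult_right) (auto simp: set_integrable_def)
        also have "\<dots> = M * (\<Sum>k<N. J k)"
          by (simp add: J_def set_lebesgue_integral_def sum_distrib_left)
        finally show ?thesis .
      qed
      have "C1 * l * (LINT x:D|lborel. (norm (grad D (u j) x))\<^sup>2 * (carleman_weight \<xi> l x)\<^sup>2)
          + C1 * l ^ 3 * (LINT x:D|lborel. (u j x)\<^sup>2 * (carleman_weight \<xi> l x)\<^sup>2)
        \<le> (LINT x:D|lborel. Q x * (carleman_weight \<xi> l x)\<^sup>2)
          + real CARD('n) * boundary_const CARD('n) * (C1 * l ^ 3) *
            (LINT x:?B|?S. ((norm (grad D (u j) x))\<^sup>2 + (u j x)\<^sup>2) * (carleman_weight \<xi> l x)\<^sup>2)"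
        by (rule carleman_integrated[OF D fin \<xi>D u2D[OF j] Qc Qle U U1 U2])
      then show ?thesis
        unfolding Qint[unfolded w_def] by (simp only: J_def[of j] E_def[of j] I_def[of j] f_def w_def B_def)
    qed
    define SJ where "SJ = (\<Sum>j<N. J j)"
    define SE where "SE = (\<Sum>j<N. E j)"
    define SI where "SI = (\<Sum>j<N. I j)"
    have J0: "J j \<ge> 0" for j
      unfolding J_def set_lebesgue_integral_def by (intro integral_nonneg_AE) (auto simp: w_def)
    have SJ0: "SJ \<ge> 0" and SE0: "SE \<ge> 0" using J0 E0 by (auto simp: SJ_def SE_def intro: sum_nonneg)
    have "(\<Sum>j<N. C1 * l * J j + C1 * l ^ 3 * E j) \<le> (\<Sum>j<N. M * SJ + B * (C1 * l ^ 3) * I j)"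
      unfolding SJ_def by (intro sum_mono ineq) auto
    then have "C1 * l * SJ + C1 * l ^ 3 * SE \<le> real N * M * SJ + B * (C1 * l ^ 3) * SI"
      by (simp add: sum.distrib sum_distrib_left[symmetric] SJ_def SE_def SI_def)
    moreover have "real N * M * SJ \<le> C1 * l / 2 * SJ" using NM SJ0 by (intro mult_right_mono)
    ultimately have 1: "C1 * l / 2 * SJ + C1 * l ^ 3 * SE \<le> B * (C1 * l ^ 3) * SI" by (simp add: field_simps)
    have l3: "l / 2 \<le> l ^ 3"
    proof -
      have "l * 1 \<le> l * l\<^sup>2" using l_pos by (intro mult_left_mono) (auto simp: one_le_power)
      then show ?thesis using l_pos by (simp add: power3_eq_cube power2_eq_square)
    qed
    have "C1 * (l / 2) * SE \<le> C1 * l ^ 3 * SE"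
      using l3 C1 SE0 by (intro mult_right_mono mult_left_mono) auto
    with 1 have "C1 * l / 2 * (SJ + SE) \<le> C1 * l / 2 * (2 * B * l\<^sup>2 * SI)"
      by (simp add: algebra_simps power3_eq_cube power2_eq_square)
    then have main: "SJ + SE \<le> 2 * B * l\<^sup>2 * SI"
      using C1 l_pos by (subst (asm) mult_le_cancel_left_pos) auto
    define G where "G j = (LINT x:(\<Gamma> \<inter> ?B)|?S. f j x)" for j
    have Ij: "I j \<le> exp (2 * l * m) * G j + exp (2 * l * d) * (\<kappa> * hB)" if j: "j < N" for j
      unfolding I_def G_def hB_def w_def
    proof (rule weighted_boundary_integral_le[OF D fin \<xi>D m \<Gamma>b off\<Gamma> fc[OF j] f0])
      show "f j x \<le> \<kappa>" if "x \<in> ?B" for x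
      proof -
        have "x \<in> closure D" "x \<in> closure \<Omega>" using that BD Dc by auto
        then show ?thesis using dj[OF j] by (simp add: f_def gradD[OF j])
      qed
    qed (use l_pos in auto)
    have Gsum: "(\<Sum>j<N. G j) \<le> 2 * \<sigma>\<^sup>2"
    proof -
      have G0: "G j \<ge> 0" for j
        unfolding G_def set_lebesgue_integral_def by (intro integral_nonneg_AE) (auto simp: f0)
      have "ennreal (\<Sum>j<N. G j) = (\<Sum>j<N. ennreal (G j))" using G0 by (simp add: sum_ennreal)
      also have "\<dots> \<le> (\<Sum>j<N. \<integral>\<^sup>+x\<in>\<Gamma>. ennreal ((norm (grad \<Omega> (u j) x))\<^sup>2 + (u j x)\<^sup>2) \<partial>?S)"
      proof (rule sum_mono)
        fix j assume "j \<in> {..<N}"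
        then have j: "j < N" by simp
        have "integrable ?S (\<lambda>x. indicator (\<Gamma> \<inter> ?B) x *\<^sub>R f j x)"
          using set_integrable_frontier[OF D(2) fin fc[OF j], of "\<Gamma> \<inter> ?B"] \<Gamma>b by (auto simp: set_integrable_def)
        then have "ennreal (G j) = (\<integral>\<^sup>+x. ennreal (indicator (\<Gamma> \<inter> ?B) x *\<^sub>R f j x) \<partial>?S)"
          unfolding G_def set_lebesgue_integral_def by (intro nn_integral_eq_integral[symmetric]) (auto simp: f0)
        also have "\<dots> \<le> (\<integral>\<^sup>+x\<in>\<Gamma>. ennreal ((norm (grad \<Omega> (u j) x))\<^sup>2 + (u j x)\<^sup>2) \<partial>?S)"
        proof (rule nn_integral_mono)
          fix x
          show "ennreal (indicator (\<Gamma> \<inter> ?B) x *\<^sub>R f j x) \<le> ennreal ((norm (grad \<Omega> (u j) x))\<^sup>2 + (u j x)\<^sup>2) * indicator \<Gamma> x"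
          proof (cases "x \<in> \<Gamma> \<inter> ?B")
            case True
            then have "grad D (u j) x = grad \<Omega> (u j) x" using BD by (intro gradD[OF j]) auto
            then show ?thesis using True by (simp add: f_def)
          qed simp
        qed
        finally show "ennreal (G j) \<le> (\<integral>\<^sup>+x\<in>\<Gamma>. ennreal ((norm (grad \<Omega> (u j) x))\<^sup>2 + (u j x)\<^sup>2) \<partial>?S)" .
      qed
      also have "\<dots> \<le> ennreal (2 * \<sigma>\<^sup>2)"
        using dj Ck_closure_2D(1)[OF u2]
        by (intro boundary_data_bound[OF \<Omega>(1) \<Gamma> _ _ _ \<Gamma>b \<sigma> H1 L2]) blast+
      finally show ?thesis by (simp add: sum_nonneg G0)
    qed
    have "SI \<le> (\<Sum>j<N. exp (2 * l * m) * G j + exp (2 * l * d) * (\<kappa> * hB))"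
      unfolding SI_def by (intro sum_mono Ij) auto
    also have "\<dots> = exp (2 * l * m) * (\<Sum>j<N. G j) + exp (2 * l * d) * (real N * \<kappa> * hB)"
      by (simp add: sum.distrib sum_distrib_left)
    also have "\<dots> \<le> exp (2 * l * m) * (2 * \<sigma>\<^sup>2) + exp (2 * l * d) * (real N * \<kappa> * hB)"
      using Gsum by simp
    also have "\<dots> \<le> (2 + real N * \<kappa> * hB) * (exp (2 * l * m) * \<sigma>\<^sup>2 + exp (2 * l * d))"
    proof -
      have "0 \<le> (real N * \<kappa> * hB) * (exp (2 * l * m) * \<sigma>\<^sup>2)" using NkB by simp
      moreover have "0 \<le> 2 * exp (2 * l * d)" by simp
      ultimately show ?thesis by (simp add: algebra_simps)
    qed
    finally have "2 * B * l\<^sup>2 * SI \<le> 2 * B * l\<^sup>2 * ((2 + real N * \<kappa> * hB) * (exp (2 * l * m) * \<sigma>\<^sup>2 + exp (2 * l * d)))"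
      using B by (intro mult_left_mono) auto
    also have "\<dots> = C * l\<^sup>2 * (exp (2 * l * m) * \<sigma>\<^sup>2 + exp (2 * l * d))"
      by (simp add: C_def mult_ac)
    finally have fin': "SJ + SE \<le> C * l\<^sup>2 * (exp (2 * l * m) * \<sigma>\<^sup>2 + exp (2 * l * d))" using main by linarith
    have "(\<Sum>j<N. LINT x:D|lborel. f j x * w l x) = (\<Sum>j<N. J j + E j)"
      unfolding J_def E_def f_def using Jint Eint
      by (intro sum.cong) (auto simp: distrib_right set_integral_add)
    also have "\<dots> = SJ + SE" by (simp add: sum.distrib SJ_def SE_def)
    finally show "(\<Sum>j<N. LINT x:D|lborel. ((norm (grad D (vec_diff V\<^sub>1 V\<^sub>2 j) x))\<^sup>2 + (vec_diff V\<^sub>1 V\<^sub>2 j x)\<^sup>2) * w l x)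
        \<le> C * l\<^sup>2 * (exp (2 * l * m) * \<sigma>\<^sup>2 + exp (2 * l * d))"
      using fin' by (simp add: f_def u_def)
  qed
qed

section \<open>Stability and uniqueness\<close>

lemma part_deriv_zero:
  fixes x :: "real^'n"
  assumes "open S" "x \<in> closure S"
  shows "part_deriv S i (\<lambda>_. 0) x = 0"
proof -
  have 0: "frechet_derivative (\<lambda>_ :: real^'n. 0 :: real) (at y) = (\<lambda>_. 0)" for y
    by (rule frechet_derivative_at[symmetric]) (rule has_derivative_const)
  show ?thesis
  proof (cases "x \<in> S")
    case True
    then show ?thesis by (simp add: part_deriv_def 0)
  next
    case False
    then show ?thesis using assms by (intro part_deriv_boundary_eq) (auto simp: 0)
  qed
qed

lemma Ck_closure_1_zero:
  assumes "open (S :: (real^'n) set)"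
  shows "Ck_closure 1 S (\<lambda>_. 0)"
proof -
  have "continuous_on (closure S) (part_deriv S i (\<lambda>_. 0))" for i
    by (rule continuous_on_cong[THEN iffD1, OF refl, rotated, OF continuous_on_const[of _ 0]])
       (simp add: part_deriv_zero[OF assms])
  then show ?thesis by (simp add: Ck_closure_1_iff del: One_nat_def)
qed

lemma surface_norms_zero:
  fixes \<Gamma> :: "(real^'n) set"
  assumes \<Omega>: "open \<Omega>" and \<Gamma>: "boundary_portion 2 \<Omega> \<Gamma>"
    and p: "\<And>j x. j < N \<Longrightarrow> x \<in> \<Gamma> \<Longrightarrow> p j x = 0" and q: "\<And>j x. j < N \<Longrightarrow> x \<in> \<Gamma> \<Longrightarrow> q j x = 0"
  shows "H1_surface_norm_vec N \<Omega> \<Gamma> p = 0" "L2_surface_norm_vec N \<Gamma> q = 0"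
proof -
  have \<Gamma>c: "\<Gamma> \<subseteq> closure \<Omega>" using boundary_portion_frontier[OF \<Gamma>] by (auto simp: frontier_def)
  have sg: "surface_grad \<Omega> \<Gamma> (p j) x = 0" if "j < N" "x \<in> \<Gamma>" for j x
  proof -
    have "grad \<Omega> (\<lambda>_. 0) x = 0"
      using part_deriv_zero[OF \<Omega>, of x] that(2) \<Gamma>c by (auto simp: grad_def vec_eq_iff)
    then show ?thesis
      using surface_grad_eq[OF \<Omega> \<Gamma> Ck_closure_1_zero[OF \<Omega>] p[OF that(1)] that(2)] by simp
  qed
  have "(\<integral>\<^sup>+x\<in>\<Gamma>. ennreal ((p j x)\<^sup>2 + (norm (surface_grad \<Omega> \<Gamma> (p j) x))\<^sup>2) \<partial>surface_measure) = 0"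
    if "j < N" for j
  proof -
    have "(\<integral>\<^sup>+x\<in>\<Gamma>. ennreal ((p j x)\<^sup>2 + (norm (surface_grad \<Omega> \<Gamma> (p j) x))\<^sup>2) \<partial>surface_measure)
      = (\<integral>\<^sup>+x. 0 \<partial>(surface_measure :: (real^'n) measure))"
      using sg[OF that] p[OF that] by (intro nn_integral_cong) (auto simp: indicator_def)
    then show ?thesis by simp
  qed
  then show "H1_surface_norm_vec N \<Omega> \<Gamma> p = 0"
    by (simp add: H1_surface_norm_vec_def esqrt_def)
  have "(\<integral>\<^sup>+x\<in>\<Gamma>. ennreal ((q j x)\<^sup>2) \<partial>surface_measure) = 0" if "j < N" for j
  proof -
    have "(\<integral>\<^sup>+x\<in>\<Gamma>. ennreal ((q j x)\<^sup>2) \<partial>surface_measure)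
      = (\<integral>\<^sup>+x. 0 \<partial>(surface_measure :: (real^'n) measure))"
      using q[OF that] by (intro nn_integral_cong) (auto simp: indicator_def)
    then show ?thesis by simp
  qed
  then show "L2_surface_norm_vec N \<Gamma> q = 0"
    by (simp add: L2_surface_norm_vec_def esqrt_def)
qed

lemma superlevel_integral_le:
  fixes f \<xi> :: "real^'n \<Rightarrow> real"
  assumes D: "open D" "bounded D" and S: "open S" "S \<subseteq> D" "\<And>x. x \<in> S \<Longrightarrow> e < \<xi> x"
    and \<xi>: "continuous_on (closure D) \<xi>" and f: "continuous_on (closure D) f" "\<And>x. 0 \<le> f x" and l: "l > 0"
  shows "(LINT x:S|lborel. f x) \<le> exp (- 2 * l * e) * (LINT x:D|lborel. f x * (carleman_weight \<xi> l x)\<^sup>2)"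
proof -
  have w: "(carleman_weight \<xi> l x)\<^sup>2 = exp (2 * l * \<xi> x)" for x
    by (simp add: carleman_weight_def power2_eq_square flip: exp_add)
  have i1: "set_integrable lborel S f"
    using set_integrable_continuous_closure[OF D f(1)] S by (rule_tac set_integrable_subset) auto
  have i2: "set_integrable lborel D (\<lambda>x. f x * (carleman_weight \<xi> l x)\<^sup>2)"
    unfolding w using \<xi> f(1) by (intro set_integrable_continuous_closure[OF D] continuous_intros)
  have "(LINT x:S|lborel. f x) \<le> (LINT x|lborel. exp (- 2 * l * e) * (indicator D x *\<^sub>R (f x * (carleman_weight \<xi> l x)\<^sup>2)))"
    unfolding set_lebesgue_integral_def
  proof (rule integral_mono)
    show "integrable lborel (\<lambda>x. indicator S x *\<^sub>R f x)" using i1 by (simp add: set_integrable_def)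
    show "integrable lborel (\<lambda>x. exp (- 2 * l * e) * (indicator D x *\<^sub>R (f x * (carleman_weight \<xi> l x)\<^sup>2)))"
      using i2 by (intro integrable_mult_right) (simp add: set_integrable_def)
    fix x
    show "indicator S x *\<^sub>R f x \<le> exp (- 2 * l * e) * (indicator D x *\<^sub>R (f x * (carleman_weight \<xi> l x)\<^sup>2))"
    proof (cases "x \<in> S")
      case True
      have "exp (- 2 * l * e) * (f x * exp (2 * l * \<xi> x)) = f x * exp (2 * l * (\<xi> x - e))"
        by (simp add: algebra_simps flip: exp_add)
      moreover have "f x * 1 \<le> f x * exp (2 * l * (\<xi> x - e))"
        using S(3)[OF True] l f(2) by (intro mult_left_mono) auto
      ultimately have "f x \<le> exp (- 2 * l * e) * (f x * exp (2 * l * \<xi> x))" by linarith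
      moreover have "x \<in> D" using True S(2) by blast
      ultimately show ?thesis using True by (simp add: w)
    next
      case False
      then show ?thesis using f(2) by (simp add: w indicator_def)
    qed
  qed
  then show ?thesis by (simp add: set_lebesgue_integral_def)
qed

text \<open>From \<open>x \<le> exp x\<close> with \<open>x = l \<delta>\<close>.\<close>

lemma square_times_exp_le:
  fixes l \<delta> :: real
  assumes "l > 0" "\<delta> > 0"
  shows "l\<^sup>2 * exp (- 2 * l * \<delta>) \<le> 1 / \<delta>\<^sup>2"
proof -
  have "l * \<delta> \<le> exp (l * \<delta>)" using exp_ge_add_one_self[of "l * \<delta>"] by linarith
  then have "(l * \<delta>)\<^sup>2 \<le> (exp (l * \<delta>))\<^sup>2" using assms by (intro power_mono) auto
  also have "\<dots> = exp (2 * l * \<delta>)" by (simp add: power2_eq_square flip: exp_add)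
  finally have "(l * \<delta>)\<^sup>2 * exp (- 2 * l * \<delta>) \<le> exp (2 * l * \<delta>) * exp (- 2 * l * \<delta>)"
    by (intro mult_right_mono) auto
  then have "l\<^sup>2 * exp (- 2 * l * \<delta>) * \<delta>\<^sup>2 \<le> 1"
    by (simp add: power_mult_distrib mult_ac flip: exp_add)
  then show ?thesis using assms by (simp add: field_simps)
qed

lemma integral_pos_of_nonzero:
  fixes f :: "real^'n \<Rightarrow> real"
  assumes S: "open S" "x0 \<in> S" and f: "continuous_on S f" "set_integrable lborel S f" "\<And>x. 0 \<le> f x" "f x0 > 0"
  shows "(LINT x:S|lborel. f x) > 0"
proof -
  obtain r1 where r1: "r1 > 0" "\<And>x. x \<in> S \<Longrightarrow> dist x x0 < r1 \<Longrightarrow> dist (f x) (f x0) < f x0 / 2"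
    using f(1,4) S(2) unfolding continuous_on_iff by (meson half_gt_zero)
  obtain r2 where r2: "r2 > 0" "ball x0 r2 \<subseteq> S" using S open_contains_ball by metis
  define r where "r = min r1 r2"
  have r: "r > 0" using r1 r2 by (simp add: r_def)
  have "0 < measure lborel (ball x0 r) * (f x0 / 2)"
    using content_ball_pos[OF r, of x0] f(4) by simp
  also have "\<dots> = (LINT x|lborel. indicator (ball x0 r) x * (f x0 / 2))" by simp
  also have "\<dots> \<le> (LINT x:S|lborel. f x)"
    unfolding set_lebesgue_integral_def
  proof (rule integral_mono)
    show "integrable lborel (\<lambda>x. indicator (ball x0 r) x * (f x0 / 2))"
      using emeasure_lborel_ball_finite[of x0 r] by (intro integrable_mult_left integrable_real_indicator) auto
    show "integrable lborel (\<lambda>x. indicator S x *\<^sub>R f x)" using f(2) by (simp add: set_integrable_def)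
    fix x
    show "indicator (ball x0 r) x * (f x0 / 2) \<le> indicator S x *\<^sub>R f x"
    proof (cases "x \<in> ball x0 r")
      case True
      then have "x \<in> S" "dist x x0 < r1" using r2(2) by (auto simp: r_def dist_commute)
      then have "f x0 / 2 \<le> f x" using r1(2)[of x] unfolding dist_real_def by linarith
      then show ?thesis using True \<open>x \<in> S\<close> by simp
    qed (use f(3) in simp)
  qed
  finally show ?thesis .
qed

theorem theorem3p1:
  fixes \<Omega> \<Gamma> :: "(real^'n) set"
    and A\<^sub>0 :: "'n multiindex \<Rightarrow> real^'n \<Rightarrow> real"
    and \<xi> :: "real^'n \<Rightarrow> real"
    and d m Z K c :: real
    and N :: nat
  assumes "bounded_domain \<Omega>" and "piecewise_smooth_boundary \<Omega>"
    and "\<And>\<alpha>. mi_order \<alpha> = 2 \<Longrightarrow> admissible_coeff \<Omega> (A\<^sub>0 \<alpha>)"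
    and "boundary_portion 2 \<Omega> \<Gamma>"
    and "\<And>T. openin (top_of_set \<Gamma>) T \<Longrightarrow> T \<noteq> {} \<Longrightarrow> \<not> characteristic_on A\<^sub>0 \<Omega> T"
    and "\<And>k. Ck_closure k \<Omega> \<xi>" and "\<And>x. x \<in> closure \<Omega> \<Longrightarrow> norm (grad \<Omega> \<xi> x) \<noteq> 0"
    and "d > 0" and "superlevel \<Omega> \<xi> d \<noteq> {}"
    and "superlevel (closure (superlevel \<Omega> \<xi> d) \<inter> frontier \<Omega>) \<xi> d = superlevel \<Gamma> \<xi> d"
    and "frontier (superlevel \<Omega> \<xi> d) = closure (level_set \<Omega> \<xi> d) \<union> closure (superlevel \<Gamma> \<xi> d)"
    and "piecewise_smooth_boundary (superlevel \<Omega> \<xi> d)"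
    and "m = (SUP x\<in>closure (superlevel \<Omega> \<xi> d). \<xi> x)"
    and "carleman_estimate A\<^sub>0 (superlevel \<Omega> \<xi> d) \<xi>"
    and "N \<ge> 2" and "Z > 0" and "K > 0"
    and "c > 0" and "superlevel \<Omega> \<xi> (d + c) \<noteq> {}"
  shows "\<exists>\<sigma>\<^sub>0 C\<^sub>2. 0 < \<sigma>\<^sub>0 \<and> \<sigma>\<^sub>0 < 1 \<and> 0 < C\<^sub>2 \<and>
    (\<forall>a V\<^sub>1 V\<^sub>2 p0\<^sub>1 p0\<^sub>2 p1\<^sub>1 p1\<^sub>2.
       (\<forall>\<alpha>. mi_order \<alpha> = 2 \<longrightarrow> a \<alpha> = A\<^sub>0 \<alpha>) \<and>
       (\<forall>\<alpha>. mi_order \<alpha> \<le> 1 \<longrightarrow> admissible_coeff \<Omega> (a \<alpha>) \<and> Ck_norm 1 \<Omega> (a \<alpha>) \<le> Z) \<and>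
       solves_cauchy_problem a N \<Omega> \<Gamma> V\<^sub>1 p0\<^sub>1 p1\<^sub>1 \<and>
       solves_cauchy_problem a N \<Omega> \<Gamma> V\<^sub>2 p0\<^sub>2 p1\<^sub>2 \<and>
       Ck_norm_vec N 1 \<Omega> V\<^sub>1 \<le> K \<and> Ck_norm_vec N 1 \<Omega> V\<^sub>2 \<le> K \<longrightarrow>
       (\<forall>\<sigma>. 0 < \<sigma> \<and> \<sigma> < \<sigma>\<^sub>0 \<and>
            H1_surface_norm_vec N \<Omega> \<Gamma> (vec_diff p0\<^sub>1 p0\<^sub>2) \<le> ennreal \<sigma> \<and>
            L2_surface_norm_vec N \<Gamma> (vec_diff p1\<^sub>1 p1\<^sub>2) \<le> ennreal \<sigma> \<longrightarrow>
            Hk_norm_vec N 1 (superlevel \<Omega> \<xi> (d + c)) (vec_diff V\<^sub>1 V\<^sub>2)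
              \<le> ennreal C\<^sub>2 * (1 + Hk_norm_vec N 2 \<Omega> (vec_diff V\<^sub>1 V\<^sub>2))
                  * ennreal (\<sigma> powr (c / (m + c)))) \<and>
       ((\<forall>j<N. \<forall>x\<in>\<Gamma>. p0\<^sub>1 j x = p0\<^sub>2 j x \<and> p1\<^sub>1 j x = p1\<^sub>2 j x) \<longrightarrow>
          (\<forall>j<N. \<forall>x\<in>superlevel \<Omega> \<xi> d. V\<^sub>1 j x = V\<^sub>2 j x)))"
proof -
  define D where "D = superlevel \<Omega> \<xi> d"
  note \<Omega> = bounded_domainD[OF assms(1)]
  have \<xi>: "continuous_on (closure \<Omega>) \<xi>" using assms(6)[of 0] by simp
  have D_sub: "D \<subseteq> \<Omega>" by (auto simp: D_def superlevel_def)
  have D: "open D" "bounded D"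
    using open_superlevel[OF \<Omega>(1) \<xi>] bounded_subset[OF \<Omega>(2) D_sub] by (auto simp: D_def)
  have \<xi>D: "continuous_on (closure D) \<xi>" using \<xi> closure_mono[OF D_sub] by (rule continuous_on_subset)
  have fin: "emeasure surface_measure (frontier D) < \<infinity>"
    using assms(12) by (auto simp: piecewise_smooth_boundary_def D_def)
  obtain b where "b > 0" "\<And>x. x \<in> closure D \<Longrightarrow> \<bar>\<xi> x\<bar> \<le> b"
    using continuous_closure_bounded[OF D(2) \<xi>D] by blast
  then have "bdd_above (\<xi> ` closure D)" by (intro bdd_aboveI[of _ b]) (auto simp: abs_le_iff)
  then have m: "\<xi> x \<le> m" if "x \<in> closure D" for x
    unfolding assms(13) D_def[symmetric] using that by (rule cSUP_upper[rotated])
  obtain xc where xc: "xc \<in> \<Omega>" "\<xi> xc > d + c" using assms(19) by (auto simp: superlevel_def)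
  then have "xc \<in> closure D" using assms(18) closure_subset by (fastforce simp: D_def superlevel_def)
  then have md: "m > d + c" using m xc by fastforce
  have mc: "m + c > 0" using md assms(8,18) by linarith
  have A0: "\<forall>\<alpha>. mi_order \<alpha> = 2 \<longrightarrow> admissible_coeff \<Omega> (A\<^sub>0 \<alpha>)" using assms(3) by blast
  show ?thesis
  proof (rule weighted_stability_estimate[OF assms(1) A0 assms(4) \<xi> D_def
        assms(10)[folded D_def] assms(11)[folded D_def] fin m assms(14)[folded D_def] assms(16,17), where N=N])
    show "x \<in> closure D" if "x \<in> closure D" for x using that .
    fix l1 C assume l1: "l1 > 1" and C: "C > 0" and est:
      "\<And>V\<^sub>1 V\<^sub>2 p0\<^sub>1 p0\<^sub>2 p1\<^sub>1 p1\<^sub>2 \<sigma> l.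
        cauchy_solution_pair A\<^sub>0 N \<Omega> \<Gamma> Z K V\<^sub>1 V\<^sub>2 p0\<^sub>1 p0\<^sub>2 p1\<^sub>1 p1\<^sub>2 \<Longrightarrow> 0 \<le> \<sigma> \<Longrightarrow>
        H1_surface_norm_vec N \<Omega> \<Gamma> (vec_diff p0\<^sub>1 p0\<^sub>2) \<le> ennreal \<sigma> \<Longrightarrow>
        L2_surface_norm_vec N \<Gamma> (vec_diff p1\<^sub>1 p1\<^sub>2) \<le> ennreal \<sigma> \<Longrightarrow> l1 \<le> l \<Longrightarrow>
        (\<Sum>j<N. LINT x:D|lborel. ((norm (grad D (vec_diff V\<^sub>1 V\<^sub>2 j) x))\<^sup>2 + (vec_diff V\<^sub>1 V\<^sub>2 j x)\<^sup>2)
            * (carleman_weight \<xi> l x)\<^sup>2)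
          \<le> C * l\<^sup>2 * (exp (2 * l * m) * \<sigma>\<^sup>2 + exp (2 * l * d))"
    define \<mu> where "\<mu> = m - d"
    have \<mu>: "\<mu> > 0" using md assms(18) by (simp add: \<mu>_def)
    define \<rho> where "\<rho> = c / (m + c)"
    \<comment> \<open>the gain of \<open>c/(m - d)\<close> over the exponent \<open>\<rho>\<close>, scaled by \<open>\<mu>\<close>; it absorbs the factor \<open>l\<^sup>2\<close>\<close>
    define \<delta> where "\<delta> = c - \<rho> * \<mu>"
    have "\<delta> = c * (c + d) / (m + c)"
      using mc by (simp add: \<delta>_def \<rho>_def \<mu>_def field_simps)
    then have \<delta>: "\<delta> > 0" using mc assms(8,18) by simp
    let ?A = "{\<alpha> :: 'n multiindex. mi_order \<alpha> \<le> 1}"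
    \<comment> \<open>the value of \<open>\<sigma>\<close> for which the balancing parameter \<open>l\<close> below equals \<open>l1\<close>\<close>
    define \<sigma>\<^sub>0 where "\<sigma>\<^sub>0 = exp (- (\<mu> * l1))"
    define C\<^sub>2 where "C\<^sub>2 = sqrt (card ?A) * (sqrt (2 * C) / \<delta>) + 1"
    have \<sigma>0: "0 < \<sigma>\<^sub>0" "\<sigma>\<^sub>0 < 1" using \<mu> l1 by (auto simp: \<sigma>\<^sub>0_def)
    have C2: "0 < C\<^sub>2" unfolding C\<^sub>2_def using C \<delta> by (intro add_nonneg_pos mult_nonneg_nonneg) auto
    have "(\<forall>\<sigma>. 0 < \<sigma> \<and> \<sigma> < \<sigma>\<^sub>0 \<and>
            H1_surface_norm_vec N \<Omega> \<Gamma> (vec_diff p0\<^sub>1 p0\<^sub>2) \<le> ennreal \<sigma> \<and>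
            L2_surface_norm_vec N \<Gamma> (vec_diff p1\<^sub>1 p1\<^sub>2) \<le> ennreal \<sigma> \<longrightarrow>
            Hk_norm_vec N 1 (superlevel \<Omega> \<xi> (d + c)) (vec_diff V\<^sub>1 V\<^sub>2)
              \<le> ennreal C\<^sub>2 * (1 + Hk_norm_vec N 2 \<Omega> (vec_diff V\<^sub>1 V\<^sub>2))
                  * ennreal (\<sigma> powr (c / (m + c)))) \<and>
       ((\<forall>j<N. \<forall>x\<in>\<Gamma>. p0\<^sub>1 j x = p0\<^sub>2 j x \<and> p1\<^sub>1 j x = p1\<^sub>2 j x) \<longrightarrow>
          (\<forall>j<N. \<forall>x\<in>superlevel \<Omega> \<xi> d. V\<^sub>1 j x = V\<^sub>2 j x))"
      if pair: "cauchy_solution_pair A\<^sub>0 N \<Omega> \<Gamma> Z K V\<^sub>1 V\<^sub>2 p0\<^sub>1 p0\<^sub>2 p1\<^sub>1 p1\<^sub>2" for V\<^sub>1 V\<^sub>2 p0\<^sub>1 p0\<^sub>2 p1\<^sub>1 p1\<^sub>2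
    proof -
      define u where "u = vec_diff V\<^sub>1 V\<^sub>2"
      define f where "f j x = (norm (grad D (u j) x))\<^sup>2 + (u j x)\<^sup>2" for j x
      have f0: "f j x \<ge> 0" for j x by (simp add: f_def)
      have u1: "Ck_closure 1 D (u j)" if "j < N" for j
      proof -
        have "Ck_closure 2 \<Omega> (V\<^sub>1 j)" "Ck_closure 2 \<Omega> (V\<^sub>2 j)"
          using pair that by (auto simp: cauchy_solution_pair_def solves_cauchy_problem_def)
        then have "Ck_closure 1 \<Omega> (u j)"
          unfolding u_def vec_diff_eq by (intro Ck_closure_diff[OF \<Omega>(1)] Ck_closure_2D(1))
        then show ?thesis by (rule Ck_closure_subset[OF D(1) D_sub \<Omega>(1)])
      qed
      have fc: "continuous_on (closure D) (f j)" if "j < N" for j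
        unfolding f_def
        using continuous_on_grad[OF u1[OF that]] Ck_closure_continuous[OF u1[OF that]] by (intro continuous_intros)
      have main: "(\<Sum>j<N. LINT x:S|lborel. f j x) \<le> exp (- 2 * l * e) * (C * l\<^sup>2 * (exp (2 * l * m) * \<sigma>\<^sup>2 + exp (2 * l * d)))"
        if S: "S = superlevel \<Omega> \<xi> e" and e: "d < e" and \<sigma>: "0 \<le> \<sigma>"
          and H1: "H1_surface_norm_vec N \<Omega> \<Gamma> (vec_diff p0\<^sub>1 p0\<^sub>2) \<le> ennreal \<sigma>"
          and L2: "L2_surface_norm_vec N \<Gamma> (vec_diff p1\<^sub>1 p1\<^sub>2) \<le> ennreal \<sigma>" and l: "l1 \<le> l" for S e \<sigma> l
      proof -
        have "(\<Sum>j<N. LINT x:S|lborel. f j x)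
            \<le> (\<Sum>j<N. exp (- 2 * l * e) * (LINT x:D|lborel. f j x * (carleman_weight \<xi> l x)\<^sup>2))"
        proof (rule sum_mono)
          fix j assume "j \<in> {..<N}"
          then show "(LINT x:S|lborel. f j x) \<le> exp (- 2 * l * e) * (LINT x:D|lborel. f j x * (carleman_weight \<xi> l x)\<^sup>2)"
            using e l l1 open_superlevel[OF \<Omega>(1) \<xi>]
            by (intro superlevel_integral_le[OF D _ _ _ \<xi>D fc f0]) (auto simp: S D_def superlevel_def)
        qed
        also have "\<dots> = exp (- 2 * l * e) * (\<Sum>j<N. LINT x:D|lborel. f j x * (carleman_weight \<xi> l x)\<^sup>2)"
          by (rule sum_distrib_left[symmetric])
        also have "\<dots> \<le> exp (- 2 * l * e) * (C * l\<^sup>2 * (exp (2 * l * m) * \<sigma>\<^sup>2 + exp (2 * l * d)))"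
          using est[OF pair \<sigma> H1 L2 l] by (intro mult_left_mono) (auto simp: f_def u_def)
        finally show ?thesis .
      qed
      have stab: "Hk_norm_vec N 1 (superlevel \<Omega> \<xi> (d + c)) (vec_diff V\<^sub>1 V\<^sub>2)
              \<le> ennreal C\<^sub>2 * (1 + Hk_norm_vec N 2 \<Omega> (vec_diff V\<^sub>1 V\<^sub>2)) * ennreal (\<sigma> powr (c / (m + c)))"
        if \<sigma>: "0 < \<sigma>" "\<sigma> < \<sigma>\<^sub>0"
          and H1: "H1_surface_norm_vec N \<Omega> \<Gamma> (vec_diff p0\<^sub>1 p0\<^sub>2) \<le> ennreal \<sigma>"
          and L2: "L2_surface_norm_vec N \<Gamma> (vec_diff p1\<^sub>1 p1\<^sub>2) \<le> ennreal \<sigma>" for \<sigma>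
      proof -
        define S where "S = superlevel \<Omega> \<xi> (d + c)"
        have S: "open S" "S \<subseteq> D"
          using open_superlevel[OF \<Omega>(1) \<xi>] assms(18) by (auto simp: S_def D_def superlevel_def)
        \<comment> \<open>balances the two terms on the right of \<open>main\<close>\<close>
        define l where "l = - ln \<sigma> / \<mu>"
        have ln\<sigma>: "ln \<sigma> = - (l * \<mu>)" using \<mu> by (simp add: l_def)
        have "ln \<sigma> < ln \<sigma>\<^sub>0" using \<sigma> by simp
        then have "ln \<sigma> < - (\<mu> * l1)" by (simp add: \<sigma>\<^sub>0_def)
        then have "\<mu> * l1 < \<mu> * l" by (simp add: ln\<sigma> mult.commute)
        then have ll: "l1 \<le> l" using \<mu> by simp
        then have l0: "l > 0" using l1 by linarith
        have \<sigma>_exp: "\<sigma> = exp (- (l * \<mu>))" using \<sigma>(1) by (simp add: ln\<sigma>[symmetric])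
        have e1: "exp (2 * l * m) * \<sigma>\<^sup>2 = exp (2 * l * d)"
          unfolding \<sigma>_exp power2_eq_square by (simp add: \<mu>_def algebra_simps flip: exp_add)
        have pw: "\<sigma> powr \<rho> = exp (- (\<rho> * (l * \<mu>)))" using \<sigma>(1) by (simp add: powr_def ln\<sigma>)
        have "(\<Sum>j<N. LINT x:S|lborel. f j x) \<le> exp (- 2 * l * (d + c)) * (C * l\<^sup>2 * (exp (2 * l * m) * \<sigma>\<^sup>2 + exp (2 * l * d)))"
          using \<sigma> assms(18) by (intro main[OF S_def _ _ H1 L2 ll]) auto
        also have "\<dots> = 2 * C * (l\<^sup>2 * (exp (- 2 * l * (d + c)) * exp (2 * l * d)))" unfolding e1 by simp
        also have "exp (- 2 * l * (d + c)) * exp (2 * l * d) = exp (- 2 * l * \<delta>) * (\<sigma> powr \<rho>)\<^sup>2"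
          unfolding pw power2_eq_square by (simp add: \<delta>_def algebra_simps flip: exp_add)
        also have "2 * C * (l\<^sup>2 * (exp (- 2 * l * \<delta>) * (\<sigma> powr \<rho>)\<^sup>2))
            = 2 * C * (l\<^sup>2 * exp (- 2 * l * \<delta>)) * (\<sigma> powr \<rho>)\<^sup>2" by simp
        also have "\<dots> \<le> 2 * C * (1 / \<delta>\<^sup>2) * (\<sigma> powr \<rho>)\<^sup>2"
          using C by (intro mult_right_mono mult_left_mono square_times_exp_le l0 \<delta>) auto
        also have "\<dots> = (sqrt (2 * C) / \<delta> * \<sigma> powr \<rho>)\<^sup>2"
          using C by (simp add: power_mult_distrib power_divide)
        finally have le: "(\<Sum>j<N. LINT x:S|lborel. f j x) \<le> (sqrt (2 * C) / \<delta> * \<sigma> powr \<rho>)\<^sup>2" .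
        have gS: "grad S (u j) x = grad D (u j) x" if "j < N" "x \<in> S" for j x
          using that closure_subset by (intro grad_subset S u1 D) blast+
        have fint: "integrable lborel (\<lambda>x. indicator S x *\<^sub>R f j x)" if "j < N" for j
          using set_integrable_subset[OF set_integrable_continuous_closure[OF D fc[OF that]], of S] S
          by (auto simp: set_integrable_def)
        have nn: "ennreal ((norm (grad S (u j) x))\<^sup>2 + (u j x)\<^sup>2) * indicator S x = ennreal (indicator S x *\<^sub>R f j x)"
          if "j < N" for j x
          using gS[OF that, of x] by (cases "x \<in> S") (auto simp: f_def)
        have "Hk_norm_vec N 1 S u \<le> ennreal (sqrt (card ?A) * (sqrt (2 * C) / \<delta> * \<sigma> powr \<rho>))"
        proof (rule Hk_norm_vec_1_le)
          show "0 \<le> sqrt (2 * C) / \<delta> * \<sigma> powr \<rho>" using C \<delta> by simp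
          show "S \<in> sets borel" using S by auto
          show "(\<lambda>x. ennreal ((norm (grad S (u j) x))\<^sup>2 + (u j x)\<^sup>2) * indicator S x) \<in> borel_measurable borel"
            if "j < N" for j
            unfolding nn[OF that] using borel_measurable_integrable[OF fint[OF that]] by simp
          have "(\<Sum>j<N. \<integral>\<^sup>+x\<in>S. ennreal ((norm (grad S (u j) x))\<^sup>2 + (u j x)\<^sup>2) \<partial>lborel)
              = (\<Sum>j<N. ennreal (LINT x:S|lborel. f j x))"
          proof (rule sum.cong)
            fix j assume "j \<in> {..<N}"
            then have j: "j < N" by simp
            show "(\<integral>\<^sup>+x\<in>S. ennreal ((norm (grad S (u j) x))\<^sup>2 + (u j x)\<^sup>2) \<partial>lborel) = ennreal (LINT x:S|lborel. f j x)"
              unfolding nn[OF j] set_lebesgue_integral_def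
              by (rule nn_integral_eq_integral[OF fint[OF j]]) (simp add: f0)
          qed simp
          also have "\<dots> = ennreal (\<Sum>j<N. LINT x:S|lborel. f j x)"
            by (intro sum_ennreal) (auto simp: set_lebesgue_integral_def f0 intro!: integral_nonneg_AE)
          also have "\<dots> \<le> ennreal ((sqrt (2 * C) / \<delta> * \<sigma> powr \<rho>)\<^sup>2)" by (rule ennreal_leI[OF le])
          finally show "(\<Sum>j<N. \<integral>\<^sup>+x\<in>S. ennreal ((norm (grad S (u j) x))\<^sup>2 + (u j x)\<^sup>2) \<partial>lborel)
            \<le> ennreal ((sqrt (2 * C) / \<delta> * \<sigma> powr \<rho>)\<^sup>2)" .
        qed
        also have "\<dots> \<le> ennreal (C\<^sub>2 * \<sigma> powr \<rho>)"
          by (intro ennreal_leI) (simp add: C\<^sub>2_def distrib_right mult.assoc)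
        also have "\<dots> = ennreal C\<^sub>2 * 1 * ennreal (\<sigma> powr \<rho>)" using C2 by (simp add: ennreal_mult)
        also have "\<dots> \<le> ennreal C\<^sub>2 * (1 + Hk_norm_vec N 2 \<Omega> u) * ennreal (\<sigma> powr \<rho>)"
          by (intro mult_right_mono mult_left_mono) auto
        finally show ?thesis by (simp add: S_def u_def \<rho>_def)
      qed
      have uniq: "V\<^sub>1 j x0 = V\<^sub>2 j x0"
        if data: "\<forall>j<N. \<forall>x\<in>\<Gamma>. p0\<^sub>1 j x = p0\<^sub>2 j x \<and> p1\<^sub>1 j x = p1\<^sub>2 j x"
          and j: "j < N" and x0: "x0 \<in> superlevel \<Omega> \<xi> d" for j x0
      proof (rule ccontr)
        assume ne: "V\<^sub>1 j x0 \<noteq> V\<^sub>2 j x0"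
        \<comment> \<open>a level strictly between \<open>d\<close> and \<open>\<xi> x0\<close>, so that the bound on \<open>{\<xi> > e}\<close> decays in \<open>l\<close>\<close>
        define e where "e = (d + \<xi> x0) / 2"
        have \<xi>x0: "x0 \<in> \<Omega>" "d < \<xi> x0" using x0 by (auto simp: superlevel_def)
        then have e: "d < e" "e < \<xi> x0" by (auto simp: e_def)
        define S where "S = superlevel \<Omega> \<xi> e"
        have S: "open S" "S \<subseteq> D" "x0 \<in> S"
          using open_superlevel[OF \<Omega>(1) \<xi>] e \<xi>x0 by (auto simp: S_def D_def superlevel_def)
        define \<eta> where "\<eta> = e - d"
        have \<eta>: "\<eta> > 0" using e by (simp add: \<eta>_def)
        have z: "H1_surface_norm_vec N \<Omega> \<Gamma> (vec_diff p0\<^sub>1 p0\<^sub>2) = 0" "L2_surface_norm_vec N \<Gamma> (vec_diff p1\<^sub>1 p1\<^sub>2) = 0"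
          using data by (intro surface_norms_zero[OF \<Omega>(1) assms(4)]; simp add: vec_diff_def)+
        \<comment> \<open>the data vanish, so \<open>main\<close> applies with \<open>\<sigma> = 0\<close> and every large \<open>l\<close>\<close>
        have bound: "(LINT x:S|lborel. f j x) \<le> (C * (4 / \<eta>\<^sup>2)) * exp (- \<eta> * l)" if l: "l1 \<le> l" for l
        proof -
          have l0: "l > 0" using l l1 by linarith
          have "(LINT x:S|lborel. f j x) \<le> (\<Sum>j<N. LINT x:S|lborel. f j x)"
            using j by (intro member_le_sum) (auto simp: set_lebesgue_integral_def f0 intro!: integral_nonneg_AE)
          also have "\<dots> \<le> exp (- 2 * l * e) * (C * l\<^sup>2 * (exp (2 * l * m) * 0\<^sup>2 + exp (2 * l * d)))"
            by (rule main[OF S_def e(1) _ _ _ l]) (auto simp: z)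
          also have "\<dots> = C * (l\<^sup>2 * (exp (- 2 * l * e) * exp (2 * l * d)))" by simp
          also have "exp (- 2 * l * e) * exp (2 * l * d) = exp (- 2 * l * (\<eta> / 2)) * exp (- \<eta> * l)"
          proof -
            have "- 2 * l * e + 2 * l * d = - 2 * l * (\<eta> / 2) + - \<eta> * l"
              by (simp add: \<eta>_def algebra_simps) (simp add: field_simps)
            then show ?thesis by (simp only: exp_add[symmetric])
          qed
          also have "C * (l\<^sup>2 * (exp (- 2 * l * (\<eta> / 2)) * exp (- \<eta> * l)))
              = C * (l\<^sup>2 * exp (- 2 * l * (\<eta> / 2))) * exp (- \<eta> * l)" by simp
          also have "\<dots> \<le> C * (1 / (\<eta> / 2)\<^sup>2) * exp (- \<eta> * l)"
            using C \<eta> by (intro mult_right_mono mult_left_mono square_times_exp_le l0) auto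
          also have "\<dots> = (C * (4 / \<eta>\<^sup>2)) * exp (- \<eta> * l)" by (simp add: power_divide)
          finally show ?thesis .
        qed
        have "filterlim (\<lambda>l. - \<eta> * l) at_bot at_top"
          using \<eta> by (intro filterlim_tendsto_neg_mult_at_bot[OF tendsto_const _ filterlim_ident]) auto
        then have "((\<lambda>l. exp (- \<eta> * l)) \<longlongrightarrow> 0) at_top"
          by (rule filterlim_compose[OF exp_at_bot])
        then have "((\<lambda>l. (C * (4 / \<eta>\<^sup>2)) * exp (- \<eta> * l)) \<longlongrightarrow> 0) at_top"
          by (rule tendsto_mult_right_zero)
        then have "(LINT x:S|lborel. f j x) \<le> 0"
          by (rule tendsto_lowerbound) (rule eventually_mono[OF eventually_ge_at_top[of l1] bound], auto)
        moreover have "(LINT x:S|lborel. f j x) > 0"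
        proof (rule integral_pos_of_nonzero[OF S(1,3)])
          show "continuous_on S (f j)"
            using fc[OF j] S(2) closure_subset by (meson continuous_on_subset order_trans)
          show "set_integrable lborel S (f j)"
            using set_integrable_subset[OF set_integrable_continuous_closure[OF D fc[OF j]], of S] S by auto
          have "u j x0 \<noteq> 0" using ne by (simp add: u_def vec_diff_def)
          then show "f j x0 > 0" by (simp add: f_def add_nonneg_pos)
        qed (rule f0)
        ultimately show False by linarith
      qed
      show ?thesis using stab uniq by blast
    qed
    then show ?thesis
      using \<sigma>0 C2 unfolding cauchy_solution_pair_def by (intro exI[of _ \<sigma>\<^sub>0] exI[of _ C\<^sub>2]) blast
  qed
qed

end
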